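(* Let $\alpha=(\alpha_1,\alpha_2,\alpha_3)\in\mathbb{R}^3$ with $|\alpha|=1$ be a rational vector, let $L>0$, and let $\mathcal{C}\subset\mathbb{T}^3$ be the straight line segment parametrised by $\gamma(t)=t\alpha$, $0\le t\le L$. Then for every positive integer $m$ that is a sum of three integer squares, the number $\mathcal{Z}$ of nodal intersections of the arithmetic random wave of energy $m$ with $\mathcal{C}$ satisfies $$\operatorname{Var}\left(\frac{\mathcal{Z}}{\sqrt m}\right)\ll \frac{\kappa(\sqrt m)}{N},$$ the implied constant depending only on $\alpha$.
   Context: $\mathbb{T}^3=\mathbb{R}^3/\mathbb{Z}^3$. For a positive integer $m$ that is a sum of three integer squares, let $\mathcal{E}=\mathcal{E}(m)=\{\mu\in\mathbb{Z}^3:\mu_1^2+\mu_2^2+\mu_3^2=m\}$ and $N=\#\mathcal{E}$. The arithmetic random wave of energy $m$ is $F(x)=N^{-1/2}\sum_{\mu\in\mathcal{E}}a_\mu e^{2\pi i\langle\mu,x\rangle}$, $x\in\mathbb{T}^3$, where the $a_\mu$ are standard complex Gaussian random variables ($\mathbb{E}a_\mu=0$, $\mathbb{E}|a_\mu|^2=1$), independent except for the relations $a_{-\mu}=\overline{a_\mu}$ (so $F$ is real-valued). $\mathcal{Z}$ denotes the number of points $x\in\mathcal{C}$ with $F(x)=0$, i.e. the number of zeros of $t\mapsto F(t\alpha)$ on $[0,L]$. A vector $\alpha$ with (say) $\alpha_1\neq0$ is called rational if $\alpha_2/\alpha_1\in\mathbb{Q}$ and $\alpha_3/\alpha_1\in\mathbb{Q}$.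 For $R>0$, $\kappa(R)$ denotes the maximal number of points of $\mathbb{Z}^3$ lying on the intersection of the sphere $\{x\in\mathbb{R}^3:|x|=R\}$ with a plane, the maximum taken over all planes in $\mathbb{R}^3$. $f\ll g$ means $f\le Cg$ for a constant $C$. *)

theory Defs
  imports "HOL-Probability.Probability"
begin

section \<open>The torus\<close>

definition integer_lattice :: "(real^3) set" where
  "integer_lattice = {x. \<forall>i. x $ i \<in> \<int>}"

quotient_type torus3 = "real^3" / "\<lambda>x y. x - y \<in> integer_lattice"
proof (rule equivpI)
  show "reflp (\<lambda>x y. x - y \<in> integer_lattice)"
    by (auto simp: reflp_def integer_lattice_def)
  show "symp (\<lambda>x y. x - y \<in> integer_lattice)"
  proof (rule sympI)
    fix x y :: "real^3"
    assume "x - y \<in> integer_lattice"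
    then have "- ((x - y) $ i) \<in> \<int>" for i
      unfolding integer_lattice_def by (intro Ints_minus) simp
    then show "y - x \<in> integer_lattice"
      by (simp add: integer_lattice_def)
  qed
  show "transp (\<lambda>x y. x - y \<in> integer_lattice)"
  proof (rule transpI)
    fix x y z :: "real^3"
    assume "x - y \<in> integer_lattice" "y - z \<in> integer_lattice"
    then have "(x - y) $ i + (y - z) $ i \<in> \<int>" for i
      unfolding integer_lattice_def by (intro Ints_add) auto
    then show "x - z \<in> integer_lattice"
      by (simp add: integer_lattice_def)
  qed
qed

lift_definition torus_point :: "real^3 \<Rightarrow> torus3" is "\<lambda>x. x" .

definition torus_segment :: "real^3 \<Rightarrow> real \<Rightarrow> torus3 set" where
  "torus_segment \<alpha> L = (\<lambda>t. torus_point (t *\<^sub>R \<alpha>)) ` {0..L}"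

definition rational_vector :: "real^3 \<Rightarrow> bool" where
  "rational_vector \<alpha> \<longleftrightarrow> (\<exists>i. \<alpha> $ i \<noteq> 0 \<and> (\<forall>j. \<alpha> $ j / \<alpha> $ i \<in> \<rat>))"


section \<open>Lattice points on spheres\<close>

definition sum_of_three_squares :: "nat \<Rightarrow> bool" where
  "sum_of_three_squares m \<longleftrightarrow> (\<exists>a b c :: int. int m = a\<^sup>2 + b\<^sup>2 + c\<^sup>2)"

definition frequencies :: "nat \<Rightarrow> (real^3) set" where
  "frequencies m =
     {\<mu> \<in> integer_lattice. (\<mu> $ 1)\<^sup>2 + (\<mu> $ 2)\<^sup>2 + (\<mu> $ 3)\<^sup>2 = real m}"

definition kappa :: "real \<Rightarrow> nat" where
  "kappa R = Max {card (integer_lattice \<inter> sphere 0 R \<inter> P) | P. affine P \<and> aff_dim P = 2}"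

lemma finite_integer_lattice_sphere: "finite (integer_lattice \<inter> sphere 0 R)"
proof (rule finite_subset)
  let ?A = "real_of_int ` {-\<lceil>R\<rceil>..\<lceil>R\<rceil>}"
  let ?f = "\<lambda>(a, b, c). vector [a, b, c] :: real^3"
  show "finite (?f ` (?A \<times> ?A \<times> ?A))"
    by (intro finite_imageI finite_cartesian_product) auto
  show "integer_lattice \<inter> sphere 0 R \<subseteq> ?f ` (?A \<times> ?A \<times> ?A)"
  proof
    fix x :: "real^3"
    assume x: "x \<in> integer_lattice \<inter> sphere 0 R"
    have "x $ i \<in> ?A" for i
    proof -
      obtain k where k: "x $ i = real_of_int k"
        using x by (auto simp: integer_lattice_def Ints_def)
      have "\<bar>x $ i\<bar> \<le> R"
        using component_le_norm_cart[of x i] x by simp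
      then have "k \<in> {-\<lceil>R\<rceil>..\<lceil>R\<rceil>}"
        unfolding k by auto linarith+
      then show ?thesis
        unfolding k by blast
    qed
    moreover have "x = ?f (x $ 1, x $ 2, x $ 3)"
      by (simp add: vec_eq_iff forall_3)
    ultimately show "x \<in> ?f ` (?A \<times> ?A \<times> ?A)"
      by blast
  qed
qed

lemma frequencies_eq: "frequencies m = integer_lattice \<inter> sphere 0 (sqrt (real m))"
proof -
  have "norm x = sqrt (real m) \<longleftrightarrow> (x $ 1)\<^sup>2 + (x $ 2)\<^sup>2 + (x $ 3)\<^sup>2 = real m"
    for x :: "real^3"
    unfolding norm_eq_sqrt_inner real_sqrt_eq_iff
    by (simp add: inner_vec_def sum_3 power2_eq_square)
  then show ?thesis
    by (simp add: frequencies_def set_eq_iff)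
qed

text \<open>The maximum in \<^const>\<open>kappa\<close> is over a finite nonempty set of numbers.\<close>

lemma kappa_set:
  shows "finite {card (integer_lattice \<inter> sphere 0 R \<inter> P) | P. affine P \<and> aff_dim P = 2}"
    and "{card (integer_lattice \<inter> sphere 0 R \<inter> P) | P. affine P \<and> aff_dim P = 2} \<noteq> {}"
proof -
  have "card (integer_lattice \<inter> sphere 0 R \<inter> P) \<le> card (integer_lattice \<inter> sphere 0 R)" for P
    by (intro card_mono finite_integer_lattice_sphere) blast
  then show "finite {card (integer_lattice \<inter> sphere 0 R \<inter> P) | P. affine P \<and> aff_dim P = 2}"
    by (intro finite_subset[OF _ finite_atMost[of "card (integer_lattice \<inter> sphere 0 R)"]]) blast
  let ?P = "{x::real^3. axis 1 1 \<bullet> x = 0}"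
  have "aff_dim ?P = 2"
    by (simp add: aff_dim_hyperplane axis_eq_0_iff)
  moreover have "affine ?P"
    by (rule affine_hyperplane)
  ultimately show "{card (integer_lattice \<inter> sphere 0 R \<inter> P) | P. affine P \<and> aff_dim P = 2} \<noteq> {}"
    by blast
qed

section \<open>The arithmetic random wave\<close>

definition standard_complex_gaussian :: "'w measure \<Rightarrow> ('w \<Rightarrow> complex) \<Rightarrow> bool" where
  "standard_complex_gaussian M X \<longleftrightarrow>
     prob_space.indep_var M borel (\<lambda>\<omega>. Re (X \<omega>)) borel (\<lambda>\<omega>. Im (X \<omega>)) \<and>
     distributed M lborel (\<lambda>\<omega>. Re (X \<omega>)) (normal_density 0 (1 / sqrt 2)) \<and>
     distributed M lborel (\<lambda>\<omega>. Im (X \<omega>)) (normal_density 0 (1 / sqrt 2))"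

text \<open>
  Independence up to the relations \<open>a (-\<mu>) = cnj (a \<mu>)\<close> means that every subfamily
  containing no two antipodal frequencies is independent.
\<close>

definition wave_coefficients ::
    "'w measure \<Rightarrow> nat \<Rightarrow> (real^3 \<Rightarrow> 'w \<Rightarrow> complex) \<Rightarrow> bool" where
  "wave_coefficients M m a \<longleftrightarrow>
     prob_space M \<and>
     (\<forall>\<mu> \<in> frequencies m. standard_complex_gaussian M (a \<mu>)) \<and>
     (\<forall>\<mu> \<in> frequencies m. \<forall>\<omega> \<in> space M. a (- \<mu>) \<omega> = cnj (a \<mu> \<omega>)) \<and>
     (\<forall>S \<subseteq> frequencies m. (\<forall>\<mu> \<in> S. - \<mu> \<notin> S) \<longrightarrow>
        prob_space.indep_vars M (\<lambda>_. borel) a S)"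

lemma exp_lattice_periodic:
  assumes "\<mu> \<in> integer_lattice" "x - y \<in> integer_lattice"
  shows "exp (2 * of_real pi * \<i> * of_real (\<mu> \<bullet> x)) = exp (2 * of_real pi * \<i> * of_real (\<mu> \<bullet> y))"
proof -
  have "\<mu> \<bullet> (x - y) \<in> \<int>"
    using assms unfolding integer_lattice_def inner_vec_def
    by (auto intro!: Ints_sum Ints_mult)
  then obtain k where "\<mu> \<bullet> x - \<mu> \<bullet> y = real_of_int k"
    by (auto simp: inner_diff_right elim: Ints_cases)
  then have "\<mu> \<bullet> x = \<mu> \<bullet> y + real_of_int k"
    by simp
  then show ?thesis
    unfolding exp_eq by (intro exI[of _ k]) (simp add: algebra_simps)
qed

text \<open>The wave for one realisation \<open>c\<close> of the coefficients.\<close>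

lift_definition wave :: "nat \<Rightarrow> (real^3 \<Rightarrow> complex) \<Rightarrow> torus3 \<Rightarrow> complex" is
  "\<lambda>m c x. (\<Sum>\<mu>\<in>frequencies m. c \<mu> * exp (2 * of_real pi * \<i> * of_real (\<mu> \<bullet> x)))
             / of_real (sqrt (real (card (frequencies m))))"
proof -
  fix m :: nat and c :: "real^3 \<Rightarrow> complex" and x y :: "real^3"
  assume xy: "x - y \<in> integer_lattice"
  have "(\<Sum>\<mu>\<in>frequencies m. c \<mu> * exp (2 * of_real pi * \<i> * of_real (\<mu> \<bullet> x))) =
        (\<Sum>\<mu>\<in>frequencies m. c \<mu> * exp (2 * of_real pi * \<i> * of_real (\<mu> \<bullet> y)))"
    by (rule sum.cong) (auto simp: frequencies_def intro!: exp_lattice_periodic[OF _ xy])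
  then show "(\<Sum>\<mu>\<in>frequencies m. c \<mu> * exp (2 * of_real pi * \<i> * of_real (\<mu> \<bullet> x)))
             / of_real (sqrt (real (card (frequencies m)))) =
        (\<Sum>\<mu>\<in>frequencies m. c \<mu> * exp (2 * of_real pi * \<i> * of_real (\<mu> \<bullet> y)))
             / of_real (sqrt (real (card (frequencies m))))"
    by simp
qed

text \<open>
  Distinct points of the segment in the torus are counted. This is the number of zeros of
  \<open>t \<mapsto> F(t \<alpha>)\<close> in \<open>[0, L]\<close> as long as the segment does not run into itself
  (\<open>nodal_intersections_eq_parameters\<close> below). In a rational direction the geodesic closes up,
  and once \<open>L\<close> exceeds its length the parameter count would count the same points repeatedly;
  for fixed \<open>m\<close> its variance can grow like \<open>L\<^sup>2\<close>, so no bound uniform in \<open>L\<close> holds for it.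
\<close>

definition nodal_intersections ::
    "nat \<Rightarrow> (real^3 \<Rightarrow> 'w \<Rightarrow> complex) \<Rightarrow> real^3 \<Rightarrow> real \<Rightarrow> 'w \<Rightarrow> nat" where
  "nodal_intersections m a \<alpha> L \<omega> =
     card {p \<in> torus_segment \<alpha> L. wave m (\<lambda>\<mu>. a \<mu> \<omega>) p = 0}"

lemma nodal_intersections_eq_parameters:
  assumes "inj_on (\<lambda>t. torus_point (t *\<^sub>R \<alpha>)) {0..L}"
  shows "nodal_intersections m a \<alpha> L \<omega> =
         card {t \<in> {0..L}. wave m (\<lambda>\<mu>. a \<mu> \<omega>) (torus_point (t *\<^sub>R \<alpha>)) = 0}"
proof -
  let ?T = "{t \<in> {0..L}. wave m (\<lambda>\<mu>. a \<mu> \<omega>) (torus_point (t *\<^sub>R \<alpha>)) = 0}"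
  have "{p \<in> torus_segment \<alpha> L. wave m (\<lambda>\<mu>. a \<mu> \<omega>) p = 0}
        = (\<lambda>t. torus_point (t *\<^sub>R \<alpha>)) ` ?T"
    by (auto simp: torus_segment_def)
  moreover have "inj_on (\<lambda>t. torus_point (t *\<^sub>R \<alpha>)) ?T"
    using assms by (rule inj_on_subset) auto
  ultimately show ?thesis
    by (simp add: nodal_intersections_def card_image)
qed

end

theory Submission
  imports Defs
begin

text \<open>
  Along a rational direction the wave is a Gaussian trigonometric polynomial \<open>f\<close> of period one whose
  coefficient at the integer frequency \<open>k\<close> collects the lattice points of the sphere on the plane
  \<open>\<mu> \<bullet> v = k\<close>; there are at most \<open>\<kappa>\<close> of them. The zeros are counted by sign changes over a grid.
  A sign change over a cell of length \<open>h\<close> says that the normalised mean and difference of the two end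
  values, which are independent Gaussians, lie in a symmetric double cone of aperture \<open>\<theta> = O(\<surd>m h)\<close>.
  If two cells have a small \<open>2 \<times> 2\<close> cross correlation matrix \<open>R\<close>, conditioning on the first pair turns
  the second event into the Gaussian measure of a cone translated by \<open>O(|R|)\<close>, which by symmetry
  changes to second order only: the covariance is \<open>O(\<theta>\<^sup>2 |R|\<^sup>2)\<close>. The strongly correlated pairs are
  grouped into macroscopic cells of length about \<open>1 / \<surd>m\<close>, in which the number of zeros has bounded second
  moment by repeated use of Rolle's theorem, and a strongly correlated pair of macroscopic cells
  contributes a fixed amount to the sum of all \<open>|R|\<^sup>2\<close>. By orthogonality that sum is
  \<open>O(n\<^sup>2 \<kappa> / N)\<close> on a grid of \<open>n\<close> points. Since almost surely \<open>f\<close> has no double zeros, refining the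
  grid gives the zero count.
\<close>

section \<open>The Gaussian measure of translated cones\<close>

text \<open>The size of the bound dictates the argument. A cell of length 1 / n has a sign change
  with probability of order K / n, where K = |v| sqrt m bounds the frequencies. The n^2 pairs of
  cells thus carry total mass K^2, and a pair may contribute only K^2 / n^2 times a quantity of
  average kappa / N. This is the average of |R|^2 and not of |R|: a covariance bound linear in the
  correlation would give only the square root of kappa / N. The second order estimate fails where
  the correlation is not small, for instance on the diagonal, where the covariance is of order K / n
  instead of K^2 / n^2. Such pairs cannot be charged one at a time. They are charged per pair of
  macroscopic cells, where all of the roughly (n / K)^2 microscopic pairs have |R|^2 bounded below.
  All constants are independent of the mesh, so that refining the grid costs nothing. To have
  independent coefficients, one frequency is kept from each antipodal pair, and the coefficients are
  rescaled so that their real and imaginary parts are standard normal.\<close>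

lemma exp_cosh_minus_one_bound:
  fixes b c :: real
  assumes "0 \<le> b"
  shows "\<bar>exp (- b / 2) * cosh c - 1\<bar> \<le> b / 2 + c\<^sup>2 * exp \<bar>c\<bar>"
proof -
  have lower: "- (b / 2) \<le> exp (- b / 2) * cosh c - 1"
  proof -
    have "1 - b / 2 \<le> exp (- b / 2)"
      using exp_ge_add_one_self[of "- b / 2"] by simp
    also have "\<dots> \<le> exp (- b / 2) * cosh c"
      using cosh_real_ge_1[of c] by (simp add: mult_le_cancel_left1)
    finally show ?thesis by simp
  qed
  have cosh_le: "cosh c - 1 \<le> c\<^sup>2 * exp \<bar>c\<bar>"
  proof -
    \<comment> \<open>With s = |c| the identity 2 (cosh s - 1) e^s = (e^s - 1)^2 reduces the claim
      to e^s - 1 \<le> s e^s, which is 1 - s \<le> e^(-s).\<close>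
    let ?s = "\<bar>c\<bar>"
    have "cosh c = cosh ?s" by (simp add: abs_if)
    moreover have "2 * (cosh ?s - 1) * exp ?s = (exp ?s - 1)\<^sup>2"
      by (simp add: cosh_field_def field_simps power2_eq_square exp_minus)
    moreover have "exp ?s - 1 \<le> ?s * exp ?s"
    proof -
      have "1 - ?s \<le> exp (- ?s)" using exp_ge_add_one_self[of "- ?s"] by simp
      then have "(1 - ?s) * exp ?s \<le> exp (- ?s) * exp ?s" by (intro mult_right_mono) auto
      then show ?thesis by (simp add: algebra_simps exp_minus)
    qed
    then have "(exp ?s - 1)\<^sup>2 \<le> (?s * exp ?s)\<^sup>2"
      by (intro power_mono) auto
    moreover have "(?s * exp ?s)\<^sup>2 = (c\<^sup>2 * exp ?s) * exp ?s"
      by (simp add: power_mult_distrib) (simp add: power2_eq_square)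
    ultimately have "2 * (cosh c - 1) * exp ?s \<le> (c\<^sup>2 * exp ?s) * exp ?s"
      by (metis mult.assoc)
    then have "2 * (cosh c - 1) \<le> c\<^sup>2 * exp ?s" by simp
    moreover have "1 * (cosh c - 1) \<le> 2 * (cosh c - 1)"
      using cosh_real_ge_1[of c] by (intro mult_right_mono) auto
    ultimately show ?thesis by simp
  qed
  have "exp (- b / 2) * cosh c \<le> 1 * cosh c"
    using assms cosh_real_ge_1[of c] by (intro mult_right_mono) auto
  moreover have "0 \<le> c\<^sup>2 * exp \<bar>c\<bar>" by simp
  ultimately show ?thesis using lower cosh_le assms by (intro abs_leI) linarith+
qed

definition gauss2 :: "real \<times> real \<Rightarrow> real" where
  "gauss2 w = exp (- (norm w)\<^sup>2 / 2) / (2 * pi)"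

lemma gauss2_eq: "gauss2 w = std_normal_density (fst w) * std_normal_density (snd w)"
  by (cases w) (simp add: gauss2_def norm_Pair normal_density_def real_sqrt_mult
      exp_add[symmetric] field_simps)

lemma gauss2_nonneg: "0 \<le> gauss2 w"
  by (simp add: gauss2_def)

lemma gauss2_measurable [measurable]: "gauss2 \<in> borel_measurable borel"
  unfolding gauss2_def by measurable

lemma gauss2_uminus [simp]: "gauss2 (- w) = gauss2 w"
  by (simp add: gauss2_def)

text \<open>The weight exp(-|w|^2 / 4) is what is left of the Gaussian after half of its exponent
  has been spent on growth factors. Divided by 2 pi it is twice a product normal density of variance
  2.\<close>

lemma gauss2_quarter_eq:
  "exp (- (norm w)\<^sup>2 / 4) / (2 * pi) =
     2 * (normal_density 0 (sqrt 2) (fst w) * normal_density 0 (sqrt 2) (snd w))"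
  by (cases w) (simp add: norm_Pair normal_density_def real_sqrt_mult
      exp_add[symmetric] field_simps)

abbreviation std_normal2 :: "(real \<times> real) measure" where
  "std_normal2 \<equiv> std_normal_distribution \<Otimes>\<^sub>M std_normal_distribution"

lemma std_normal2_eq: "std_normal2 = density lborel gauss2"
proof -
  interpret prob_space std_normal_distribution by (rule prob_space_normal_density) simp
  have "std_normal2 = density (lborel \<Otimes>\<^sub>M lborel)
      (\<lambda>(x, y). ennreal (std_normal_density x) * ennreal (std_normal_density y))"
    by (rule pair_measure_density) (auto intro: sigma_finite_measure_axioms lborel.sigma_finite_measure_axioms)
  also have "\<dots> = density lborel gauss2"
    by (simp add: lborel_prod gauss2_eq case_prod_beta' ennreal_mult'')
  finally show ?thesis .
qed

lemma integrable_normal_density_prod: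
  assumes "0 < s"
  shows "integrable lborel (\<lambda>w. normal_density 0 s (fst w) * normal_density 0 s (snd w))"
    "(\<integral>w. normal_density 0 s (fst w) * normal_density 0 s (snd w) \<partial>lborel) = 1"
proof -
  have *: "has_bochner_integral (lborel \<Otimes>\<^sub>M lborel)
     (\<lambda>w. normal_density 0 s (fst w) * normal_density 0 s (snd w)) 1"
  proof (rule has_bochner_integral_nn_integral)
    show "(\<integral>\<^sup>+ w. ennreal (normal_density 0 s (fst w) * normal_density 0 s (snd w)) \<partial>(lborel \<Otimes>\<^sub>M lborel)) = ennreal 1"
    proof -
      have one: "(\<integral>\<^sup>+ x. ennreal (normal_density 0 s x) \<partial>lborel) = 1"
        using assms integral_normal_density[OF assms, of 0] integrable_normal_density[OF assms, of 0]
        by (subst nn_integral_eq_integral) auto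
      have "(\<integral>\<^sup>+ w. ennreal (normal_density 0 s (fst w) * normal_density 0 s (snd w)) \<partial>(lborel \<Otimes>\<^sub>M lborel))
        = (\<integral>\<^sup>+ x. \<integral>\<^sup>+ y. ennreal (normal_density 0 s x) * ennreal (normal_density 0 s y) \<partial>lborel \<partial>lborel)"
        by (subst lborel.nn_integral_fst[symmetric]) (auto simp: ennreal_mult'')
      also have "\<dots> = 1"
        by (simp add: nn_integral_cmult one)
      finally show ?thesis by simp
    qed
  qed (auto)
  then show "integrable lborel (\<lambda>w. normal_density 0 s (fst w) * normal_density 0 s (snd w))"
    "(\<integral>w. normal_density 0 s (fst w) * normal_density 0 s (snd w) \<partial>lborel) = 1"
    by (auto simp: lborel_prod has_bochner_integral_iff)
qed

lemma integrable_gauss_quarter: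
  "integrable lborel (\<lambda>w :: real \<times> real. exp (- (norm w)\<^sup>2 / 4) / (2 * pi))"
  "(\<integral>w. exp (- (norm (w :: real \<times> real))\<^sup>2 / 4) / (2 * pi) \<partial>lborel) = 2"
  unfolding gauss2_quarter_eq using integrable_normal_density_prod[of "sqrt 2"] by auto

lemma integrable_gauss2: "integrable lborel gauss2"
  using integrable_normal_density_prod(1)[of 1] by (simp add: gauss2_eq[abs_def])

lemma double_cone_sets [measurable]: "{w :: real \<times> real. \<bar>fst w\<bar> < \<tau> * \<bar>snd w\<bar>} \<in> sets borel"
  by (intro borel_open open_Collect_less continuous_intros)

lemma double_cone_indicator_measurable [measurable]:
  "(\<lambda>w :: real \<times> real. indicator {w. \<bar>fst w\<bar> < \<tau> * \<bar>snd w\<bar>} w :: real) \<in> borel_measurable borel"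
  by (rule borel_measurable_indicator) (rule double_cone_sets)

text \<open>At height y the cone is an interval of length 2 \<tau> |y|, so the integral is \<tau>
  times a first absolute moment. The factor |y| is absorbed by weakening exp(-y^2 / 4) to exp(-y^2 /
  8), which leaves a multiple of the normal density of standard deviation 2.\<close>

lemma double_cone_integral:
  assumes "0 \<le> \<tau>"
  shows "(\<integral>w. indicator {w. \<bar>fst w\<bar> < \<tau> * \<bar>snd w\<bar>} w * (exp (- (norm (w :: real \<times> real))\<^sup>2 / 4) / (2 * pi)) \<partial>lborel)
          \<le> 4 * \<tau>" (is "?I \<le> _")
proof -
  let ?f = "\<lambda>w :: real \<times> real. indicator {w. \<bar>fst w\<bar> < \<tau> * \<bar>snd w\<bar>} w * (exp (- (norm w)\<^sup>2 / 4) / (2 * pi))"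
  have abs_le: "\<bar>y\<bar> * exp (- y\<^sup>2 / 4) \<le> 2 * exp (- y\<^sup>2 / 8)" for y :: real
  proof -
    have "\<bar>y\<bar> \<le> 2 * (1 + y\<^sup>2 / 8)"
      using zero_le_power2[of "\<bar>y\<bar> / 2 - 1"] by (simp add: power2_eq_square algebra_simps)
    also have "\<dots> \<le> 2 * exp (y\<^sup>2 / 8)" by (intro mult_left_mono exp_ge_add_one_self) simp
    finally have "\<bar>y\<bar> * exp (- y\<^sup>2 / 4) \<le> 2 * exp (y\<^sup>2 / 8) * exp (- y\<^sup>2 / 4)"
      by (intro mult_right_mono) auto
    also have "\<dots> = 2 * exp (- y\<^sup>2 / 8)"
      by (simp add: exp_add[symmetric])
    finally show ?thesis .
  qed
  have sqrt8: "sqrt (8 * pi) \<le> 6"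
    using pi_less_4 by (intro real_le_lsqrt) auto
  have e8: "exp (- y\<^sup>2 / 8) = sqrt (8 * pi) * normal_density 0 2 y" for y :: real
    by (simp add: normal_density_def field_simps)
  have one: "(\<integral>\<^sup>+ x. ennreal (normal_density 0 2 x) \<partial>lborel) = 1"
    using integral_normal_density[of 2 0] integrable_normal_density[of 2 0]
    by (subst nn_integral_eq_integral) auto
  have inner: "(\<integral>\<^sup>+ x. ennreal (?f (x, y)) \<partial>lborel) \<le> ennreal (4 * \<tau> * normal_density 0 2 y)" for y
  proof -
    have "(\<integral>\<^sup>+ x. ennreal (?f (x, y)) \<partial>lborel)
        \<le> (\<integral>\<^sup>+ x. ennreal (exp (- y\<^sup>2 / 4) / (2 * pi)) * indicator {- (\<tau> * \<bar>y\<bar>)..\<tau> * \<bar>y\<bar>} x \<partial>lborel)"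
      by (intro nn_integral_mono)
        (auto simp: indicator_def norm_Pair intro!: ennreal_leI divide_right_mono)
    also have "\<dots> = ennreal (exp (- y\<^sup>2 / 4) / (2 * pi)) * ennreal (2 * (\<tau> * \<bar>y\<bar>))"
      using assms by (subst nn_integral_cmult_indicator) auto
    also have "\<dots> = ennreal (exp (- y\<^sup>2 / 4) / (2 * pi) * (2 * (\<tau> * \<bar>y\<bar>)))"
      using assms by (subst ennreal_mult[symmetric]) auto
    also have "\<dots> \<le> ennreal (4 * \<tau> * normal_density 0 2 y)"
    proof (rule ennreal_leI)
      have "exp (- y\<^sup>2 / 4) / (2 * pi) * (2 * (\<tau> * \<bar>y\<bar>)) = (\<tau> / pi) * (\<bar>y\<bar> * exp (- y\<^sup>2 / 4))"
        by (simp add: field_simps)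
      also have "\<dots> \<le> (\<tau> / pi) * (2 * exp (- y\<^sup>2 / 8))"
        using assms abs_le by (intro mult_left_mono) auto
      also have "\<dots> = (2 * sqrt (8 * pi) / pi) * (\<tau> * normal_density 0 2 y)"
        unfolding e8 by simp
      also have "\<dots> \<le> 4 * (\<tau> * normal_density 0 2 y)"
        using assms sqrt8 pi_gt3 by (intro mult_right_mono) (auto simp: field_simps)
      finally show "exp (- y\<^sup>2 / 4) / (2 * pi) * (2 * (\<tau> * \<bar>y\<bar>)) \<le> 4 * \<tau> * normal_density 0 2 y"
        by simp
    qed
    finally show ?thesis .
  qed
  have "(\<integral>\<^sup>+ w. ennreal (?f w) \<partial>lborel) = (\<integral>\<^sup>+ w. ennreal (?f w) \<partial>(lborel \<Otimes>\<^sub>M lborel))"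
    by (simp add: lborel_prod)
  also have "\<dots> = (\<integral>\<^sup>+ y. \<integral>\<^sup>+ x. ennreal (?f (x, y)) \<partial>lborel \<partial>lborel)"
    by (rule lborel_pair.nn_integral_snd[symmetric]) (simp add: lborel_prod)
  also have "\<dots> \<le> (\<integral>\<^sup>+ y. ennreal (4 * \<tau> * normal_density 0 2 y) \<partial>lborel)"
    by (intro nn_integral_mono inner)
  also have "\<dots> = (\<integral>\<^sup>+ y. ennreal (4 * \<tau>) * ennreal (normal_density 0 2 y) \<partial>lborel)"
    using assms by (simp add: ennreal_mult'')
  also have "\<dots> = ennreal (4 * \<tau>)"
    by (simp add: nn_integral_cmult one)
  finally have "(\<integral>\<^sup>+ w. ennreal (?f w) \<partial>lborel) \<le> ennreal (4 * \<tau>)" .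
  then show ?thesis
    using assms by (subst integral_eq_nn_integral) (auto intro!: enn2real_leI)
qed

text \<open>Averaging over the shifts z and -z cancels the term linear in z: the ratio to
  \<open>gauss2 w\<close> is exp(-|z|^2 / 2) cosh(w . z) = 1 + O(|z|^2). The parameter r will be the
  length of the point on which one conditions; growth in r and in w is paid for by exponential
  weights.\<close>

lemma gauss2_shift_bound:
  assumes "0 \<le> \<epsilon>" "\<epsilon> \<le> 1 / 4" "norm z \<le> \<epsilon> * r" "0 \<le> r"
  shows "\<bar>(gauss2 (w - z) + gauss2 (w + z)) / 2 - gauss2 w\<bar>
     \<le> 68 * \<epsilon>\<^sup>2 * exp (r\<^sup>2 / 4) * (exp (- (norm w)\<^sup>2 / 4) / (2 * pi))"
proof -
  let ?b = "(norm z)\<^sup>2" and ?c = "inner w z" and ?g = "norm w"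
  have sq: "r\<^sup>2 \<le> 8 * exp (r\<^sup>2 / 8)" for r :: real
    using exp_ge_add_one_self[of "r\<^sup>2 / 8"] by linarith
  have n1: "(norm (w - z))\<^sup>2 = ?g\<^sup>2 + ?b - 2 * ?c"
    by (simp add: power2_norm_eq_inner algebra_simps inner_commute)
  have n2: "(norm (w + z))\<^sup>2 = ?g\<^sup>2 + ?b + 2 * ?c"
    by (simp add: power2_norm_eq_inner algebra_simps inner_commute)
  have m1: "gauss2 (w - z) = gauss2 w * exp (- ?b / 2) * exp ?c"
    unfolding gauss2_def n1 by (simp add: exp_add[symmetric] field_simps)
  have m2: "gauss2 (w + z) = gauss2 w * exp (- ?b / 2) * exp (- ?c)"
    unfolding gauss2_def n2 by (simp add: exp_add[symmetric] field_simps)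
  have eq: "(gauss2 (w - z) + gauss2 (w + z)) / 2 - gauss2 w = gauss2 w * (exp (- ?b / 2) * cosh ?c - 1)"
    unfolding m1 m2 cosh_field_def by (simp add: field_simps)
  have c: "\<bar>?c\<bar> \<le> \<epsilon> * (?g * r)"
  proof -
    have "\<bar>?c\<bar> \<le> ?g * norm z" by (rule Cauchy_Schwarz_ineq2)
    also have "\<dots> \<le> ?g * (\<epsilon> * r)" using assms by (intro mult_left_mono) auto
    finally show ?thesis by (simp add: mult_ac)
  qed
  \<comment> \<open>\<epsilon> \<le> 1/4 enters here: exp|w . z| costs only |w|^2 / 8 and r^2 / 8 in
    the exponent, and the polynomial factors may then use up another eighth of each.\<close>
  have c8: "\<bar>?c\<bar> \<le> ?g\<^sup>2 / 8 + r\<^sup>2 / 8"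
  proof -
    have "\<epsilon> * (?g * r) \<le> 1 / 4 * (?g * r)" using assms by (intro mult_right_mono) auto
    also have "\<dots> \<le> ?g\<^sup>2 / 8 + r\<^sup>2 / 8"
      using zero_le_power2[of "?g - r"] by (simp add: power2_eq_square algebra_simps)
    finally show ?thesis using c by simp
  qed
  have ee: "exp \<bar>?c\<bar> \<le> exp (?g\<^sup>2 / 8) * exp (r\<^sup>2 / 8)"
    using c8 by (simp add: exp_add[symmetric])
  have c2: "?c\<^sup>2 \<le> \<epsilon>\<^sup>2 * (?g\<^sup>2 * r\<^sup>2)"
  proof -
    have "\<bar>?c\<bar>\<^sup>2 \<le> (\<epsilon> * (?g * r))\<^sup>2" using c by (intro power_mono) auto
    then show ?thesis by (simp add: power_mult_distrib)
  qed
  have b: "?b \<le> \<epsilon>\<^sup>2 * r\<^sup>2"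
    using power_mono[OF assms(3), of 2] by (simp add: power_mult_distrib)
  have e4: "exp (x\<^sup>2 / 8) * exp (x\<^sup>2 / 8) = exp (x\<^sup>2 / 4)" for x :: real
    by (simp add: exp_add[symmetric])
  \<comment> \<open>The constant 68 is 4 + 64: each square x^2 is at most 8 exp(x^2 / 8), giving 8 /
    2 for the first term and 8 times 8 for the second.\<close>
  have "\<bar>exp (- ?b / 2) * cosh ?c - 1\<bar> \<le> ?b / 2 + ?c\<^sup>2 * exp \<bar>?c\<bar>"
    by (rule exp_cosh_minus_one_bound) simp
  also have "\<dots> \<le> \<epsilon>\<^sup>2 * (4 * (exp (r\<^sup>2 / 4) * exp (?g\<^sup>2 / 4)))
      + \<epsilon>\<^sup>2 * (64 * (exp (r\<^sup>2 / 4) * exp (?g\<^sup>2 / 4)))"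
  proof (rule add_mono)
    have "r\<^sup>2 \<le> 8 * exp (r\<^sup>2 / 8)" by (rule sq)
    also have "\<dots> \<le> 8 * (exp (r\<^sup>2 / 4) * exp (?g\<^sup>2 / 4))"
      by (simp add: exp_add[symmetric])
    finally have "\<epsilon>\<^sup>2 * r\<^sup>2 \<le> \<epsilon>\<^sup>2 * (8 * (exp (r\<^sup>2 / 4) * exp (?g\<^sup>2 / 4)))"
      by (intro mult_left_mono) auto
    then show "?b / 2 \<le> \<epsilon>\<^sup>2 * (4 * (exp (r\<^sup>2 / 4) * exp (?g\<^sup>2 / 4)))"
      using b by simp
    have "?c\<^sup>2 * exp \<bar>?c\<bar> \<le> (\<epsilon>\<^sup>2 * (?g\<^sup>2 * r\<^sup>2)) * (exp (?g\<^sup>2 / 8) * exp (r\<^sup>2 / 8))"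
      by (intro mult_mono c2 ee) auto
    also have "\<dots> \<le> (\<epsilon>\<^sup>2 * ((8 * exp (?g\<^sup>2 / 8)) * (8 * exp (r\<^sup>2 / 8)))) * (exp (?g\<^sup>2 / 8) * exp (r\<^sup>2 / 8))"
      by (intro mult_right_mono mult_left_mono mult_mono sq) auto
    also have "\<dots> = \<epsilon>\<^sup>2 * (64 * ((exp (r\<^sup>2 / 8) * exp (r\<^sup>2 / 8)) * (exp (?g\<^sup>2 / 8) * exp (?g\<^sup>2 / 8))))"
      by (simp add: mult_ac)
    also have "\<dots> = \<epsilon>\<^sup>2 * (64 * (exp (r\<^sup>2 / 4) * exp (?g\<^sup>2 / 4)))" unfolding e4 ..
    finally show "?c\<^sup>2 * exp \<bar>?c\<bar> \<le> \<epsilon>\<^sup>2 * (64 * (exp (r\<^sup>2 / 4) * exp (?g\<^sup>2 / 4)))" .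
  qed
  finally have "\<bar>exp (- ?b / 2) * cosh ?c - 1\<bar> \<le> 68 * \<epsilon>\<^sup>2 * exp (r\<^sup>2 / 4) * exp (?g\<^sup>2 / 4)"
    by simp
  then have "gauss2 w * \<bar>exp (- ?b / 2) * cosh ?c - 1\<bar> \<le> gauss2 w * (68 * \<epsilon>\<^sup>2 * exp (r\<^sup>2 / 4) * exp (?g\<^sup>2 / 4))"
    by (intro mult_left_mono gauss2_nonneg)
  also have "\<dots> = 68 * \<epsilon>\<^sup>2 * exp (r\<^sup>2 / 4) * (exp (- ?g\<^sup>2 / 4) / (2 * pi))"
    by (simp add: gauss2_def exp_add[symmetric])
  finally show ?thesis
    unfolding eq abs_mult using gauss2_nonneg[of w] by simp
qed


text \<open>The reflection of w to -w preserves the symmetric set and turns the shift by z into the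
  shift by -z, so the two shifted densities may be averaged. This is the source of the second order
  gain.\<close>

lemma std_normal2_translate:
  assumes [measurable]: "A \<in> sets borel" and symm: "\<And>w. - w \<in> A \<longleftrightarrow> w \<in> A"
  shows "measure std_normal2 {g. g + z \<in> A} =
    (\<integral>w. indicator A w * ((gauss2 (w - z) + gauss2 (w + z)) / 2) \<partial>lborel)"
    and "integrable lborel (\<lambda>w. indicator A w * ((gauss2 (w - z) + gauss2 (w + z)) / 2))"
proof -
  have sh: "integrable lborel (\<lambda>w. gauss2 (w + y))" for y
    using lborel_integrable_real_affine integrable_gauss2
    by (subst (asm) lborel_distr_plus[of y, symmetric], subst (asm) integrable_distr_eq) (auto simp: add.commute)
  have int: "integrable lborel (\<lambda>w. indicator A w * gauss2 (w + y))" for y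
    by (rule Bochner_Integration.integrable_bound[OF sh[of y]])
      (auto simp: indicator_def gauss2_nonneg)
  have m: "measure std_normal2 {g. g + z \<in> A} = (\<integral>w. indicator A w * gauss2 (w - z) \<partial>lborel)"
  proof -
    have [measurable]: "{g. g + z \<in> A} \<in> sets borel"
      using measurable_sets_borel[of "\<lambda>g. g + z" borel A] by (simp add: vimage_def)
    have "measure std_normal2 {g. g + z \<in> A} = (\<integral>g. indicator {g. g + z \<in> A} g \<partial>density lborel gauss2)"
      unfolding std_normal2_eq by simp
    also have "\<dots> = (\<integral>g. gauss2 g * indicator {g. g + z \<in> A} g \<partial>lborel)"
      by (subst integral_density) (auto simp: gauss2_nonneg)
    also have "\<dots> = (\<integral>g. indicator A (z + g) * gauss2 ((z + g) - z) \<partial>lborel)"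
      by (intro Bochner_Integration.integral_cong) (auto simp: indicator_def add.commute)
    also have "\<dots> = (\<integral>w. indicator A w * gauss2 (w - z) \<partial>(distr lborel borel ((+) z)))"
      by (subst integral_distr) auto
    finally show ?thesis by (simp only: lborel_distr_plus)
  qed
  have neg: "distr lborel borel (uminus :: real \<times> real \<Rightarrow> _) = lborel"
    using lborel_affine[of "-1 :: real" "0 :: real \<times> real"] by (simp add: density_1)
  have r: "(\<integral>w. indicator A w * gauss2 (w - z) \<partial>lborel) = (\<integral>w. indicator A w * gauss2 (w + z) \<partial>lborel)"
  proof -
    have "(\<integral>w. indicator A w * gauss2 (w - z) \<partial>lborel)
       = (\<integral>w. indicator A w * gauss2 (w - z) \<partial>(distr lborel borel uminus))"
      by (simp only: neg)
    also have "\<dots> = (\<integral>w. indicator A (- w) * gauss2 (- w - z) \<partial>lborel)"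
      by (subst integral_distr) auto
    also have "\<dots> = (\<integral>w. indicator A w * gauss2 (w + z) \<partial>lborel)"
      using gauss2_uminus[of "w + z" for w]
      by (intro Bochner_Integration.integral_cong) (auto simp: indicator_def symm)
    finally show ?thesis .
  qed
  show "integrable lborel (\<lambda>w. indicator A w * ((gauss2 (w - z) + gauss2 (w + z)) / 2))"
    using Bochner_Integration.integrable_add[OF int[of "- z"] int[of z]]
    by (simp add: distrib_left[symmetric])
  have "(\<integral>w. indicator A w * ((gauss2 (w - z) + gauss2 (w + z)) / 2) \<partial>lborel)
     = (\<integral>w. indicator A w * gauss2 (w - z) + indicator A w * gauss2 (w + z) \<partial>lborel) / 2"
    by (simp add: distrib_left[symmetric])
  also have "\<dots> = (\<integral>w. indicator A w * gauss2 (w - z) \<partial>lborel)"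
    using int[of "- z"] int[of z] by (subst Bochner_Integration.integral_add) (auto simp: r)
  finally show "measure std_normal2 {g. g + z \<in> A} =
    (\<integral>w. indicator A w * ((gauss2 (w - z) + gauss2 (w + z)) / 2) \<partial>lborel)"
    by (simp add: m)
qed

text \<open>The pointwise gain \<epsilon>^2 is integrated over the surrounding cone, which supplies
  the factor \<tau>; 272 is 68 times the 4 of the cone integral.\<close>

lemma std_normal2_cone_translate:
  assumes [measurable]: "A \<in> sets borel" and symm: "\<And>w. - w \<in> A \<longleftrightarrow> w \<in> A"
    and cone: "A \<subseteq> {w. \<bar>fst w\<bar> < \<tau> * \<bar>snd w\<bar>}" "0 \<le> \<tau>"
    and z: "0 \<le> \<epsilon>" "\<epsilon> \<le> 1 / 4" "norm z \<le> \<epsilon> * r" "0 \<le> r"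
  shows "\<bar>measure std_normal2 {g. g + z \<in> A} - measure std_normal2 A\<bar> \<le> 272 * \<tau> * \<epsilon>\<^sup>2 * exp (r\<^sup>2 / 4)"
proof -
  let ?C = "{w :: real \<times> real. \<bar>fst w\<bar> < \<tau> * \<bar>snd w\<bar>}"
  let ?e = "\<lambda>w :: real \<times> real. exp (- (norm w)\<^sup>2 / 4) / (2 * pi)"
  let ?K = "68 * \<epsilon>\<^sup>2 * exp (r\<^sup>2 / 4)"
  note i1 = std_normal2_translate[OF assms(1) symm, of z]
  note i0 = std_normal2_translate[OF assms(1) symm, of 0]
  have intC: "integrable lborel (\<lambda>w. indicator ?C w * ?e w)"
    by (rule Bochner_Integration.integrable_bound[OF integrable_gauss_quarter(1)])
      (measurable, auto simp: indicator_def)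
  have "measure std_normal2 {g. g + z \<in> A} - measure std_normal2 A
    = (\<integral>w. indicator A w * ((gauss2 (w - z) + gauss2 (w + z)) / 2)
        - indicator A w * ((gauss2 (w - 0) + gauss2 (w + 0)) / 2) \<partial>lborel)"
    using i1 i0 by (subst Bochner_Integration.integral_diff) auto
  then have "\<bar>measure std_normal2 {g. g + z \<in> A} - measure std_normal2 A\<bar>
    = \<bar>\<integral>w. indicator A w * ((gauss2 (w - z) + gauss2 (w + z)) / 2)
        - indicator A w * ((gauss2 (w - 0) + gauss2 (w + 0)) / 2) \<partial>lborel\<bar>"
    by (rule arg_cong)
  also have "\<dots> \<le> (\<integral>w. ?K * (indicator ?C w * ?e w) \<partial>lborel)"
  proof (rule order_trans[OF integral_abs_bound], rule integral_mono)
    show "integrable lborel (\<lambda>w. \<bar>indicator A w * ((gauss2 (w - z) + gauss2 (w + z)) / 2)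
        - indicator A w * ((gauss2 (w - 0) + gauss2 (w + 0)) / 2)\<bar>)"
      using i1 i0 by (intro integrable_abs Bochner_Integration.integrable_diff)
    show "integrable lborel (\<lambda>w. ?K * (indicator ?C w * ?e w))"
      by (intro Bochner_Integration.integrable_mult_right intC)
    fix w
    show "\<bar>indicator A w * ((gauss2 (w - z) + gauss2 (w + z)) / 2)
        - indicator A w * ((gauss2 (w - 0) + gauss2 (w + 0)) / 2)\<bar> \<le> ?K * (indicator ?C w * ?e w)"
    proof (cases "w \<in> A")
      case True
      then have "indicator ?C w = (1 :: real)" using cone(1) by auto
      then show ?thesis
        using gauss2_shift_bound[OF z, of w] True
        by (simp only: indicator_simps(1) mult_1 diff_0_right add_0_right field_sum_of_halves add_divide_distrib)
    next
      case False
      then have "indicator A w = (0 :: real)" by simp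
      moreover have "0 \<le> ?K * (indicator ?C w * ?e w)"
        by (intro mult_nonneg_nonneg) (simp_all only: indicator_pos_le zero_le_power2 exp_ge_zero divide_nonneg_nonneg
          zero_le_numeral pi_ge_zero mult_nonneg_nonneg)
      ultimately show ?thesis by (simp only: mult_zero_left diff_self abs_zero)
    qed
  qed
  also have "\<dots> = ?K * (\<integral>w. indicator ?C w * ?e w \<partial>lborel)"
    by (rule integral_mult_right_zero)
  also have "\<dots> \<le> ?K * (4 * \<tau>)"
    using double_cone_integral[OF cone(2)] by (intro mult_left_mono) auto
  finally show ?thesis by (simp add: mult_ac)
qed

lemma prob_space_std_normal2: "prob_space std_normal2"
proof -
  interpret A: prob_space std_normal_distribution by (rule prob_space_normal_density) simp
  interpret pair_prob_space std_normal_distribution std_normal_distribution ..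
  show ?thesis by (rule prob_space_axioms)
qed

lemma gauss2_exp_quarter: "gauss2 w * exp ((norm w)\<^sup>2 / 4) = exp (- (norm w)\<^sup>2 / 4) / (2 * pi)"
  by (simp add: gauss2_def exp_add[symmetric])

text \<open>
  The second factor is a translate of a symmetric cone by a small vector depending linearly on the
  first point. As the cone is symmetric, its Gaussian measure changes only to second order in the
  translation, which gives \<open>\<epsilon>\<^sup>2\<close> and not just \<open>\<epsilon>\<close>.
\<close>

lemma cone_covariance:
  assumes A: "A \<in> sets borel" "A \<subseteq> {w. \<bar>fst w\<bar> < \<theta> * \<bar>snd w\<bar>}"
    and B: "B \<in> sets borel" "\<And>w. - w \<in> B \<longleftrightarrow> w \<in> B" "B \<subseteq> {w. \<bar>fst w\<bar> < 2 * \<theta> * \<bar>snd w\<bar>}"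
    and \<theta>: "0 \<le> \<theta>" and \<epsilon>: "0 \<le> \<epsilon>" "\<epsilon> \<le> 1 / 4"
    and z: "z \<in> borel_measurable borel" "\<And>u. norm (z u) \<le> \<epsilon> * norm u"
  shows "measure (std_normal2 \<Otimes>\<^sub>M std_normal2) {w. fst w \<in> A \<and> snd w + z (fst w) \<in> B}
      - measure std_normal2 A * measure (std_normal2 \<Otimes>\<^sub>M std_normal2) {w. snd w + z (fst w) \<in> B}
      \<le> 6528 * \<epsilon>\<^sup>2 * \<theta>\<^sup>2"
proof -
  interpret N: prob_space std_normal2 by (rule prob_space_std_normal2)
  interpret NN: pair_prob_space std_normal2 std_normal2 ..
  note [measurable] = A(1) B(1) z(1)
  have sets_N [measurable_cong]: "sets std_normal2 = sets borel"
    unfolding std_normal2_eq by simp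
  have space_N: "space std_normal2 = UNIV" unfolding std_normal2_eq by simp
  define h where "h u = measure std_normal2 {g. g + z u \<in> B}" for u
  let ?q = "\<lambda>u :: real \<times> real. exp ((norm u)\<^sup>2 / 4)"
  \<comment> \<open>544 = 272 * 2, because \<open>B\<close> lies in a cone of aperture 2
    \<theta>.\<close>
  let ?K = "544 * \<theta> * \<epsilon>\<^sup>2"
  have meas: "{w \<in> space (std_normal2 \<Otimes>\<^sub>M std_normal2). snd w + z (fst w) \<in> B} \<in> sets (std_normal2 \<Otimes>\<^sub>M std_normal2)"
    by measurable
  have measA: "{w \<in> space (std_normal2 \<Otimes>\<^sub>M std_normal2). fst w \<in> A \<and> snd w + z (fst w) \<in> B} \<in> sets (std_normal2 \<Otimes>\<^sub>M std_normal2)"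
    by measurable
  have fubini: "measure (std_normal2 \<Otimes>\<^sub>M std_normal2) S = (\<integral>u. measure std_normal2 (Pair u -` S) \<partial>std_normal2)"
    if S: "S \<in> sets (std_normal2 \<Otimes>\<^sub>M std_normal2)" for S
  proof -
    have "integrable (std_normal2 \<Otimes>\<^sub>M std_normal2) (indicator S :: _ \<Rightarrow> real)"
      using S by (simp add: NN.P.emeasure_eq_measure)
    from NN.integral_fst'[OF this]
    have "measure (std_normal2 \<Otimes>\<^sub>M std_normal2) S = (\<integral>u. (\<integral>g. indicator S (u, g) \<partial>std_normal2) \<partial>std_normal2)"
      using S by simp
    also have "\<dots> = (\<integral>u. (\<integral>g. indicator (Pair u -` S) g \<partial>std_normal2) \<partial>std_normal2)"
      by (simp add: indicator_def)
    also have "\<dots> = (\<integral>u. measure std_normal2 (Pair u -` S) \<partial>std_normal2)"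
      using sets_Pair1[OF S] by simp
    finally show ?thesis .
  qed
  have e1: "measure (std_normal2 \<Otimes>\<^sub>M std_normal2) {w. snd w + z (fst w) \<in> B} = (\<integral>u. h u \<partial>std_normal2)"
    using fubini[OF meas] by (simp add: h_def space_pair_measure space_N vimage_def)
  have e2: "measure (std_normal2 \<Otimes>\<^sub>M std_normal2) {w. fst w \<in> A \<and> snd w + z (fst w) \<in> B}
     = (\<integral>u. indicator A u * h u \<partial>std_normal2)"
    using fubini[OF measA]
    by (simp add: h_def space_pair_measure space_N vimage_def)
      (intro Bochner_Integration.integral_cong, auto simp: indicator_def)
  have h_meas [measurable]: "h \<in> borel_measurable borel"
  proof -
    have "(\<lambda>u. measure std_normal2 (Pair u -` {w \<in> space (std_normal2 \<Otimes>\<^sub>M std_normal2). snd w + z (fst w) \<in> B}))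
       \<in> borel_measurable std_normal2"
      using N.measurable_emeasure_Pair[OF meas] unfolding measure_def by measurable
    then show ?thesis
      using measurable_cong_sets[OF sets_N refl]
      by (simp add: h_def[abs_def] space_pair_measure space_N vimage_def)
  qed
  have h_int: "integrable std_normal2 h"
    by (rule N.integrable_const_bound[of _ 1]) (auto simp: h_def)
  let ?h0 = "measure std_normal2 B"
  have hd: "\<bar>h u - ?h0\<bar> \<le> ?K * ?q u" for u
    using std_normal2_cone_translate[OF B(1) B(2) B(3) _ \<epsilon> z(2)[of u]] \<theta>
    by (simp add: h_def mult_ac)
  \<comment> \<open>The translation bound grows like exp(|u|^2 / 4) in the conditioned point, and
    this still has finite mean under the density exp(-|u|^2 / 2) / (2 pi).\<close>
  have q_int: "integrable std_normal2 ?q" and q_val: "(\<integral>u. ?q u \<partial>std_normal2) = 2"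
    unfolding std_normal2_eq using integrable_gauss_quarter
    by (auto simp: integrable_density integral_density gauss2_nonneg gauss2_exp_quarter)
  let ?C = "{w :: real \<times> real. \<bar>fst w\<bar> < \<theta> * \<bar>snd w\<bar>}"
  have intC: "integrable lborel (\<lambda>w. indicator ?C w * (exp (- (norm w)\<^sup>2 / 4) / (2 * pi)))"
    by (rule Bochner_Integration.integrable_bound[OF integrable_gauss_quarter(1)])
      (measurable, auto simp: indicator_def)
  have Aq_int: "integrable std_normal2 (\<lambda>u. indicator A u * ?q u)"
    by (rule Bochner_Integration.integrable_bound[OF q_int]) (auto simp: indicator_def)
  have Aq: "(\<integral>u. indicator A u * ?q u \<partial>std_normal2) \<le> 4 * \<theta>"
  proof -
    have "(\<integral>u. indicator A u * ?q u \<partial>std_normal2) = (\<integral>u. indicator A u * (exp (- (norm u)\<^sup>2 / 4) / (2 * pi)) \<partial>lborel)"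
      unfolding std_normal2_eq
    proof (subst integral_density)
      have "gauss2 u * (indicator A u * ?q u) = indicator A u * (gauss2 u * ?q u)" for u
        by (simp only: mult_ac)
      then show "(\<integral>u. gauss2 u *\<^sub>R (indicator A u * ?q u) \<partial>lborel)
         = (\<integral>u. indicator A u * (exp (- (norm u)\<^sup>2 / 4) / (2 * pi)) \<partial>lborel)"
        by (simp only: gauss2_exp_quarter real_scaleR_def)
    qed (auto simp: gauss2_nonneg)
    also have "\<dots> \<le> (\<integral>w. indicator ?C w * (exp (- (norm w)\<^sup>2 / 4) / (2 * pi)) \<partial>lborel)"
    proof (rule integral_mono[OF _ intC])
      show "integrable lborel (\<lambda>u. indicator A u * (exp (- (norm u)\<^sup>2 / 4) / (2 * pi)))"
        by (rule Bochner_Integration.integrable_bound[OF integrable_gauss_quarter(1)])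
          (auto simp: indicator_def)
    qed (use A(2) in \<open>auto simp: indicator_def\<close>)
    also have "\<dots> \<le> 4 * \<theta>" by (rule double_cone_integral[OF \<theta>])
    finally show ?thesis .
  qed
  have PA: "measure std_normal2 A \<le> 4 * \<theta>"
  proof -
    have "measure std_normal2 A = (\<integral>u. indicator A u \<partial>std_normal2)"
      by (simp add: space_N)
    also have "\<dots> \<le> (\<integral>u. indicator A u * ?q u \<partial>std_normal2)"
    proof (rule integral_mono[OF _ Aq_int])
      show "integrable std_normal2 (indicator A :: _ \<Rightarrow> real)"
        by (rule N.integrable_const_bound[of _ 1]) auto
    qed (auto simp: indicator_def)
    finally show ?thesis using Aq by simp
  qed
  let ?a = "measure std_normal2 A"
  \<comment> \<open>Replacing \<open>h\<close> by its deviation from the untranslated measure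
    \<open>?h0\<close> does not change the covariance. Afterwards each term carries one factor
    \<theta> from \<open>?K\<close> and a second one from the restriction to
    \<open>A\<close>.\<close>
  have "(\<integral>u. indicator A u * h u \<partial>std_normal2) - ?a * (\<integral>u. h u \<partial>std_normal2)
      = (\<integral>u. indicator A u * (h u - ?h0) - ?a * (h u - ?h0) \<partial>std_normal2)"
  proof -
    have i: "integrable std_normal2 (\<lambda>u. indicator A u * h u)"
      by (rule Bochner_Integration.integrable_bound[OF h_int]) (auto simp: indicator_def)
    have j: "integrable std_normal2 (\<lambda>u. indicator A u * ?h0)"
      by (rule N.integrable_const_bound[of _ 1]) (auto simp: indicator_def)
    have "(\<integral>u. indicator A u * (h u - ?h0) - ?a * (h u - ?h0) \<partial>std_normal2)
      = (\<integral>u. indicator A u * h u \<partial>std_normal2) - ?a * ?h0 - ?a * ((\<integral>u. h u \<partial>std_normal2) - ?h0)"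
      using i j h_int by (simp add: right_diff_distrib space_N N.prob_space[unfolded space_N])
    then show ?thesis by (simp add: algebra_simps)
  qed
  also have "\<dots> \<le> (\<integral>u. ?K * (indicator A u * ?q u) + ?a * (?K * ?q u) \<partial>std_normal2)"
  proof (rule integral_mono')
    show "integrable std_normal2 (\<lambda>u. ?K * (indicator A u * ?q u) + ?a * (?K * ?q u))"
      using Aq_int q_int by (intro Bochner_Integration.integrable_add) auto
    fix u
    have "indicator A u * (h u - ?h0) \<le> indicator A u * (?K * ?q u)"
      using hd[of u] by (intro mult_left_mono) auto
    moreover have "?a * (?h0 - h u) \<le> ?a * (?K * ?q u)"
      using hd[of u] by (intro mult_left_mono) auto
    ultimately show "indicator A u * (h u - ?h0) - ?a * (h u - ?h0) \<le> ?K * (indicator A u * ?q u) + ?a * (?K * ?q u)"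
      by (simp add: algebra_simps)
    show "0 \<le> ?K * (indicator A u * ?q u) + ?a * (?K * ?q u)"
      using \<theta> by (intro add_nonneg_nonneg mult_nonneg_nonneg) auto
  qed
  also have "\<dots> = ?K * (\<integral>u. indicator A u * ?q u \<partial>std_normal2) + ?a * (?K * 2)"
    using Aq_int q_int by (subst Bochner_Integration.integral_add) (auto simp: q_val)
  also have "\<dots> \<le> ?K * (4 * \<theta>) + (4 * \<theta>) * (?K * 2)"
    using Aq PA \<theta> by (intro add_mono mult_left_mono mult_right_mono) auto
  also have "\<dots> = 6528 * \<epsilon>\<^sup>2 * \<theta>\<^sup>2"
    by (simp add: power2_eq_square)
  finally show ?thesis unfolding e1 e2 .
qed

section \<open>Uniqueness of Gaussian laws\<close>

context prob_space
begin

text \<open>A signed weight of modulus at most 1 becomes a probability density after adding 2 and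
  dividing by \<open>c + 2\<close>. Under this density \<open>V\<close> still has the standard
  normal characteristic function, so uniqueness determines its law; subtracting the contribution of
  the constant 2 gives the claim.\<close>

lemma Levy_weighted_real:
  fixes V Z :: "'a \<Rightarrow> real"
  assumes [measurable]: "V \<in> borel_measurable M" "Z \<in> borel_measurable M"
    and Z: "\<And>x. x \<in> space M \<Longrightarrow> \<bar>Z x\<bar> \<le> 1"
    and char_V: "\<And>t. (\<integral>x. iexp (t * V x) \<partial>M) = of_real (exp (- t\<^sup>2 / 2))"
    and char_Z: "\<And>t. (\<integral>x. of_real (Z x) * iexp (t * V x) \<partial>M) = of_real c * of_real (exp (- t\<^sup>2 / 2))"
    and [measurable]: "B \<in> sets borel"
  shows "(\<integral>x. Z x * indicator B (V x) \<partial>M) = c * measure std_normal_distribution B"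
proof -
  have int_Z [simp, intro]: "integrable M Z"
    by (rule integrable_const_bound[of _ 1]) (auto intro!: AE_I2 mult_nonneg_nonneg Z)
  have "complex_of_real (\<integral>x. Z x \<partial>M) = of_real c"
    using char_Z[of 0] by simp
  then have c: "(\<integral>x. Z x \<partial>M) = c"
    unfolding of_real_eq_iff .
  have "\<bar>c\<bar> \<le> (\<integral>x. \<bar>Z x\<bar> \<partial>M)" unfolding c[symmetric] by (rule integral_abs_bound)
  also have "\<dots> \<le> 1" using Z by (intro integral_le_const) auto
  finally have c1: "\<bar>c\<bar> \<le> 1" .
  define w where "w x = (Z x + 2) / (c + 2)" for x
  have [measurable]: "w \<in> borel_measurable M" unfolding w_def by measurable
  have w_nn: "0 \<le> w x" if "x \<in> space M" for x
    using Z[OF that] c1 by (auto simp: w_def abs_le_iff intro!: divide_nonneg_nonneg)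
  define D where "D = density M (\<lambda>x. ennreal (w x))"
  have int_w: "integrable M w" unfolding w_def by auto
  have w1: "(\<integral>x. w x \<partial>M) = 1"
    using c1 by (simp add: w_def c prob_space)
  have "prob_space D"
  proof
    have "emeasure D (space D) = (\<integral>\<^sup>+ x. ennreal (w x) \<partial>M)"
      unfolding D_def by (subst emeasure_density) (auto intro!: nn_integral_cong)
    also have "\<dots> = ennreal (\<integral>x. w x \<partial>M)"
      by (rule nn_integral_eq_integral[OF int_w]) (auto intro!: AE_I2 w_nn)
    finally show "emeasure D (space D) = 1" by (simp add: w1)
  qed
  then interpret D: prob_space D .
  have [measurable_cong]: "sets D = sets M" by (simp add: D_def)
  have [measurable]: "V \<in> borel_measurable D" by measurable
  have rd: "real_distribution (distr D borel V)"
    by (rule D.real_distribution_distr) simp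
  have "char (distr D borel V) = char std_normal_distribution"
  proof
    fix t
    have "char (distr D borel V) t = (\<integral>x. iexp (t * V x) \<partial>D)"
      unfolding char_def by (subst integral_distr) auto
    also have "\<dots> = (\<integral>x. w x *\<^sub>R iexp (t * V x) \<partial>M)"
      unfolding D_def by (subst integral_density) (auto intro!: AE_I2 w_nn)
    also have "\<dots> = (\<integral>x. (of_real (Z x) * iexp (t * V x) + 2 * iexp (t * V x)) / of_real (c + 2) \<partial>M)"
      by (intro Bochner_Integration.integral_cong) (auto simp: w_def scaleR_conv_of_real field_simps)
    also have "\<dots> = (\<integral>x. of_real (Z x) * iexp (t * V x) + 2 * iexp (t * V x) \<partial>M) / of_real (c + 2)"
      by (rule integral_divide_zero)
    also have "(\<integral>x. of_real (Z x) * iexp (t * V x) + 2 * iexp (t * V x) \<partial>M)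
      = (\<integral>x. of_real (Z x) * iexp (t * V x) \<partial>M) + 2 * (\<integral>x. iexp (t * V x) \<partial>M)"
    proof -
      have "integrable M (\<lambda>x. of_real (Z x) * iexp (t * V x))"
        by (rule integrable_const_bound[of _ 1]) (auto intro!: AE_I2 simp: norm_mult Z)
      moreover have "integrable M (\<lambda>x. iexp (t * V x))"
        by (rule integrable_const_bound[of _ 1]) auto
      ultimately show ?thesis by (simp del: of_real_mult)
    qed
    also have "\<dots> = of_real (c + 2) * of_real (exp (- t\<^sup>2 / 2))"
      unfolding char_V char_Z by (simp add: algebra_simps)
    finally show "char (distr D borel V) t = char std_normal_distribution t"
      using c1 by (simp add: char_std_normal_distribution complex_eq_iff)
  qed
  from Levy_uniqueness[OF rd real_dist_normal_dist this]
  have law: "distr D borel V = std_normal_distribution" .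
  have "char (distr M borel V) = char std_normal_distribution"
  proof
    fix t
    have "char (distr M borel V) t = (\<integral>x. iexp (t * V x) \<partial>M)"
      unfolding char_def by (subst integral_distr) auto
    then show "char (distr M borel V) t = char std_normal_distribution t"
      by (simp only: char_V char_std_normal_distribution)
  qed
  from Levy_uniqueness[OF real_distribution_distr real_dist_normal_dist this]
  have law0: "distr M borel V = std_normal_distribution" by simp
  have "measure std_normal_distribution B = (\<integral>x. indicator B (V x) \<partial>D)"
    unfolding law[symmetric] by (simp add: measure_distr) (simp add: indicator_vimage[symmetric])
  also have "\<dots> = (\<integral>x. w x * indicator B (V x) \<partial>M)"
    unfolding D_def by (subst integral_density) (auto intro!: AE_I2 w_nn)
  also have "\<dots> = (\<integral>x. (Z x * indicator B (V x) + 2 * indicator B (V x)) / (c + 2) \<partial>M)"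
    by (intro Bochner_Integration.integral_cong) (auto simp: w_def field_simps)
  also have "\<dots> = (\<integral>x. Z x * indicator B (V x) + 2 * indicator B (V x) \<partial>M) / (c + 2)"
    by (rule integral_divide_zero)
  also have "(\<integral>x. Z x * indicator B (V x) + 2 * indicator B (V x) \<partial>M)
      = (\<integral>x. Z x * indicator B (V x) \<partial>M) + 2 * (\<integral>x. indicator B (V x) \<partial>M)"
  proof -
    have "integrable M (\<lambda>x. Z x * indicator B (V x))"
      by (rule integrable_const_bound[of _ 1]) (auto intro!: AE_I2 simp: Z indicator_def)
    moreover have "integrable M (\<lambda>x. indicator B (V x) :: real)"
      by (rule integrable_const_bound[of _ 1]) auto
    ultimately show ?thesis by simp
  qed
  also have "(\<integral>x. indicator B (V x) \<partial>M) = measure std_normal_distribution B"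
    unfolding law0[symmetric] by (simp add: measure_distr) (simp add: indicator_vimage[symmetric])
  finally show ?thesis
    using c1 by (simp add: field_simps abs_le_iff)
qed

text \<open>The complex weight is split into real and imaginary parts. Their characteristic
  integrals come from those of the weight and of its conjugate, the latter obtained by conjugating
  and replacing t by -t.\<close>

lemma Levy_weighted:
  fixes V :: "'a \<Rightarrow> real" and Z :: "'a \<Rightarrow> complex"
  assumes [measurable]: "V \<in> borel_measurable M" "Z \<in> borel_measurable M"
    and Z: "\<And>x. x \<in> space M \<Longrightarrow> norm (Z x) \<le> 1"
    and char_V: "\<And>t. (\<integral>x. iexp (t * V x) \<partial>M) = of_real (exp (- t\<^sup>2 / 2))"
    and char_Z: "\<And>t. (\<integral>x. Z x * iexp (t * V x) \<partial>M) = c * of_real (exp (- t\<^sup>2 / 2))"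
    and [measurable]: "B \<in> sets borel"
  shows "(\<integral>x. Z x * indicator B (V x) \<partial>M) = c * measure std_normal_distribution B"
proof -
  have int: "integrable M (\<lambda>x. Z x * iexp (t * V x))" for t
    by (rule integrable_const_bound[of _ 1]) (auto intro!: AE_I2 simp: norm_mult Z)
  have [measurable]: "cnj \<in> borel_measurable borel"
    by (intro borel_measurable_continuous_onI continuous_intros)
  have int': "integrable M (\<lambda>x. cnj (Z x) * iexp (t * V x))" for t
    by (rule integrable_const_bound[of _ 1]) (auto intro!: AE_I2 simp: norm_mult Z)
  have cnj_Z: "(\<integral>x. cnj (Z x) * iexp (t * V x) \<partial>M) = cnj c * of_real (exp (- t\<^sup>2 / 2))" for t
  proof -
    have "(\<integral>x. cnj (Z x) * iexp (t * V x) \<partial>M) = (\<integral>x. cnj (Z x * iexp (- t * V x)) \<partial>M)"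
      by (intro Bochner_Integration.integral_cong) (auto simp: exp_cnj)
    also have "\<dots> = cnj (\<integral>x. Z x * iexp (- t * V x) \<partial>M)"
      by (rule Bochner_Integration.integral_cnj)
    also have "\<dots> = cnj c * of_real (exp (- t\<^sup>2 / 2))"
      using char_Z[of "- t"] by simp
    finally show ?thesis .
  qed
  have re: "(\<integral>x. of_real (Re (Z x)) * iexp (t * V x) \<partial>M) = of_real (Re c) * of_real (exp (- t\<^sup>2 / 2))" for t
  proof -
    have "(\<integral>x. of_real (Re (Z x)) * iexp (t * V x) \<partial>M)
       = (\<integral>x. (Z x * iexp (t * V x) + cnj (Z x) * iexp (t * V x)) / 2 \<partial>M)"
      by (intro Bochner_Integration.integral_cong)
        (auto simp: distrib_right[symmetric] complex_add_cnj)
    also have "\<dots> = ((\<integral>x. Z x * iexp (t * V x) \<partial>M) + (\<integral>x. cnj (Z x) * iexp (t * V x) \<partial>M)) / 2"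
      by (simp only: integral_divide_zero Bochner_Integration.integral_add[OF int int'])
    also have "\<dots> = of_real (Re c) * of_real (exp (- t\<^sup>2 / 2))"
      unfolding char_Z cnj_Z by (simp only: distrib_right[symmetric] complex_add_cnj) simp
    finally show ?thesis .
  qed
  have im_eq: "(w * e - cnj w * e) / (2 * \<i>) = of_real (Im w) * e" for w e :: complex
  proof -
    have "w * e - cnj w * e = (2 * \<i>) * (of_real (Im w) * e)"
      by (simp only: left_diff_distrib[symmetric] complex_diff_cnj) (simp add: mult_ac)
    then show ?thesis by simp
  qed
  have im: "(\<integral>x. of_real (Im (Z x)) * iexp (t * V x) \<partial>M) = of_real (Im c) * of_real (exp (- t\<^sup>2 / 2))" for t
  proof -
    have "(\<integral>x. of_real (Im (Z x)) * iexp (t * V x) \<partial>M)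
       = (\<integral>x. (Z x * iexp (t * V x) - cnj (Z x) * iexp (t * V x)) / (2 * \<i>) \<partial>M)"
    proof (intro Bochner_Integration.integral_cong refl)
      show "of_real (Im (Z x)) * iexp (t * V x)
        = (Z x * iexp (t * V x) - cnj (Z x) * iexp (t * V x)) / (2 * \<i>)" for x
        by (rule im_eq[symmetric])
    qed
    also have "\<dots> = ((\<integral>x. Z x * iexp (t * V x) \<partial>M) - (\<integral>x. cnj (Z x) * iexp (t * V x) \<partial>M)) / (2 * \<i>)"
      by (simp only: integral_divide_zero Bochner_Integration.integral_diff[OF int int'])
    also have "\<dots> = of_real (Im c) * of_real (exp (- t\<^sup>2 / 2))"
      unfolding char_Z cnj_Z by (rule im_eq)
    finally show ?thesis .
  qed
  have R: "(\<integral>x. Re (Z x) * indicator B (V x) \<partial>M) = Re c * measure std_normal_distribution B"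
    by (rule Levy_weighted_real[OF _ _ _ char_V re])
      (auto intro: order_trans[OF abs_Re_le_cmod Z])
  have I: "(\<integral>x. Im (Z x) * indicator B (V x) \<partial>M) = Im c * measure std_normal_distribution B"
    by (rule Levy_weighted_real[OF _ _ _ char_V im])
      (auto intro: order_trans[OF abs_Im_le_cmod Z])
  have ZB: "integrable M (\<lambda>x. Z x * indicator B (V x))"
    by (rule integrable_const_bound[of _ 1]) (auto intro!: AE_I2 simp: Z indicator_def)
  show ?thesis
  proof (rule complex_eqI)
    have "Re (Z x * indicator B (V x)) = Re (Z x) * indicator B (V x)" for x
      by (simp add: indicator_def)
    then show "Re (\<integral>x. Z x * indicator B (V x) \<partial>M) = Re (c * measure std_normal_distribution B)"
      using R by (simp add: integral_Re[OF ZB, symmetric])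
    have "Im (Z x * indicator B (V x)) = Im (Z x) * indicator B (V x)" for x
      by (simp add: indicator_def)
    then show "Im (\<integral>x. Z x * indicator B (V x) \<partial>M) = Im (c * measure std_normal_distribution B)"
      using I by (simp add: integral_Im[OF ZB, symmetric])
  qed
qed

text \<open>A nonnegative weight, normalised by its mean \<open>c\<close>, is a density under which
  the law of the pair agrees with the product law on rectangles, hence everywhere. For
  \<open>c = 0\<close> no normalisation is possible, but then both sides vanish.\<close>

lemma pair_law_weighted:
  fixes V W Z :: "'a \<Rightarrow> real"
  assumes [measurable]: "V \<in> borel_measurable M" "W \<in> borel_measurable M" "Z \<in> borel_measurable M"
    and Z: "\<And>x. x \<in> space M \<Longrightarrow> 0 \<le> Z x" "\<And>x. x \<in> space M \<Longrightarrow> Z x \<le> 1"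
    and rect: "\<And>B C. B \<in> sets borel \<Longrightarrow> C \<in> sets borel \<Longrightarrow>
      (\<integral>x. Z x * (indicator B (V x) * indicator C (W x)) \<partial>M)
        = c * (measure std_normal_distribution B * measure std_normal_distribution C)"
    and [measurable]: "A \<in> sets borel"
  shows "(\<integral>x. Z x * indicator A (V x, W x) \<partial>M) = c * measure std_normal2 A"
proof -
  interpret S: prob_space std_normal_distribution by (rule prob_space_normal_density) simp
  interpret N: prob_space std_normal2 by (rule prob_space_std_normal2)
  have int: "integrable M (\<lambda>x. Z x * indicator A (V x, W x))" if [measurable]: "A \<in> sets borel" for A
    by (rule integrable_const_bound[of _ 1]) (auto intro!: AE_I2 simp: Z indicator_def)
  have int_Z: "integrable M Z"
    by (rule integrable_const_bound[of _ 1]) (auto intro!: AE_I2 simp: Z)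
  have c: "(\<integral>x. Z x \<partial>M) = c"
    using rect[of UNIV UNIV] S.prob_space by simp
  have c0: "0 \<le> c" unfolding c[symmetric] by (rule integral_nonneg_AE) (auto intro!: AE_I2 mult_nonneg_nonneg Z)
  show ?thesis
  proof (cases "c = 0")
    case True
    have "(\<integral>x. Z x * indicator A (V x, W x) \<partial>M) \<le> (\<integral>x. Z x \<partial>M)"
      by (rule integral_mono[OF int int_Z]) (auto simp: indicator_def Z)
    moreover have "0 \<le> (\<integral>x. Z x * indicator A (V x, W x) \<partial>M)"
      by (rule integral_nonneg_AE) (auto intro!: AE_I2 mult_nonneg_nonneg Z)
    ultimately show ?thesis using True c by simp
  next
    case False
    then have c0: "0 < c" using c0 by simp
    define D where "D = density M (\<lambda>x. ennreal (Z x / c))"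
    let ?L = "distr D borel (\<lambda>x. (V x, W x))"
    have [measurable_cong]: "sets D = sets M" by (simp add: D_def)
    have law: "emeasure ?L A = ennreal ((\<integral>x. Z x * indicator A (V x, W x) \<partial>M) / c)"
      if [measurable]: "A \<in> sets borel" for A
    proof -
      have "emeasure ?L A = (\<integral>\<^sup>+ x. ennreal (Z x / c) * indicator A (V x, W x) \<partial>M)"
        unfolding D_def
        by (subst emeasure_distr, measurable, subst emeasure_density)
          (auto intro!: nn_integral_cong simp: indicator_def)
      also have "\<dots> = (\<integral>\<^sup>+ x. ennreal (Z x * indicator A (V x, W x) / c) \<partial>M)"
        by (intro nn_integral_cong) (auto simp: indicator_def)
      also have "\<dots> = ennreal (\<integral>x. Z x * indicator A (V x, W x) / c \<partial>M)"
        using int[OF that] c0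
        by (intro nn_integral_eq_integral) (auto intro!: AE_I2 divide_nonneg_nonneg mult_nonneg_nonneg Z)
      finally show ?thesis by simp
    qed
    have "std_normal2 = ?L"
    proof (rule pair_measure_eqI)
      show "sigma_finite_measure std_normal_distribution" "sigma_finite_measure std_normal_distribution"
        by (rule S.sigma_finite_measure_axioms)+
      show "sets std_normal2 = sets ?L"
        unfolding std_normal2_eq by simp
      fix B C :: "real set"
      assume "B \<in> sets std_normal_distribution" "C \<in> sets std_normal_distribution"
      then have [measurable]: "B \<in> sets borel" "C \<in> sets borel" by auto
      have "(indicator (B \<times> C) (V x, W x) :: real) = indicator B (V x) * indicator C (W x)" for x
        by (auto simp: indicator_def)
      then have "emeasure ?L (B \<times> C)
          = ennreal (measure std_normal_distribution B * measure std_normal_distribution C)"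
        using c0 by (subst law) (auto simp: rect borel_prod[symmetric])
      then show "emeasure std_normal_distribution B * emeasure std_normal_distribution C = emeasure ?L (B \<times> C)"
        by (simp add: S.emeasure_eq_measure ennreal_mult')
    qed
    then have "ennreal (measure std_normal2 A) = ennreal ((\<integral>x. Z x * indicator A (V x, W x) \<partial>M) / c)"
      using law[of A] by (metis N.emeasure_eq_measure assms(7))
    moreover have "0 \<le> (\<integral>x. Z x * indicator A (V x, W x) \<partial>M)"
      by (rule integral_nonneg_AE) (auto intro!: AE_I2 mult_nonneg_nonneg Z)
    ultimately show ?thesis using c0 by (simp add: field_simps)
  qed
qed

text \<open>The joint characteristic function is inverted one coordinate at a time: an exponential
  in one variable is traded for an indicator by the weighted one-dimensional uniqueness, with the
  remaining exponentials and the indicators already obtained serving as the weight.\<close>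

lemma four_std_normal_law:
  fixes V :: "nat \<Rightarrow> 'a \<Rightarrow> real"
  assumes V [measurable]: "\<And>i. V i \<in> borel_measurable M"
    and char: "\<And>a b c d. (\<integral>x. iexp (a * V 0 x + b * V 1 x + c * V 2 x + d * V 3 x) \<partial>M)
        = of_real (exp (- (a\<^sup>2 + b\<^sup>2 + c\<^sup>2 + d\<^sup>2) / 2))"
  shows "distr M borel (\<lambda>x. ((V 0 x, V 1 x), (V 2 x, V 3 x))) = std_normal2 \<Otimes>\<^sub>M std_normal2"
proof -
  interpret S: prob_space std_normal_distribution by (rule prob_space_normal_density) simp
  interpret N: prob_space std_normal2 by (rule prob_space_std_normal2)
  let ?n = "\<lambda>B. measure std_normal_distribution B"
  have split: "exp (- (s + t\<^sup>2) / 2) = exp (- s / 2) * exp (- t\<^sup>2 / 2)" for s t :: real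
    by (simp add: exp_add[symmetric] add_divide_distrib[symmetric])
  have c0: "(\<integral>x. iexp (t * V 0 x) \<partial>M) = of_real (exp (- t\<^sup>2 / 2))" for t using char[of t 0 0 0] by simp
  have c1: "(\<integral>x. iexp (t * V 1 x) \<partial>M) = of_real (exp (- t\<^sup>2 / 2))" for t using char[of 0 t 0 0] by simp
  have c2: "(\<integral>x. iexp (t * V 2 x) \<partial>M) = of_real (exp (- t\<^sup>2 / 2))" for t using char[of 0 0 t 0] by simp
  have c3: "(\<integral>x. iexp (t * V 3 x) \<partial>M) = of_real (exp (- t\<^sup>2 / 2))" for t using char[of 0 0 0 t] by simp
  have s3: "(\<integral>x. iexp (a * V 0 x + b * V 1 x + c * V 2 x) * indicator B3 (V 3 x) \<partial>M)
     = of_real (exp (- (a\<^sup>2 + b\<^sup>2 + c\<^sup>2) / 2)) * of_real (?n B3)"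
    if [measurable]: "B3 \<in> sets borel" for a b c B3
  proof (rule Levy_weighted[OF _ _ _ c3])
    fix t
    have "iexp (a * V 0 x + b * V 1 x + c * V 2 x) * iexp (t * V 3 x)
      = iexp (a * V 0 x + b * V 1 x + c * V 2 x + t * V 3 x)" for x
      by (simp add: exp_add[symmetric] algebra_simps)
    then show "(\<integral>x. iexp (a * V 0 x + b * V 1 x + c * V 2 x) * iexp (t * V 3 x) \<partial>M)
      = of_real (exp (- (a\<^sup>2 + b\<^sup>2 + c\<^sup>2) / 2)) * of_real (exp (- t\<^sup>2 / 2))"
      using char[of a b c t] split[of "a\<^sup>2 + b\<^sup>2 + c\<^sup>2" t] by (simp only: of_real_mult)
  qed (auto simp: norm_mult indicator_def)
  have s2: "(\<integral>x. (iexp (a * V 0 x + b * V 1 x) * indicator B3 (V 3 x)) * indicator B2 (V 2 x) \<partial>M)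
     = (of_real (exp (- (a\<^sup>2 + b\<^sup>2) / 2)) * of_real (?n B3)) * of_real (?n B2)"
    if [measurable]: "B2 \<in> sets borel" "B3 \<in> sets borel" for a b B2 B3
  proof (rule Levy_weighted[OF _ _ _ c2])
    fix t
    have "iexp (a * V 0 x + b * V 1 x) * indicator B3 (V 3 x) * iexp (t * V 2 x)
      = iexp (a * V 0 x + b * V 1 x + t * V 2 x) * indicator B3 (V 3 x)" for x
      by (simp add: exp_add[symmetric] algebra_simps indicator_def)
    then show "(\<integral>x. iexp (a * V 0 x + b * V 1 x) * indicator B3 (V 3 x) * iexp (t * V 2 x) \<partial>M)
      = of_real (exp (- (a\<^sup>2 + b\<^sup>2) / 2)) * of_real (?n B3) * of_real (exp (- t\<^sup>2 / 2))"
      using s3[OF that(2), of a b t] split[of "a\<^sup>2 + b\<^sup>2" t] by (simp only: of_real_mult mult_ac)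
  qed (auto simp: norm_mult indicator_def)
  have s1: "(\<integral>x. (iexp (a * V 0 x) * indicator B3 (V 3 x) * indicator B2 (V 2 x)) * indicator B1 (V 1 x) \<partial>M)
     = (of_real (exp (- a\<^sup>2 / 2)) * of_real (?n B3) * of_real (?n B2)) * of_real (?n B1)"
    if [measurable]: "B1 \<in> sets borel" "B2 \<in> sets borel" "B3 \<in> sets borel" for a B1 B2 B3
  proof (rule Levy_weighted[OF _ _ _ c1])
    fix t
    have "iexp (a * V 0 x) * indicator B3 (V 3 x) * indicator B2 (V 2 x) * iexp (t * V 1 x)
      = (iexp (a * V 0 x + t * V 1 x) * indicator B3 (V 3 x)) * indicator B2 (V 2 x)" for x
      by (simp add: exp_add[symmetric] algebra_simps indicator_def)
    then show "(\<integral>x. iexp (a * V 0 x) * indicator B3 (V 3 x) * indicator B2 (V 2 x) * iexp (t * V 1 x) \<partial>M)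
      = of_real (exp (- a\<^sup>2 / 2)) * of_real (?n B3) * of_real (?n B2) * of_real (exp (- t\<^sup>2 / 2))"
      using s2[OF that(2,3), of a t] split[of "a\<^sup>2" t] by (simp only: of_real_mult mult_ac)
  qed (auto simp: norm_mult indicator_def)
  have s0: "(\<integral>x. (indicator B3 (V 3 x) * indicator B2 (V 2 x) * indicator B1 (V 1 x)) * indicator B0 (V 0 x) \<partial>M)
     = (?n B3 * ?n B2 * ?n B1) * ?n B0"
    if [measurable]: "B0 \<in> sets borel" "B1 \<in> sets borel" "B2 \<in> sets borel" "B3 \<in> sets borel" for B0 B1 B2 B3
  proof (rule Levy_weighted_real[OF _ _ _ c0])
    fix t
    have "of_real (indicator B3 (V 3 x) * indicator B2 (V 2 x) * indicator B1 (V 1 x)) * iexp (t * V 0 x)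
      = (iexp (t * V 0 x) * indicator B3 (V 3 x) * indicator B2 (V 2 x)) * indicator B1 (V 1 x)" for x
      by (simp add: indicator_def)
    then show "(\<integral>x. of_real (indicator B3 (V 3 x) * indicator B2 (V 2 x) * indicator B1 (V 1 x)) * iexp (t * V 0 x) \<partial>M)
      = of_real (?n B3 * ?n B2 * ?n B1) * of_real (exp (- t\<^sup>2 / 2))"
      using s1[OF that(2-4), of t] by (simp only: of_real_mult mult_ac)
  qed (auto simp: indicator_def)
  have p1: "(\<integral>x. (indicator B2 (V 2 x) * indicator B3 (V 3 x)) * indicator A (V 0 x, V 1 x) \<partial>M)
     = (?n B2 * ?n B3) * measure std_normal2 A"
    if [measurable]: "B2 \<in> sets borel" "B3 \<in> sets borel" "A \<in> sets borel" for A B2 B3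
    by (rule pair_law_weighted) (use s0 in \<open>auto simp: mult_ac indicator_def\<close>)
  have p2: "(\<integral>x. indicator A (V 0 x, V 1 x) * indicator A' (V 2 x, V 3 x) \<partial>M)
     = measure std_normal2 A * measure std_normal2 A'"
    if [measurable]: "A \<in> sets borel" "A' \<in> sets borel" for A A'
    by (rule pair_law_weighted) (use p1 in \<open>auto simp: mult_ac\<close>)
  have "std_normal2 \<Otimes>\<^sub>M std_normal2 = distr M borel (\<lambda>x. ((V 0 x, V 1 x), (V 2 x, V 3 x)))" (is "_ = ?L")
  proof (rule pair_measure_eqI)
    show "sigma_finite_measure std_normal2" "sigma_finite_measure std_normal2"
      by (rule N.sigma_finite_measure_axioms)+
    have s: "sets std_normal2 = sets borel" unfolding std_normal2_eq by simp
    show "sets (std_normal2 \<Otimes>\<^sub>M std_normal2) = sets ?L"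
      using sets_pair_measure_cong[OF s s] by (simp only: sets_distr borel_prod)
    fix A B
    assume "A \<in> sets std_normal2" "B \<in> sets std_normal2"
    then have [measurable]: "A \<in> sets borel" "B \<in> sets borel" using s by auto
    have [measurable]: "A \<times> B \<in> sets borel"
      using pair_measureI[of A borel B borel] by (simp only: borel_prod \<open>A \<in> sets borel\<close> \<open>B \<in> sets borel\<close>)
    have "emeasure ?L (A \<times> B) = emeasure M ((\<lambda>x. ((V 0 x, V 1 x), (V 2 x, V 3 x))) -` (A \<times> B) \<inter> space M)"
      by (subst emeasure_distr) auto
    also have "\<dots> = ennreal (\<integral>x. indicator ((\<lambda>x. ((V 0 x, V 1 x), (V 2 x, V 3 x))) -` (A \<times> B) \<inter> space M) x \<partial>M)"
      by (simp add: emeasure_eq_measure)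
    also have "(\<integral>x. indicator ((\<lambda>x. ((V 0 x, V 1 x), (V 2 x, V 3 x))) -` (A \<times> B) \<inter> space M) x \<partial>M)
       = (\<integral>x. indicator A (V 0 x, V 1 x) * (indicator B (V 2 x, V 3 x) :: real) \<partial>M)"
      by (intro Bochner_Integration.integral_cong) (auto simp: indicator_def)
    finally show "emeasure std_normal2 A * emeasure std_normal2 B = emeasure ?L (A \<times> B)"
      unfolding p2[OF \<open>A \<in> sets borel\<close> \<open>B \<in> sets borel\<close>]
      by (simp only: N.emeasure_eq_measure ennreal_mult' measure_nonneg)
  qed
  then show ?thesis ..
qed

end

section \<open>Gaussian linear forms\<close>

text \<open>Independence and normality are both contained in the joint characteristic function. It
  says that the real and imaginary parts of all \<open>b j\<close> are independent standard normals,
  so that E|b j|^2 = 2.\<close>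

locale gaussian_coefficients = prob_space M for M :: "'a measure" +
  fixes J :: "'j set" and b :: "'j \<Rightarrow> 'a \<Rightarrow> complex"
  assumes finite_J: "finite J"
    and b_measurable: "\<And>j. j \<in> J \<Longrightarrow> b j \<in> borel_measurable M"
    and char_b: "\<And>z. (\<integral>x. iexp (\<Sum>j\<in>J. Re (z j * b j x)) \<partial>M)
        = of_real (exp (- (\<Sum>j\<in>J. (cmod (z j))\<^sup>2) / 2))"
begin

definition G :: "('j \<Rightarrow> complex) \<Rightarrow> 'a \<Rightarrow> real" where
  "G z x = (\<Sum>j\<in>J. Re (z j * b j x))"

text \<open>This is the covariance of \<open>G z\<close> and \<open>G w\<close>, so that statements
  about values of the wave become linear algebra of coefficient vectors.\<close>

definition ip :: "('j \<Rightarrow> complex) \<Rightarrow> ('j \<Rightarrow> complex) \<Rightarrow> real" where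
  "ip z w = (\<Sum>j\<in>J. Re (z j * cnj (w j)))"

lemma G_measurable [measurable]: "G z \<in> borel_measurable M"
proof -
  have "(\<lambda>x. Re (z j * b j x)) \<in> borel_measurable M" if "j \<in> J" for j
    using b_measurable[OF that] by measurable
  then show ?thesis unfolding G_def[abs_def] by (intro borel_measurable_sum)
qed

lemma ip_commute: "ip z w = ip w z"
  by (simp add: ip_def mult_ac)

lemma ip_self: "ip z z = (\<Sum>j\<in>J. (cmod (z j))\<^sup>2)"
  by (simp add: ip_def complex_mult_cnj cmod_power2)

lemma ip_nonneg: "0 \<le> ip z z"
  by (simp add: ip_self sum_nonneg)

lemma G_add: "G (\<lambda>j. z j + w j) x = G z x + G w x"
  by (simp only: G_def distrib_right plus_complex.sel sum.distrib)

lemma G_diff: "G (\<lambda>j. z j - w j) x = G z x - G w x"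
  by (simp only: G_def left_diff_distrib minus_complex.sel sum_subtractf)

lemma G_scale: "G (\<lambda>j. of_real r * z j) x = r * G z x"
  by (simp add: G_def sum_distrib_left algebra_simps)

lemma ip_add: "ip (\<lambda>j. z j + w j) v = ip z v + ip w v"
  by (simp add: ip_def sum.distrib algebra_simps)

lemma ip_diff: "ip (\<lambda>j. z j - w j) v = ip z v - ip w v"
  by (simp add: ip_def sum_subtractf algebra_simps)

lemma ip_scale: "ip (\<lambda>j. of_real r * z j) v = r * ip z v"
  by (simp add: ip_def sum_distrib_left algebra_simps)

lemma ip_add_right: "ip v (\<lambda>j. z j + w j) = ip v z + ip v w"
  using ip_add[of z w v] by (simp add: ip_commute)

lemma ip_diff_right: "ip v (\<lambda>j. z j - w j) = ip v z - ip v w"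
  using ip_diff[of z w v] by (simp add: ip_commute)

lemma ip_scale_right: "ip v (\<lambda>j. of_real r * z j) = r * ip v z"
  using ip_scale[of r z v] by (simp add: ip_commute)

lemmas ip_linear = ip_add ip_diff ip_scale ip_add_right ip_diff_right ip_scale_right

lemma char_G: "(\<integral>x. iexp (G z x) \<partial>M) = of_real (exp (- ip z z / 2))"
  unfolding G_def ip_self by (rule char_b)

lemma G_law:
  assumes "ip z z = 1"
  shows "distr M borel (G z) = std_normal_distribution"
proof (rule Levy_uniqueness[OF real_distribution_distr real_dist_normal_dist])
  show "char (distr M borel (G z)) = char std_normal_distribution"
  proof
    fix t
    have "char (distr M borel (G z)) t = (\<integral>x. iexp (t * G z x) \<partial>M)"
      unfolding char_def by (subst integral_distr) auto
    also have "\<dots> = (\<integral>x. iexp (G (\<lambda>j. of_real t * z j) x) \<partial>M)"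
      by (simp only: G_scale)
    also have "\<dots> = char std_normal_distribution t"
      unfolding char_G char_std_normal_distribution by (simp add: ip_linear assms power2_eq_square)
    finally show "char (distr M borel (G z)) t = char std_normal_distribution t" .
  qed
qed simp

text \<open>The normal density is at most 1 / sqrt (2 pi) < 1/2, and the interval has length 2
  \<delta>.\<close>

lemma prob_G_small:
  assumes "ip z z = 1" "0 \<le> \<delta>"
  shows "prob {x \<in> space M. \<bar>G z x\<bar> \<le> \<delta>} \<le> \<delta>"
proof -
  have "prob {x \<in> space M. \<bar>G z x\<bar> \<le> \<delta>} = measure (distr M borel (G z)) {-\<delta>..\<delta>}"
    by (subst measure_distr) (auto intro!: arg_cong[where f = prob])
  also have "\<dots> = measure std_normal_distribution {-\<delta>..\<delta>}"
    by (simp only: G_law[OF assms(1)])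
  also have "\<dots> \<le> \<delta>"
  proof -
    have "emeasure std_normal_distribution {-\<delta>..\<delta>}
        = (\<integral>\<^sup>+ t. ennreal (std_normal_density t) * indicator {-\<delta>..\<delta>} t \<partial>lborel)"
      by (subst emeasure_density) auto
    also have "\<dots> \<le> (\<integral>\<^sup>+ t. ennreal (1 / 2) * indicator {-\<delta>..\<delta>} t \<partial>lborel)"
    proof (intro nn_integral_mono mult_right_mono ennreal_leI)
      fix t
      have "2 \<le> sqrt (2 * pi)"
        using pi_gt3 by (intro real_le_rsqrt) auto
      then have "1 / sqrt (2 * pi) * exp (- t\<^sup>2 / 2) \<le> 1 / 2 * 1"
        by (intro mult_mono) (auto simp: field_simps)
      then show "std_normal_density t \<le> 1 / 2" by (simp add: std_normal_density_def)
    qed auto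
    also have "\<dots> = ennreal (1 / 2) * ennreal (2 * \<delta>)"
      using assms(2) by (subst nn_integral_cmult_indicator) auto
    also have "\<dots> = ennreal \<delta>"
      using assms(2) by (subst ennreal_mult[symmetric]) auto
    finally show ?thesis
      using assms(2) unfolding measure_def by (intro enn2real_leI) auto
  qed
  finally show ?thesis .
qed

text \<open>After normalising the variance, |t| \<le> (1 + t^2) / 2 bounds the first absolute moment
  through the second moment, which is 1.\<close>

lemma expectation_abs_G: "(\<integral>\<^sup>+ x. ennreal \<bar>G z x\<bar> \<partial>M) \<le> ennreal (sqrt (ip z z))"
proof (cases "ip z z = 0")
  case True
  then have "z j = 0" if "j \<in> J" for j
    using that finite_J by (auto simp: ip_self sum_nonneg_eq_0_iff)
  then show ?thesis by (simp add: G_def)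
next
  case False
  define s where "s = sqrt (ip z z)"
  have s: "0 < s" "s * s = ip z z" using False ip_nonneg[of z] by (auto simp: s_def)
  define w where "w j = of_real (1 / s) * z j" for j
  have w: "ip w w = 1" unfolding w_def ip_linear using s False by (simp add: field_simps)
  have G: "G z x = s * G w x" for x unfolding w_def using s by (simp only: G_scale) simp
  have "(\<integral>\<^sup>+ x. ennreal \<bar>G w x\<bar> \<partial>M) = (\<integral>\<^sup>+ t. ennreal \<bar>t\<bar> \<partial>distr M borel (G w))"
    by (subst nn_integral_distr) auto
  also have "\<dots> = (\<integral>\<^sup>+ t. ennreal \<bar>t\<bar> \<partial>std_normal_distribution)"
    by (simp only: G_law[OF w])
  also have "\<dots> \<le> (\<integral>\<^sup>+ t. ennreal ((1 + t\<^sup>2) / 2) \<partial>std_normal_distribution)"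
  proof (intro nn_integral_mono ennreal_leI)
    fix t :: real
    show "\<bar>t\<bar> \<le> (1 + t\<^sup>2) / 2"
      using zero_le_power2[of "\<bar>t\<bar> - 1"] by (simp add: power2_eq_square algebra_simps)
  qed
  also have "\<dots> = ennreal (\<integral>t. (1 + t\<^sup>2) / 2 \<partial>std_normal_distribution)"
  proof (rule nn_integral_eq_integral)
    interpret S: prob_space std_normal_distribution by (rule prob_space_normal_density) simp
    show "integrable std_normal_distribution (\<lambda>t. (1 + t\<^sup>2) / 2)"
      using integrable_std_normal_distribution_moment[of 2] by auto
  qed auto
  also have "(\<integral>t. (1 + t\<^sup>2) / 2 \<partial>std_normal_distribution) = 1"
  proof -
    interpret S: prob_space std_normal_distribution by (rule prob_space_normal_density) simp
    show ?thesis
      using integrable_std_normal_distribution_moment[of 2] std_normal_distribution_even_moments(1)[of 1] S.prob_space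
      by simp
  qed
  finally have 1: "(\<integral>\<^sup>+ x. ennreal \<bar>G w x\<bar> \<partial>M) \<le> 1" by simp
  have "(\<integral>\<^sup>+ x. ennreal \<bar>G z x\<bar> \<partial>M) = (\<integral>\<^sup>+ x. ennreal s * ennreal \<bar>G w x\<bar> \<partial>M)"
    using s by (simp add: G abs_mult ennreal_mult)
  also have "\<dots> = ennreal s * (\<integral>\<^sup>+ x. ennreal \<bar>G w x\<bar> \<partial>M)"
    by (subst nn_integral_cmult) auto
  also have "\<dots> \<le> ennreal s * 1" by (intro mult_left_mono 1) auto
  finally show ?thesis by (simp add: s_def)
qed

text \<open>Gram-Schmidt applied to \<open>x\<close>, \<open>y\<close>, \<open>x'\<close>,
  \<open>y'\<close> produces four independent standard normals. In them the second event says that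
  the pair given by \<open>g3\<close> and \<open>g4\<close>, translated by a vector depending
  linearly on the first pair, lies in a slightly distorted cone \<open>B\<close>.\<close>

lemma cone_events_covariance:
  assumes x: "ip x x = 1" "ip y y = 1" "ip x y = 0"
    and x': "ip x' x' = 1" "ip y' y' = 1" "ip x' y' = 0"
    and \<rho>: "(ip x x')\<^sup>2 + (ip y x')\<^sup>2 + (ip x y')\<^sup>2 + (ip y y')\<^sup>2 \<le> \<rho>\<^sup>2" "0 \<le> \<rho>" "\<rho> \<le> 1 / 8"
    and \<theta>: "0 \<le> \<theta>" "\<theta> \<le> 1"
  shows "prob {\<omega> \<in> space M. \<bar>G x \<omega>\<bar> < \<theta> * \<bar>G y \<omega>\<bar> \<and> \<bar>G x' \<omega>\<bar> < \<theta> * \<bar>G y' \<omega>\<bar>}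
     - prob {\<omega> \<in> space M. \<bar>G x \<omega>\<bar> < \<theta> * \<bar>G y \<omega>\<bar>} * prob {\<omega> \<in> space M. \<bar>G x' \<omega>\<bar> < \<theta> * \<bar>G y' \<omega>\<bar>}
     \<le> 26112 * \<rho>\<^sup>2 * \<theta>\<^sup>2"
proof -
  define p q r s where "p = ip x x'" and "q = ip y x'" and "r = ip x y'" and "s = ip y y'"
  \<comment> \<open>\<open>P\<close> and \<open>Q\<close> are the squared lengths of the projections
    of \<open>x'\<close> and \<open>y'\<close> to the span of \<open>x\<close> and
    \<open>y\<close>.\<close>
  define P Q where "P = p\<^sup>2 + q\<^sup>2" and "Q = r\<^sup>2 + s\<^sup>2"
  have PQ: "0 \<le> P" "0 \<le> Q" "P + Q \<le> \<rho>\<^sup>2" using \<rho>(1) by (auto simp: P_def Q_def p_def q_def r_def s_def)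
  have \<rho>64: "\<rho>\<^sup>2 \<le> 1 / 64" using power_mono[OF \<rho>(3,2), of 2] by (simp add: power2_eq_square)
  define \<sigma>1 where "\<sigma>1 = sqrt (1 - P)"
  have \<sigma>1_sq: "\<sigma>1\<^sup>2 = 1 - P" and "\<sigma>1 \<le> 1"
    using PQ \<rho>64 by (auto simp: \<sigma>1_def)
  have \<sigma>1: "7 / 8 \<le> \<sigma>1"
    unfolding \<sigma>1_def using PQ \<rho>64 by (intro real_le_rsqrt) (simp add: power2_eq_square)
  \<comment> \<open>Removing these projections destroys the orthogonality of \<open>x'\<close> and
    \<open>y'\<close>; \<open>\<beta>\<close> is the resulting inner product of \<open>g3\<close>
    and \<open>y'\<close>.\<close>
  define \<beta> where "\<beta> = - (p * r + q * s) / \<sigma>1"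
  have CS: "(a * c + b * d)\<^sup>2 \<le> (a\<^sup>2 + b\<^sup>2) * (c\<^sup>2 + d\<^sup>2)" for a b c d :: real
    using zero_le_power2[of "a * d - b * c"] by (simp add: power2_eq_square algebra_simps)
  have \<beta>_sq: "\<beta>\<^sup>2 \<le> Q / 63"
  proof -
    have "\<beta>\<^sup>2 = (p * r + q * s)\<^sup>2 / (1 - P)" by (simp add: \<beta>_def power_divide \<sigma>1_sq) (simp add: power2_eq_square algebra_simps)
    also have "\<dots> \<le> P * Q / (1 - P)"
      using PQ \<rho>64 CS[of p r q s, folded P_def Q_def]
      by (intro divide_right_mono) auto
    also have "\<dots> \<le> ((1 / 64) * Q) / (63 / 64)"
      using PQ \<rho>64 by (intro frac_le mult_right_mono) auto
    finally show ?thesis by simp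
  qed
  have \<beta>: "\<bar>\<beta>\<bar> \<le> 1 / 8"
  proof (rule power2_le_imp_le)
    have "\<bar>\<beta>\<bar>\<^sup>2 \<le> Q / 63" using \<beta>_sq by simp
    also have "\<dots> \<le> (1 / 8)\<^sup>2" using PQ \<rho>64 by (simp add: power2_eq_square)
    finally show "\<bar>\<beta>\<bar>\<^sup>2 \<le> (1 / 8)\<^sup>2" .
  qed simp
  define \<sigma>2 where "\<sigma>2 = sqrt (1 - Q - \<beta>\<^sup>2)"
  have \<sigma>2_sq: "\<sigma>2\<^sup>2 = 1 - Q - \<beta>\<^sup>2" and \<sigma>2_ge: "62 / 63 \<le> \<sigma>2\<^sup>2" and \<sigma>2: "0 < \<sigma>2" "\<sigma>2 \<le> 1"
  proof -
    have "0 \<le> \<beta>\<^sup>2" by simp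
    then have "62 / 63 \<le> 1 - Q - \<beta>\<^sup>2" "1 - Q - \<beta>\<^sup>2 \<le> 1"
      using PQ \<rho>64 \<beta>_sq by linarith+
    then show "\<sigma>2\<^sup>2 = 1 - Q - \<beta>\<^sup>2" "62 / 63 \<le> \<sigma>2\<^sup>2" "0 < \<sigma>2" "\<sigma>2 \<le> 1"
      by (auto simp: \<sigma>2_def)
  qed
  define g3 where "g3 = (\<lambda>j. of_real (1 / \<sigma>1) * ((x' j - of_real p * x j) - of_real q * y j))"
  define g4 where "g4 = (\<lambda>j. of_real (1 / \<sigma>2) * (((y' j - of_real r * x j) - of_real s * y j) - of_real \<beta> * g3 j))"
  note sym = ip_commute[of y x] ip_commute[of x' x] ip_commute[of y' x] ip_commute[of x' y] ip_commute[of y' y]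
    ip_commute[of y' x']
  note vals = x x' p_def[symmetric] q_def[symmetric] r_def[symmetric] s_def[symmetric]
  have g3x: "ip x g3 = 0" "ip y g3 = 0"
    unfolding g3_def ip_linear by (simp_all add: sym vals)
  have g33: "ip g3 g3 = 1"
    using \<sigma>1 \<sigma>1_sq unfolding g3_def ip_linear
    by (simp add: sym vals) (simp add: P_def field_simps power2_eq_square)
  have g3y': "ip g3 y' = \<beta>"
    unfolding g3_def ip_linear by (simp add: sym vals \<beta>_def)
  have g4x: "ip x g4 = 0" "ip y g4 = 0"
    unfolding g4_def ip_linear by (simp_all add: sym vals g3x)
  have g34: "ip g3 g4 = 0"
    unfolding g4_def ip_linear by (simp add: g33 g3y' ip_commute[of g3 x] ip_commute[of g3 y] g3x)
  have comm: "ip g3 x = 0" "ip g3 y = 0" "ip y' g3 = \<beta>"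
    using g3x g3y' by (simp_all add: ip_commute)
  have g44: "ip g4 g4 = 1"
  proof -
    have "ip g4 g4 = (1 / \<sigma>2) * ((1 / \<sigma>2) * (1 - Q - \<beta>\<^sup>2))"
      unfolding g4_def ip_linear
      by (simp add: sym vals g3x g33 g3y' comm) (simp add: Q_def power2_eq_square algebra_simps)
    also have "\<dots> = (1 / \<sigma>2) * ((1 / \<sigma>2) * (\<sigma>2 * \<sigma>2))" unfolding \<sigma>2_sq[symmetric] by (simp add: power2_eq_square)
    also have "\<dots> = 1" using \<sigma>2 by simp
    finally show ?thesis .
  qed
  define V where "V i = (if i = 0 then G x else if i = 1 then G y else if i = 2 then G g3 else G g4)" for i :: nat
  have V: "V 0 = G x" "V 1 = G y" "V 2 = G g3" "V 3 = G g4" by (auto simp: V_def)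
  let ?T = "\<lambda>\<omega>. ((V 0 \<omega>, V 1 \<omega>), (V 2 \<omega>, V 3 \<omega>))"
  have law: "distr M borel ?T = std_normal2 \<Otimes>\<^sub>M std_normal2"
  proof (rule four_std_normal_law)
    show "V i \<in> borel_measurable M" for i by (simp add: V_def)
    fix a b c d :: real
    let ?z = "\<lambda>j. ((of_real a * x j + of_real b * y j) + of_real c * g3 j) + of_real d * g4 j"
    have "a * V 0 \<omega> + b * V 1 \<omega> + c * V 2 \<omega> + d * V 3 \<omega> = G ?z \<omega>" for \<omega>
      by (simp only: G_add G_scale V)
    moreover have "ip ?z ?z = a\<^sup>2 + b\<^sup>2 + c\<^sup>2 + d\<^sup>2"
      using ip_commute[of g4 x] ip_commute[of g4 y] ip_commute[of g4 g3]
      unfolding ip_linear by (simp add: sym x g3x g33 comm g4x g34 g44 power2_eq_square)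
    ultimately show "(\<integral>\<omega>. iexp (a * V 0 \<omega> + b * V 1 \<omega> + c * V 2 \<omega> + d * V 3 \<omega>) \<partial>M)
        = of_real (exp (- (a\<^sup>2 + b\<^sup>2 + c\<^sup>2 + d\<^sup>2) / 2))"
      by (simp only: char_G)
  qed
  \<comment> \<open>The aim is \<open>x' = \<sigma>1 (g3 + z1)\<close> and
    \<open>y' = \<beta> (g3 + z1) + \<sigma>2 (g4 + z2)\<close>: the dependence on the first pair
    enters as a translation, so that \<open>B\<close> is a fixed set.\<close>
  define z1 where "z1 u = (p * fst u + q * snd u) / \<sigma>1" for u :: "real \<times> real"
  define z2 where "z2 u = (r * fst u + s * snd u - \<beta> * z1 u) / \<sigma>2" for u :: "real \<times> real"
  define A where "A = {w :: real \<times> real. \<bar>fst w\<bar> < \<theta> * \<bar>snd w\<bar>}"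
  define B where "B = {w :: real \<times> real. \<bar>\<sigma>1 * fst w\<bar> < \<theta> * \<bar>\<beta> * fst w + \<sigma>2 * snd w\<bar>}"
  have x'_eq: "G x' \<omega> = \<sigma>1 * (G g3 \<omega> + z1 (G x \<omega>, G y \<omega>))" for \<omega>
  proof -
    have "G g3 \<omega> = (1 / \<sigma>1) * ((G x' \<omega> - p * G x \<omega>) - q * G y \<omega>)"
      unfolding g3_def by (simp only: G_scale G_diff)
    then show ?thesis using \<sigma>1 by (simp add: z1_def field_simps)
  qed
  have y'_eq: "G y' \<omega> = \<beta> * (G g3 \<omega> + z1 (G x \<omega>, G y \<omega>)) + \<sigma>2 * (G g4 \<omega> + z2 (G x \<omega>, G y \<omega>))" for \<omega>
  proof -
    have "G g4 \<omega> = (1 / \<sigma>2) * (((G y' \<omega> - r * G x \<omega>) - s * G y \<omega>) - \<beta> * G g3 \<omega>)"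
      unfolding g4_def by (simp only: G_scale G_diff)
    then have "\<sigma>2 * G g4 \<omega> = G y' \<omega> - r * G x \<omega> - s * G y \<omega> - \<beta> * G g3 \<omega>"
      using \<sigma>2 by simp
    moreover have "\<sigma>2 * z2 (G x \<omega>, G y \<omega>) = r * G x \<omega> + s * G y \<omega> - \<beta> * z1 (G x \<omega>, G y \<omega>)"
      using \<sigma>2 by (simp add: z2_def)
    ultimately show ?thesis by (simp add: distrib_left)
  qed
  have A_sets [measurable]: "A \<in> sets borel" unfolding A_def by (rule double_cone_sets)
  have B_sets [measurable]: "B \<in> sets borel"
    unfolding B_def by (intro borel_open open_Collect_less continuous_intros)
  have z_meas: "(\<lambda>u. (z1 u, z2 u)) \<in> borel_measurable borel"
    unfolding z1_def z2_def using \<sigma>1 \<sigma>2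
    by (intro borel_measurable_continuous_onI continuous_intros) auto
  \<comment> \<open>Cauchy-Schwarz bounds the linear map by P and Q; dividing by
    \<open>\<sigma>1\<close> and \<open>\<sigma>2\<close> and subtracting the \<open>\<beta>\<close>
    term costs a bounded factor, and 4 (P + Q) is enough for the squared norm.\<close>
  have z_norm: "norm (z1 u, z2 u) \<le> (2 * \<rho>) * norm u" for u
  proof -
    let ?n = "(norm u)\<^sup>2"
    have n: "?n = (fst u)\<^sup>2 + (snd u)\<^sup>2" by (cases u) (simp add: norm_Pair)
    have z1: "(z1 u)\<^sup>2 \<le> (64 / 63) * (P * ?n)"
    proof -
      have "(z1 u)\<^sup>2 = (p * fst u + q * snd u)\<^sup>2 / (1 - P)"
        by (simp add: z1_def power_divide \<sigma>1_sq)
      also have "\<dots> \<le> (P * ?n) / (63 / 64)"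
        using CS[of p "fst u" q "snd u"] PQ \<rho>64 by (intro frac_le) (auto simp: P_def n)
      finally show ?thesis by simp
    qed
    have "(\<beta> * z1 u)\<^sup>2 \<le> (Q / 63) * ((64 / 63) * (P * ?n))"
      unfolding power_mult_distrib using \<beta>_sq z1 PQ by (intro mult_mono) auto
    also have "\<dots> \<le> (1 / 63) * (Q * ?n)"
    proof -
      have "(64 / 63) * P \<le> 1" using PQ \<rho>64 by simp
      then have "(1 / 63 * (Q * ?n)) * ((64 / 63) * P) \<le> (1 / 63 * (Q * ?n)) * 1"
        using PQ by (intro mult_left_mono) auto
      then show ?thesis by (simp add: mult_ac)
    qed
    finally have bz: "(\<beta> * z1 u)\<^sup>2 \<le> (1 / 63) * (Q * ?n)" .
    have sq_diff: "(v - w)\<^sup>2 \<le> 2 * v\<^sup>2 + 2 * w\<^sup>2" for v w :: real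
      using zero_le_power2[of "v + w"] by (simp add: power2_eq_square algebra_simps)
    have z2: "(z2 u)\<^sup>2 \<le> 3 * (Q * ?n)"
    proof -
      have Qn: "0 \<le> Q * ?n" using PQ by simp
      have "(r * fst u + s * snd u - \<beta> * z1 u)\<^sup>2 \<le> 2 * (Q * ?n) + 2 * ((1 / 63) * (Q * ?n))"
        using sq_diff[of "r * fst u + s * snd u" "\<beta> * z1 u"] CS[of r "fst u" s "snd u"] bz
        unfolding n Q_def by linarith
      also have "\<dots> \<le> 2.1 * (Q * ?n)" using Qn by simp
      finally have "(z2 u)\<^sup>2 \<le> 2.1 * (Q * ?n) / \<sigma>2\<^sup>2"
        unfolding z2_def power_divide by (intro divide_right_mono) auto
      also have "\<dots> \<le> 2.1 * (Q * ?n) / (62 / 63)"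
        using \<sigma>2_ge Qn by (intro frac_le) auto
      also have "\<dots> \<le> 3 * (Q * ?n)" using Qn by simp
      finally show ?thesis .
    qed
    have "(norm (z1 u, z2 u))\<^sup>2 = (z1 u)\<^sup>2 + (z2 u)\<^sup>2" by (simp add: norm_Pair)
    also have "\<dots> \<le> 4 * ((P + Q) * ?n)"
    proof -
      have "0 \<le> P * ?n" "0 \<le> Q * ?n" using PQ by auto
      then show ?thesis using z1 z2 by (simp add: distrib_right)
    qed
    also have "\<dots> \<le> 4 * (\<rho>\<^sup>2 * ?n)" using PQ by (intro mult_left_mono mult_right_mono) auto
    also have "\<dots> = ((2 * \<rho>) * norm u)\<^sup>2" by (simp add: power_mult_distrib)
    finally show ?thesis by (rule power2_le_imp_le) (use \<rho> in auto)
  qed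
  \<comment> \<open>The distortion is small enough for the aperture to grow at most from \<theta> to
    2 \<theta>: \<open>\<sigma>1\<close> is at least 7/8 and |\<open>\<beta>\<close>| at most
    1/8.\<close>
  have B_cone: "B \<subseteq> {w. \<bar>fst w\<bar> < 2 * \<theta> * \<bar>snd w\<bar>}"
  proof
    fix w assume "w \<in> B"
    then have "\<sigma>1 * \<bar>fst w\<bar> < \<theta> * \<bar>\<beta> * fst w + \<sigma>2 * snd w\<bar>"
      using \<sigma>1 by (simp add: B_def abs_mult)
    also have "\<dots> \<le> \<theta> * (1 / 8 * \<bar>fst w\<bar> + 1 * \<bar>snd w\<bar>)"
    proof (rule mult_left_mono[OF _ \<theta>(1)])
      have "\<bar>\<beta> * fst w + \<sigma>2 * snd w\<bar> \<le> \<bar>\<beta>\<bar> * \<bar>fst w\<bar> + \<bar>\<sigma>2\<bar> * \<bar>snd w\<bar>"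
        by (simp add: abs_mult[symmetric])
      also have "\<dots> \<le> 1 / 8 * \<bar>fst w\<bar> + 1 * \<bar>snd w\<bar>"
        using \<beta> \<sigma>2 by (intro add_mono mult_right_mono) auto
      finally show "\<bar>\<beta> * fst w + \<sigma>2 * snd w\<bar> \<le> 1 / 8 * \<bar>fst w\<bar> + 1 * \<bar>snd w\<bar>" .
    qed
    also have "\<dots> \<le> 1 / 8 * \<bar>fst w\<bar> + \<theta> * \<bar>snd w\<bar>"
      using mult_right_mono[OF \<theta>(2), of "1 / 8 * \<bar>fst w\<bar>"] by (simp add: distrib_left)
    finally have "\<sigma>1 * \<bar>fst w\<bar> < 1 / 8 * \<bar>fst w\<bar> + \<theta> * \<bar>snd w\<bar>" .
    moreover have "7 / 8 * \<bar>fst w\<bar> \<le> \<sigma>1 * \<bar>fst w\<bar>" using \<sigma>1 by (intro mult_right_mono) auto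
    ultimately have "3 / 4 * \<bar>fst w\<bar> < \<theta> * \<bar>snd w\<bar>" by simp
    then show "w \<in> {w. \<bar>fst w\<bar> < 2 * \<theta> * \<bar>snd w\<bar>}" by auto
  qed
  have B_sym: "- w \<in> B \<longleftrightarrow> w \<in> B" for w
  proof -
    have "\<bar>- (\<beta> * fst w) - \<sigma>2 * snd w\<bar> = \<bar>\<beta> * fst w + \<sigma>2 * snd w\<bar>"
      using abs_minus_cancel[of "\<beta> * fst w + \<sigma>2 * snd w"] by simp
    then show ?thesis by (simp add: B_def)
  qed
  have sets_NN: "sets (std_normal2 \<Otimes>\<^sub>M std_normal2) = sets borel"
    unfolding law[symmetric] by simp
  have [measurable]: "V i \<in> borel_measurable M" for i
    by (simp add: V_def)
  have transfer: "measure (std_normal2 \<Otimes>\<^sub>M std_normal2) S = prob {\<omega> \<in> space M. ?T \<omega> \<in> S}"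
    if "S \<in> sets borel" for S
    unfolding law[symmetric] using that
    by (subst measure_distr) (auto intro!: arg_cong[where f = prob])
  have z_meas' [measurable]: "(\<lambda>w :: (real \<times> real) \<times> real \<times> real. snd w + (z1 (fst w), z2 (fst w))) \<in> borel_measurable borel"
    unfolding z1_def z2_def using \<sigma>1 \<sigma>2
    by (intro borel_measurable_continuous_onI continuous_intros) auto
  have S1: "{w. fst w \<in> A} \<in> sets (borel :: ((real \<times> real) \<times> real \<times> real) measure)"
    using measurable_sets_borel[OF borel_measurable_continuous_onI[OF continuous_on_fst[OF continuous_on_id]] A_sets]
    by (simp add: vimage_def)
  have S2: "{w. snd w + (z1 (fst w), z2 (fst w)) \<in> B} \<in> sets (borel :: ((real \<times> real) \<times> real \<times> real) measure)"
    using measurable_sets_borel[OF z_meas' B_sets] by (simp add: vimage_def)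
  have S12: "{w. fst w \<in> A \<and> snd w + (z1 (fst w), z2 (fst w)) \<in> B} \<in> sets (borel :: ((real \<times> real) \<times> real \<times> real) measure)"
    using sets.Int[OF S1 S2] by (simp add: Collect_conj_eq)
  have e1: "?T \<omega> \<in> {w. fst w \<in> A} \<longleftrightarrow> \<bar>G x \<omega>\<bar> < \<theta> * \<bar>G y \<omega>\<bar>" for \<omega>
    by (simp add: A_def V[unfolded One_nat_def])
  have e2: "?T \<omega> \<in> {w. snd w + (z1 (fst w), z2 (fst w)) \<in> B} \<longleftrightarrow> \<bar>G x' \<omega>\<bar> < \<theta> * \<bar>G y' \<omega>\<bar>" for \<omega>
    by (simp add: B_def V[unfolded One_nat_def] x'_eq y'_eq)
  have e12: "?T \<omega> \<in> {w. fst w \<in> A \<and> snd w + (z1 (fst w), z2 (fst w)) \<in> B}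
     \<longleftrightarrow> \<bar>G x \<omega>\<bar> < \<theta> * \<bar>G y \<omega>\<bar> \<and> \<bar>G x' \<omega>\<bar> < \<theta> * \<bar>G y' \<omega>\<bar>" for \<omega>
    using e1[of \<omega>] e2[of \<omega>] by simp
  have mA: "measure std_normal2 A = measure (std_normal2 \<Otimes>\<^sub>M std_normal2) {w. fst w \<in> A}"
  proof -
    interpret N: prob_space std_normal2 by (rule prob_space_std_normal2)
    have sA: "A \<in> sets std_normal2" unfolding std_normal2_eq by simp
    have "emeasure (std_normal2 \<Otimes>\<^sub>M std_normal2) (A \<times> space std_normal2)
       = emeasure std_normal2 A * emeasure std_normal2 (space std_normal2)"
      by (rule N.emeasure_pair_measure_Times[OF sA sets.top])
    moreover have "A \<times> space std_normal2 = {w. fst w \<in> A}"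
      by (auto simp: std_normal2_eq space_pair_measure)
    ultimately show ?thesis by (simp add: measure_def N.emeasure_space_1)
  qed
  \<comment> \<open>With \<epsilon> = 2 \<rho> the hypothesis \<rho> \<le> 1/8 becomes \<epsilon>
    \<le> 1/4, and 26112 = 4 * 6528.\<close>
  have "measure (std_normal2 \<Otimes>\<^sub>M std_normal2) {w. fst w \<in> A \<and> snd w + (z1 (fst w), z2 (fst w)) \<in> B}
      - measure std_normal2 A * measure (std_normal2 \<Otimes>\<^sub>M std_normal2) {w. snd w + (z1 (fst w), z2 (fst w)) \<in> B}
      \<le> 6528 * (2 * \<rho>)\<^sup>2 * \<theta>\<^sup>2"
    by (rule cone_covariance[OF A_sets _ B_sets B_sym B_cone \<theta>(1) _ _ z_meas z_norm])
      (use \<rho> in \<open>auto simp: A_def\<close>)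
  then show ?thesis
    unfolding mA transfer[OF S1] transfer[OF S2] transfer[OF S12] e1 e2 e12
    by (simp add: power_mult_distrib)
qed

end

section \<open>Sign changes and derivatives\<close>

text \<open>The clause \<open>z < Max Z\<close> carries the induction: the zero of the derivative
  found between the two largest points of \<open>Z\<close> lies beyond all those found before, hence
  is new.\<close>

lemma Rolle_finite_set:
  fixes g g' :: "real \<Rightarrow> real"
  assumes deriv: "\<And>t. (g has_real_derivative g' t) (at t)"
    and "finite Z" "card Z = Suc n" "Z \<subseteq> {a..b}" "\<And>z. z \<in> Z \<Longrightarrow> g z = 0"
  shows "\<exists>Z'. finite Z' \<and> card Z' = n \<and> Z' \<subseteq> {a..b} \<and> (\<forall>z\<in>Z'. g' z = 0 \<and> z < Max Z)"
  using assms(2-)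
proof (induction n arbitrary: Z)
  case 0
  show ?case by (intro exI[of _ "{}"]) auto
next
  case (Suc n)
  define m where "m = Max Z"
  define Z0 where "Z0 = Z - {m}"
  have "Z \<noteq> {}" using Suc.prems by auto
  then have m: "m \<in> Z" unfolding m_def using Suc.prems by (intro Max_in)
  have Z0: "finite Z0" "card Z0 = Suc n" "Z0 \<subseteq> {a..b}" "\<And>z. z \<in> Z0 \<Longrightarrow> g z = 0"
    using Suc.prems m by (auto simp: Z0_def)
  then obtain Z' where Z': "finite Z'" "card Z' = n" "Z' \<subseteq> {a..b}" "\<And>z. z \<in> Z' \<Longrightarrow> g' z = 0 \<and> z < Max Z0"
    using Suc.IH[of Z0] by blast
  have "Z0 \<noteq> {}" using Z0 by auto
  then have M0: "Max Z0 \<in> Z0" using Z0 by (intro Max_in)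
  then have lt: "Max Z0 < m"
    using Suc.prems unfolding Z0_def m_def by (metis Diff_iff Max_ge insertI1 order_le_imp_less_or_eq)
  have cont: "continuous_on {Max Z0..m} g"
    by (intro continuous_at_imp_continuous_on ballI) (metis DERIV_isCont deriv)
  have "\<exists>y>Max Z0. y < m \<and> (\<lambda>h. h * g' y) = (\<lambda>v. 0)"
  proof (rule Rolle_deriv[OF lt])
    show "g (Max Z0) = g m" using Suc.prems(4) Z0(4) M0 m by simp
    show "(g has_derivative (\<lambda>h. h * g' x)) (at x)" for x
    proof -
      have "(*) (g' x) = (\<lambda>h. h * g' x)" by (auto simp: mult.commute)
      then show ?thesis using deriv[of x] by (simp add: has_field_derivative_def)
    qed
  qed (rule cont)
  then obtain y where y: "Max Z0 < y" "y < m" "g' y = 0"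
    by (auto dest: fun_cong[of _ _ 1])
  have "y \<in> {a..b}" using y M0 m Z0(3) Suc.prems(3) by force
  moreover have "y \<notin> Z'" using Z'(4) y by fastforce
  moreover have "z < m" if "z \<in> Z'" for z using Z'(4)[OF that] lt by simp
  ultimately show ?case
    using Z' y by (intro exI[of _ "insert y Z'"]) (auto simp: m_def)
qed

lemma derivatives_vanish:
  fixes F :: "nat \<Rightarrow> real \<Rightarrow> real"
  assumes deriv: "\<And>l t. (F l has_real_derivative F (Suc l) t) (at t)"
    and Z: "finite Z" "card Z = n" "Z \<subseteq> {a..b}" "\<And>z. z \<in> Z \<Longrightarrow> F 0 z = 0"
    and l: "l < n"
  shows "\<exists>z\<in>{a..b}. F l z = 0"
proof -
  have "\<exists>Z'. finite Z' \<and> card Z' = n - l \<and> Z' \<subseteq> {a..b} \<and> (\<forall>z\<in>Z'. F l z = 0)" if "l < n" for l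
    using that
  proof (induction l)
    case 0
    then show ?case using Z by (intro exI[of _ Z]) auto
  next
    case (Suc l)
    then obtain Z' where Z': "finite Z'" "card Z' = n - l" "Z' \<subseteq> {a..b}" "\<And>z. z \<in> Z' \<Longrightarrow> F l z = 0"
      by (metis Suc_lessD)
    moreover have "n - l = Suc (n - Suc l)" using Suc.prems by simp
    ultimately show ?case
      using Rolle_finite_set[OF deriv[of l], of Z' "n - Suc l" a b] by metis
  qed
  from this[OF l] obtain Z' where "card Z' = n - l" "Z' \<subseteq> {a..b}" "\<forall>z\<in>Z'. F l z = 0"
    by blast
  moreover have "Z' \<noteq> {}" using calculation l by auto
  ultimately show ?thesis by blast
qed

text \<open>Each derivative up to order n vanishes somewhere in the interval. At order n the
  fundamental theorem bounds it by the integral of the next derivative; going down, every order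
  costs a factor b - a by the mean value theorem. The expectation of an integral, unlike that of a
  supremum, is accessible through Fubini.\<close>

lemma abs_le_of_many_zeros:
  fixes F :: "nat \<Rightarrow> real \<Rightarrow> real"
  assumes deriv: "\<And>l t. (F l has_real_derivative F (Suc l) t) (at t)"
    and Z: "finite Z" "card Z = Suc n" "Z \<subseteq> {a..b}" "\<And>z. z \<in> Z \<Longrightarrow> F 0 z = 0"
    and t: "t \<in> {a..b}"
  shows "ennreal \<bar>F 0 t\<bar> \<le> ennreal ((b - a) ^ n) * (\<integral>\<^sup>+ u. ennreal \<bar>F (Suc n) u\<bar> * indicator {a..b} u \<partial>lborel)"
proof -
  let ?W = "\<integral>\<^sup>+ u. ennreal \<bar>F (Suc n) u\<bar> * indicator {a..b} u \<partial>lborel"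
  have ab: "0 \<le> b - a" using t by simp
  have cont: "isCont (F l) u" for l u using deriv by (rule DERIV_isCont)
  have FTC: "ennreal \<bar>F n y - F n x\<bar> \<le> ?W" if "x \<le> y" "x \<in> {a..b}" "y \<in> {a..b}" for x y
  proof -
    have hb: "has_bochner_integral lborel (\<lambda>u. F (Suc n) u * indicator {x..y} u) (F n y - F n x)"
      using that(1) deriv cont by (intro has_bochner_integral_FTC_Icc_real) auto
    have "ennreal (norm (F n y - F n x)) \<le> (\<integral>\<^sup>+ u. ennreal (norm (F (Suc n) u * indicator {x..y} u)) \<partial>lborel)"
      using hb integral_norm_bound_ennreal[of lborel "\<lambda>u. F (Suc n) u * indicator {x..y} u"]
      by (simp add: has_bochner_integral_iff)
    also have "\<dots> \<le> ?W"
      using that by (intro nn_integral_mono) (auto simp: indicator_def)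
    finally show ?thesis by simp
  qed
  have "\<forall>t\<in>{a..b}. ennreal \<bar>F l t\<bar> \<le> ennreal ((b - a) ^ (n - l)) * ?W" if "l \<le> n" for l
    using that
  proof (induction l rule: inc_induct)
    case base
    obtain z where z: "z \<in> {a..b}" "F n z = 0"
      using derivatives_vanish[OF deriv Z, of n] by auto
    show ?case
    proof
      fix t assume t: "t \<in> {a..b}"
      show "ennreal \<bar>F n t\<bar> \<le> ennreal ((b - a) ^ (n - n)) * ?W"
        using FTC[of z t] FTC[of t z] z t by (cases "z \<le> t") auto
    qed
  next
    case (step l)
    obtain z where z: "z \<in> {a..b}" "F l z = 0"
      using derivatives_vanish[OF deriv Z, of l] step by auto
    show ?case
    proof
      fix t assume t: "t \<in> {a..b}"
      have "\<exists>\<xi>\<in>{a..b}. \<bar>F l t\<bar> \<le> (b - a) * \<bar>F (Suc l) \<xi>\<bar>"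
      proof (cases "t = z")
        case True
        then show ?thesis using z ab t by (intro bexI[of _ t]) auto
      next
        case False
        then consider "z < t" | "t < z" by linarith
        then show ?thesis
        proof cases
          case 1
          obtain \<xi> where "z < \<xi>" "\<xi> < t" "F l t - F l z = (t - z) * F (Suc l) \<xi>"
            using MVT2[OF 1, of "F l" "F (Suc l)"] deriv by auto
          then show ?thesis
            using z t 1 by (intro bexI[of _ \<xi>]) (auto simp: abs_mult intro!: mult_right_mono)
        next
          case 2
          obtain \<xi> where \<xi>: "t < \<xi>" "\<xi> < z" "F l z - F l t = (z - t) * F (Suc l) \<xi>"
            using MVT2[OF 2, of "F l" "F (Suc l)"] deriv by auto
          then have "\<bar>F l t\<bar> = (z - t) * \<bar>F (Suc l) \<xi>\<bar>"
            using z 2 by (metis abs_minus_commute abs_mult abs_of_pos diff_0_right diff_gt_0_iff_gt)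
          also have "\<dots> \<le> (b - a) * \<bar>F (Suc l) \<xi>\<bar>" using z t by (intro mult_right_mono) auto
          finally show ?thesis using \<xi> z t by (intro bexI[of _ \<xi>]) auto
        qed
      qed
      then obtain \<xi> where \<xi>: "\<xi> \<in> {a..b}" "\<bar>F l t\<bar> \<le> (b - a) * \<bar>F (Suc l) \<xi>\<bar>" by blast
      have "ennreal \<bar>F l t\<bar> \<le> ennreal (b - a) * ennreal \<bar>F (Suc l) \<xi>\<bar>"
        using \<xi>(2) ab by (subst ennreal_mult[symmetric]) (auto intro: ennreal_leI)
      also have "\<dots> \<le> ennreal (b - a) * (ennreal ((b - a) ^ (n - Suc l)) * ?W)"
        using step.IH \<xi>(1) by (intro mult_left_mono) auto
      also have "\<dots> = ennreal ((b - a) ^ (n - l)) * ?W"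
      proof -
        have "(b - a) ^ (n - l) = (b - a) * (b - a) ^ (n - Suc l)"
          using step by (metis Suc_diff_Suc power_Suc)
        then show ?thesis using ab by (simp add: ennreal_mult mult.assoc)
      qed
      finally show "ennreal \<bar>F l t\<bar> \<le> ennreal ((b - a) ^ (n - l)) * ?W" .
    qed
  qed
  from this[of 0] t show ?thesis by simp
qed

text \<open>Strict sign changes put the zeros into the open cells, which are disjoint; this makes
  the choice injective.\<close>

lemma sign_changes_give_zeros:
  fixes f :: "real \<Rightarrow> real"
  assumes cont: "\<And>t. isCont f t" and h: "0 < h"
    and C: "\<And>i. i \<in> C \<Longrightarrow> f (real i * h) * f (real (Suc i) * h) < 0"
  shows "\<exists>\<zeta>. inj_on \<zeta> C \<and> (\<forall>i\<in>C. real i * h < \<zeta> i \<and> \<zeta> i < real (Suc i) * h \<and> f (\<zeta> i) = 0)"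
proof -
  have ex: "\<exists>z. real i * h < z \<and> z < real (Suc i) * h \<and> f z = 0" if "i \<in> C" for i
  proof -
    let ?a = "real i * h" and ?b = "real (Suc i) * h"
    have ab: "?a \<le> ?b" using h by (simp add: distrib_right)
    have "\<exists>z\<ge>?a. z \<le> ?b \<and> f z = 0"
    proof (cases "f ?a < 0")
      case True
      then have "0 < f ?b" using C[OF that] by (simp add: mult_less_0_iff)
      then show ?thesis using True IVT[of f ?a 0 ?b] ab cont by auto
    next
      case False
      then have "f ?b < 0" "0 < f ?a" using C[OF that] by (auto simp: mult_less_0_iff)
      then show ?thesis using IVT2[of f ?b 0 ?a] ab cont by auto
    qed
    then obtain z where z: "?a \<le> z" "z \<le> ?b" "f z = 0" by blast
    moreover have "z \<noteq> ?a" "z \<noteq> ?b" using z(3) C[OF that] by auto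
    ultimately show ?thesis by (intro exI[of _ z]) auto
  qed
  then obtain \<zeta> where \<zeta>: "\<And>i. i \<in> C \<Longrightarrow> real i * h < \<zeta> i \<and> \<zeta> i < real (Suc i) * h \<and> f (\<zeta> i) = 0"
    by metis
  have "\<zeta> i \<noteq> \<zeta> j" if "i \<in> C" "j \<in> C" "i < j" for i j
  proof -
    have "real (Suc i) * h \<le> real j * h" using that(3) h by (intro mult_right_mono) auto
    then show ?thesis using \<zeta>[OF that(1)] \<zeta>[OF that(2)] by linarith
  qed
  then have "inj_on \<zeta> C" by (metis inj_onI linorder_neqE_nat)
  then show ?thesis using \<zeta> by blast
qed

section \<open>Roots of unity and elementary trigonometric bounds\<close>

text \<open>The summands are the powers of an n-th root of unity, which is not 1 because d is not a
  multiple of n. This is the orthogonality of characters on the grid.\<close>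

lemma sum_cis_multiples:
  fixes d :: int and n :: nat
  assumes "0 < n" "\<bar>d\<bar> < int n" "d \<noteq> 0"
  shows "(\<Sum>i<n. cis (2 * pi * of_int d * (real i / real n))) = 0"
proof -
  let ?z = "cis (2 * pi * of_int d / real n)"
  have "?z \<noteq> 1"
  proof
    assume "?z = 1"
    then have "cos (2 * pi * of_int d / real n) = 1" by (simp add: complex_eq_iff)
    then obtain m :: int where "2 * pi * of_int d / real n = of_int m * 2 * pi"
      by (auto simp: cos_one_2pi_int)
    then have "real_of_int d = of_int m * real n" using assms(1) by (simp add: field_simps)
    then have "d = m * int n" by (metis of_int_eq_iff of_int_mult of_int_of_nat_eq)
    then have "\<bar>d\<bar> = \<bar>m\<bar> * int n" by (simp add: abs_mult)
    moreover have "m \<noteq> 0" using \<open>d = m * int n\<close> assms(3) by auto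
    then have "1 * int n \<le> \<bar>m\<bar> * int n" by (intro mult_right_mono) auto
    ultimately show False using assms(2) by simp
  qed
  moreover have "?z ^ n = 1"
  proof -
    have "?z ^ n = cis (2 * pi * of_int d)" using assms(1) by (simp add: Complex.DeMoivre)
    also have "\<dots> = 1" using cos_int_2pin[of d] sin_int_2pin[of d] by (simp add: complex_eq_iff)
    finally show ?thesis .
  qed
  moreover have "cis (2 * pi * of_int d * (real i / real n)) = ?z ^ i" for i
    by (simp add: Complex.DeMoivre mult_ac)
  ultimately show ?thesis by (simp add: geometric_sum)
qed

text \<open>By the mean value theorem sin x = x cos \<xi> with cos \<xi> at least cos (pi /
  4).\<close>

lemma sin_squared_lower:
  fixes x :: real
  assumes "\<bar>x\<bar> \<le> pi / 4"
  shows "x\<^sup>2 / 2 \<le> (sin x)\<^sup>2"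
proof -
  have *: "x\<^sup>2 / 2 \<le> (sin x)\<^sup>2" if x: "0 < x" "x \<le> pi / 4" for x :: real
  proof -
    obtain \<xi> where \<xi>: "0 < \<xi>" "\<xi> < x" "sin x - sin 0 = (x - 0) * cos \<xi>"
      using MVT2[OF x(1), of sin cos] by (auto intro: DERIV_sin)
    have "cos (pi / 4) \<le> cos \<xi>"
      using \<xi> x pi_gt_zero by (subst cos_mono_le_eq) auto
    then have "(sqrt 2 / 2)\<^sup>2 \<le> (cos \<xi>)\<^sup>2" by (intro power_mono) (auto simp: cos_45)
    then have "x\<^sup>2 * (1 / 2) \<le> x\<^sup>2 * (cos \<xi>)\<^sup>2"
      by (intro mult_left_mono) (auto simp: power_divide)
    then show ?thesis using \<xi>(3) by (simp add: power_mult_distrib)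
  qed
  show ?thesis
    using *[of x] *[of "- x"] assms by (cases "x = 0"; cases "0 < x") auto
qed

lemma cos_squared_lower:
  fixes x :: real
  assumes "\<bar>x\<bar> \<le> pi / 4"
  shows "1 / 2 \<le> (cos x)\<^sup>2"
proof -
  have "cos (pi / 4) \<le> cos \<bar>x\<bar>"
    using assms pi_gt_zero by (subst cos_mono_le_eq) auto
  then have "(sqrt 2 / 2)\<^sup>2 \<le> (cos \<bar>x\<bar>)\<^sup>2" by (intro power_mono) (auto simp: cos_45)
  then show ?thesis by (simp add: power_divide)
qed

section \<open>Gaussian trigonometric polynomials\<close>

lemma has_real_derivative_Re_cis:
  "((\<lambda>t. Re (w * cis (a * t) * b)) has_real_derivative Re (w * (\<i> * of_real a) * cis (a * t) * b)) (at t)"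
proof -
  have 1: "Re (w * cis (a * t) * b) = Re (w * b) * cos (a * t) - Im (w * b) * sin (a * t)" for t
    by (simp add: algebra_simps)
  have 2: "Re (w * (\<i> * of_real a) * cis (a * t) * b) = - (Re (w * b) * (a * sin (a * t))) - Im (w * b) * (a * cos (a * t))"
    by (simp add: algebra_simps)
  show ?thesis
    unfolding 1 2 by (auto intro!: derivative_eq_intros simp: algebra_simps)
qed

text \<open>The last three assumptions abstract the geometry: for the wave, \<open>k\<close> is
  \<mu> . v and \<open>K\<close> is |v| sqrt m. \<open>second_moment\<close> keeps the typical
  frequency comparable with the largest one, so that increments over a cell do not degenerate;
  \<open>\<kappa>\<close> bounds the number of frequencies that coincide after restriction to the
  line.\<close>

locale gaussian_trig = gaussian_coefficients M J b
  for M :: "'a measure" and J :: "'j set" and b +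
  fixes k :: "'j \<Rightarrow> int" and K :: real and \<kappa> :: nat
  assumes J_nonempty: "J \<noteq> {}"
    and K_ge_1: "1 \<le> K"
    and k_le: "\<And>j. j \<in> J \<Longrightarrow> \<bar>real_of_int (k j)\<bar> \<le> K"
    and second_moment: "K\<^sup>2 * real (card J) \<le> 3 * (\<Sum>j\<in>J. (real_of_int (k j))\<^sup>2)"
    and multiplicity: "\<And>j. j \<in> J \<Longrightarrow> card {i \<in> J. k i = k j} \<le> \<kappa>"
begin

definition c :: real where "c = 1 / sqrt (real (card J))"

lemma card_J_pos: "0 < card J"
  using finite_J J_nonempty by (simp add: card_gt_0_iff)

lemma c_sq: "c\<^sup>2 = 1 / real (card J)"
  by (simp add: c_def power_divide)

lemma c_pos: "0 < c"
  using card_J_pos by (simp add: c_def)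

text \<open>The coefficient vector of the l-th derivative at t, so that all derivatives are linear
  forms in the same Gaussian vector.\<close>

definition dv :: "nat \<Rightarrow> real \<Rightarrow> 'j \<Rightarrow> complex" where
  "dv l t j = of_real c * (\<i> * of_real (2 * pi * of_int (k j))) ^ l * cis (2 * pi * of_int (k j) * t)"

definition F :: "nat \<Rightarrow> real \<Rightarrow> 'a \<Rightarrow> real" where
  "F l t \<omega> = G (dv l t) \<omega>"

lemma F_deriv: "((\<lambda>t. F l t \<omega>) has_real_derivative F (Suc l) t \<omega>) (at t)"
proof -
  have "((\<lambda>t. \<Sum>j\<in>J. Re (of_real c * (\<i> * of_real (2 * pi * of_int (k j))) ^ l * cis (2 * pi * of_int (k j) * t) * b j \<omega>))
    has_real_derivative
      (\<Sum>j\<in>J. Re (of_real c * (\<i> * of_real (2 * pi * of_int (k j))) ^ l * (\<i> * of_real (2 * pi * of_int (k j)))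
        * cis (2 * pi * of_int (k j) * t) * b j \<omega>))) (at t)"
    by (intro DERIV_sum has_real_derivative_Re_cis)
  then show ?thesis
    by (simp add: F_def G_def dv_def mult.assoc power_Suc2 del: power_Suc)
qed

lemma F_isCont: "isCont (\<lambda>t. F l t \<omega>) t"
  using F_deriv by (rule DERIV_isCont)

lemma F_measurable [measurable]: "F l t \<in> borel_measurable M"
  unfolding F_def[abs_def] by measurable

lemma F_measurable_pair: "(\<lambda>(x, t). F l t x) \<in> borel_measurable (M \<Otimes>\<^sub>M lborel)"
proof -
  have [measurable]: "cis \<in> borel_measurable borel"
    by (intro borel_measurable_continuous_onI continuous_intros)
  have "(\<lambda>p. Re (dv l (snd p) j * b j (fst p))) \<in> borel_measurable (M \<Otimes>\<^sub>M lborel)" if "j \<in> J" for j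
    using b_measurable[OF that] unfolding dv_def by measurable
  then show ?thesis
    unfolding F_def G_def case_prod_beta' by (intro borel_measurable_sum)
qed

lemma ip_dv: "ip (dv l t) (dv l t) \<le> ((2 * pi * K) ^ l)\<^sup>2"
proof -
  have "ip (dv l t) (dv l t) = (\<Sum>j\<in>J. c\<^sup>2 * ((2 * pi * \<bar>real_of_int (k j)\<bar>) ^ l)\<^sup>2)"
    unfolding ip_self using c_pos
    by (intro sum.cong) (auto simp: dv_def norm_mult norm_power power_mult_distrib abs_mult)
  also have "\<dots> \<le> (\<Sum>j\<in>J. c\<^sup>2 * ((2 * pi * K) ^ l)\<^sup>2)"
    using k_le by (intro sum_mono mult_left_mono power_mono) auto
  also have "\<dots> = ((2 * pi * K) ^ l)\<^sup>2"
    using card_J_pos by (simp add: c_sq)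
  finally show ?thesis .
qed

lemma ip_dv_0: "ip (dv 0 t) (dv 0 t) = 1"
  using card_J_pos c_pos by (simp add: ip_self dv_def norm_mult c_sq)

lemma expectation_abs_F: "(\<integral>\<^sup>+ x. ennreal \<bar>F l t x\<bar> \<partial>M) \<le> ennreal ((2 * pi * K) ^ l)"
proof -
  have "(\<integral>\<^sup>+ x. ennreal \<bar>F l t x\<bar> \<partial>M) \<le> ennreal (sqrt (ip (dv l t) (dv l t)))"
    unfolding F_def by (rule expectation_abs_G)
  also have "\<dots> \<le> ennreal (sqrt (((2 * pi * K) ^ l)\<^sup>2))"
    by (intro ennreal_leI real_sqrt_le_mono ip_dv)
  also have "\<dots> = ennreal ((2 * pi * K) ^ l)"
    using K_ge_1 by simp
  finally show ?thesis .
qed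

lemma prob_F_small: "0 \<le> \<delta> \<Longrightarrow> prob {x \<in> space M. \<bar>F 0 t x\<bar> \<le> \<delta>} \<le> \<delta>"
  unfolding F_def by (rule prob_G_small[OF ip_dv_0])

text \<open>The strict inequality ignores zeros at grid points; these have probability zero.\<close>

definition crossing :: "real \<Rightarrow> nat \<Rightarrow> 'a \<Rightarrow> bool" where
  "crossing h i \<omega> \<longleftrightarrow> F 0 (real i * h) \<omega> * F 0 (real (Suc i) * h) \<omega> < 0"

lemma crossing_measurable [measurable]: "Measurable.pred M (crossing h i)"
  unfolding crossing_def[abs_def] by measurable

definition crossings :: "real \<Rightarrow> nat set \<Rightarrow> 'a \<Rightarrow> nat" where
  "crossings h A \<omega> = card {i \<in> A. crossing h i \<omega>}"

lemma real_crossings: "finite A \<Longrightarrow> real (crossings h A \<omega>) = (\<Sum>i\<in>A. of_bool (crossing h i \<omega>))"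
  by (simp add: crossings_def Int_def)

lemma crossings_measurable [measurable]:
  assumes "finite A"
  shows "(\<lambda>\<omega>. real (crossings h A \<omega>)) \<in> borel_measurable M"
  unfolding real_crossings[OF assms] by measurable

lemma crossings_le: "finite A \<Longrightarrow> crossings h A \<omega> \<le> card A"
  unfolding crossings_def by (intro card_mono) auto

text \<open>
  If \<open>F 0\<close> has \<open>n + 1\<close> zeros in a short interval then all derivatives up to order \<open>n\<close> vanish somewhere
  in it, so that \<open>F 0\<close> is tiny at its left endpoint unless the derivative of order \<open>n + 1\<close> is huge.
\<close>

lemma prob_many_crossings:
  assumes h: "0 < h" and A: "A \<subseteq> {i0..<i0 + q}" and short: "8 * pi * K * (real q * h) \<le> 1"
  shows "prob {\<omega> \<in> space M. Suc n \<le> crossings h A \<omega>} \<le> (1 / 2) ^ n"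
proof -
  let ?a = "real i0 * h" and ?d = "real q * h"
  have fin: "finite A" using A finite_subset by blast
  define W where "W \<omega> = (\<integral>\<^sup>+ u. ennreal \<bar>F (Suc n) u \<omega>\<bar> * indicator {?a..?a + ?d} u \<partial>lborel)" for \<omega>
  have pm: "(\<lambda>(\<omega>, u). ennreal \<bar>F (Suc n) u \<omega>\<bar> * indicator {?a..?a + ?d} u) \<in> borel_measurable (M \<Otimes>\<^sub>M lborel)"
    using F_measurable_pair[of "Suc n"] by (simp add: case_prod_beta')
  have [measurable]: "W \<in> borel_measurable M"
    unfolding W_def[abs_def] using pm by (rule lborel.borel_measurable_nn_integral)
  have d_nn: "0 \<le> ?d" using h by simp
  have EW: "(\<integral>\<^sup>+ \<omega>. W \<omega> \<partial>M) \<le> ennreal ((2 * pi * K) ^ Suc n * ?d)"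
  proof -
    interpret pair_sigma_finite M lborel ..
    have "(\<integral>\<^sup>+ \<omega>. W \<omega> \<partial>M) = (\<integral>\<^sup>+ u. (\<integral>\<^sup>+ \<omega>. ennreal \<bar>F (Suc n) u \<omega>\<bar> * indicator {?a..?a + ?d} u \<partial>M) \<partial>lborel)"
      unfolding W_def by (rule Fubini'[OF pm, symmetric])
    also have "\<dots> \<le> (\<integral>\<^sup>+ u. ennreal ((2 * pi * K) ^ Suc n) * indicator {?a..?a + ?d} u \<partial>lborel)"
    proof (rule nn_integral_mono)
      fix u
      have "(\<integral>\<^sup>+ \<omega>. ennreal \<bar>F (Suc n) u \<omega>\<bar> * indicator {?a..?a + ?d} u \<partial>M)
        = (\<integral>\<^sup>+ \<omega>. ennreal \<bar>F (Suc n) u \<omega>\<bar> \<partial>M) * indicator {?a..?a + ?d} u"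
        by (subst nn_integral_multc) auto
      also have "\<dots> \<le> ennreal ((2 * pi * K) ^ Suc n) * indicator {?a..?a + ?d} u"
        by (intro mult_right_mono expectation_abs_F) auto
      finally show "(\<integral>\<^sup>+ \<omega>. ennreal \<bar>F (Suc n) u \<omega>\<bar> * indicator {?a..?a + ?d} u \<partial>M)
        \<le> ennreal ((2 * pi * K) ^ Suc n) * indicator {?a..?a + ?d} u" .
    qed
    also have "\<dots> = ennreal ((2 * pi * K) ^ Suc n) * ennreal ?d"
      using d_nn by (subst nn_integral_cmult_indicator) auto
    also have "\<dots> = ennreal ((2 * pi * K) ^ Suc n * ?d)"
      using d_nn K_ge_1 by (subst ennreal_mult) auto
    finally show ?thesis .
  qed
  \<comment> \<open>The threshold for the left endpoint is 2^-(n+1): the value is smaller with at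
    most that probability, and otherwise the integral \<open>W\<close> of the derivative of order n
    + 1 must be large, to which Markov's inequality applies.\<close>
  let ?C = "2 ^ Suc n * ?d ^ n"
  have sub: "{\<omega> \<in> space M. Suc n \<le> crossings h A \<omega>}
     \<subseteq> {\<omega> \<in> space M. \<bar>F 0 ?a \<omega>\<bar> \<le> (1 / 2) ^ Suc n} \<union> {\<omega> \<in> space M. 1 \<le> ennreal ?C * W \<omega>}"
  proof
    fix \<omega> assume \<omega>: "\<omega> \<in> {\<omega> \<in> space M. Suc n \<le> crossings h A \<omega>}"
    let ?Cr = "{i \<in> A. crossing h i \<omega>}"
    have cr: "F 0 (real i * h) \<omega> * F 0 (real (Suc i) * h) \<omega> < 0" if "i \<in> ?Cr" for i
      using that by (simp add: crossing_def)
    obtain \<zeta> where \<zeta>: "inj_on \<zeta> ?Cr"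
      "\<And>i. i \<in> ?Cr \<Longrightarrow> real i * h < \<zeta> i \<and> \<zeta> i < real (Suc i) * h \<and> F 0 (\<zeta> i) \<omega> = 0"
      using sign_changes_give_zeros[of "\<lambda>t. F 0 t \<omega>", OF F_isCont h cr] by blast
    have card: "Suc n \<le> card (\<zeta> ` ?Cr)"
      using \<omega> by (simp add: card_image[OF \<zeta>(1)] crossings_def)
    then obtain Z where Z: "Z \<subseteq> \<zeta> ` ?Cr" "card Z = Suc n"
      by (meson obtain_subset_with_card_n)
    have finZ: "finite Z" using Z(2) by (intro card_ge_0_finite) simp
    have "Z \<subseteq> {?a..?a + ?d}"
    proof
      fix z assume "z \<in> Z"
      then obtain i where i: "i \<in> ?Cr" "z = \<zeta> i" using Z(1) by blast
      then have "real i0 * h \<le> real i * h" "real (Suc i) * h \<le> real (i0 + q) * h"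
        using A h by (auto intro!: mult_right_mono simp del: of_nat_Suc of_nat_add)
      then show "z \<in> {?a..?a + ?d}"
        using \<zeta>(2)[OF i(1)] i(2) unfolding atLeastAtMost_iff of_nat_add distrib_right by linarith
    qed
    moreover have "F 0 z \<omega> = 0" if "z \<in> Z" for z
      using that Z(1) \<zeta>(2) by auto
    ultimately have "ennreal \<bar>F 0 ?a \<omega>\<bar> \<le> ennreal ((?a + ?d - ?a) ^ n) * W \<omega>"
      unfolding W_def
      by (intro abs_le_of_many_zeros[where F = "\<lambda>l t. F l t \<omega>", OF F_deriv finZ Z(2)]) (use d_nn in auto)
    then have le: "ennreal \<bar>F 0 ?a \<omega>\<bar> \<le> ennreal (?d ^ n) * W \<omega>" by simp
    show "\<omega> \<in> {\<omega> \<in> space M. \<bar>F 0 ?a \<omega>\<bar> \<le> (1 / 2) ^ Suc n} \<union> {\<omega> \<in> space M. 1 \<le> ennreal ?C * W \<omega>}"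
    proof (cases "\<bar>F 0 ?a \<omega>\<bar> \<le> (1 / 2) ^ Suc n")
      case False
      have "1 = ennreal (2 ^ Suc n * (1 / 2) ^ Suc n)" by (simp add: power_one_over)
      also have "\<dots> \<le> ennreal (2 ^ Suc n * \<bar>F 0 ?a \<omega>\<bar>)"
        using False by (intro ennreal_leI mult_left_mono) auto
      also have "\<dots> = ennreal (2 ^ Suc n) * ennreal \<bar>F 0 ?a \<omega>\<bar>" by (rule ennreal_mult) auto
      also have "\<dots> \<le> ennreal (2 ^ Suc n) * (ennreal (?d ^ n) * W \<omega>)" by (intro mult_left_mono le) auto
      also have "\<dots> = ennreal ?C * W \<omega>"
        using d_nn by (subst ennreal_mult) (auto simp: mult.assoc)
      finally show ?thesis using \<omega> by auto
    qed (use \<omega> in auto)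
  qed
  have markov: "emeasure M {\<omega> \<in> space M. 1 \<le> ennreal ?C * W \<omega>} \<le> ennreal ((1 / 2) ^ Suc n)"
  proof -
    have "emeasure M {\<omega> \<in> space M. 1 \<le> ennreal ?C * W \<omega>} \<le> ennreal ?C * (\<integral>\<^sup>+ \<omega>. W \<omega> * indicator (space M) \<omega> \<partial>M)"
      by (rule nn_integral_Markov_inequality) auto
    also have "(\<integral>\<^sup>+ \<omega>. W \<omega> * indicator (space M) \<omega> \<partial>M) = (\<integral>\<^sup>+ \<omega>. W \<omega> \<partial>M)"
      by (intro nn_integral_cong) auto
    also have "ennreal ?C * \<dots> \<le> ennreal ?C * ennreal ((2 * pi * K) ^ Suc n * ?d)"
      by (intro mult_left_mono EW) auto
    also have "\<dots> = ennreal (?C * ((2 * pi * K) ^ Suc n * ?d))"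
      using d_nn K_ge_1 by (intro ennreal_mult[symmetric]) auto
    \<comment> \<open>The powers of 2, of the length d and of 2 pi K combine into (4 pi K d)^(n+1),
      and \<open>short\<close> makes the base at most 1/2.\<close>
    also have "?C * ((2 * pi * K) ^ Suc n * ?d) = (4 * pi * K * ?d) ^ Suc n"
      by (simp add: power_mult_distrib mult_ac) (simp add: power_mult_distrib[symmetric])
    also have "ennreal \<dots> \<le> ennreal ((1 / 2) ^ Suc n)"
      using d_nn K_ge_1 short by (intro ennreal_leI power_mono) auto
    finally show ?thesis .
  qed
  have "prob {\<omega> \<in> space M. Suc n \<le> crossings h A \<omega>}
    \<le> prob {\<omega> \<in> space M. \<bar>F 0 ?a \<omega>\<bar> \<le> (1 / 2) ^ Suc n} + prob {\<omega> \<in> space M. 1 \<le> ennreal ?C * W \<omega>}"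
    by (rule order_trans[OF finite_measure_mono[OF sub] measure_Un_le]) auto
  also have "\<dots> \<le> (1 / 2) ^ Suc n + (1 / 2) ^ Suc n"
    using prob_F_small[of "(1 / 2) ^ Suc n" ?a] markov
    by (intro add_mono) (auto simp: emeasure_eq_measure)
  finally show ?thesis by simp
qed

text \<open>The square of the count is the sum of 2 n + 1 over the levels n below it, and the
  geometric tail bounds the mean by the sum of (2 n + 1) / 2^n, which is 6. The bound does not see
  how fine the grid inside the interval is.\<close>

lemma crossings_second_moment:
  assumes h: "0 < h" and A: "A \<subseteq> {i0..<i0 + q}" and short: "8 * pi * K * (real q * h) \<le> 1"
  shows "(\<integral>\<omega>. (real (crossings h A \<omega>))\<^sup>2 \<partial>M) \<le> 6"
proof -
  have fin: "finite A" using A finite_subset by blast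
  have "card A \<le> card {i0..<i0 + q}" using A by (intro card_mono) auto
  then have cA: "crossings h A \<omega> \<le> q" for \<omega> using crossings_le[OF fin, of h \<omega>] by simp
  have sq: "(real m)\<^sup>2 = (\<Sum>n<q. (2 * real n + 1) * of_bool (Suc n \<le> m))" if "m \<le> q" for m q
    using that
  proof (induction q arbitrary: m)
    case (Suc q)
    show ?case
    proof (cases "m \<le> q")
      case True
      then show ?thesis using Suc.IH by simp
    next
      case False
      then have m: "m = Suc q" using Suc.prems by simp
      have "(\<Sum>n<q. (2 * real n + 1) * of_bool (Suc n \<le> m)) = (\<Sum>n<q. (2 * real n + 1) * of_bool (Suc n \<le> q))"
        by (intro sum.cong) (auto simp: m)
      then show ?thesis using Suc.IH[of q] by (simp add: m power2_eq_square algebra_simps)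
    qed
  qed simp
  have meas: "{\<omega> \<in> space M. Suc n \<le> crossings h A \<omega>} \<in> sets M" for n
  proof -
    have "{\<omega> \<in> space M. Suc n \<le> crossings h A \<omega>} = {\<omega> \<in> space M. real (Suc n) \<le> real (crossings h A \<omega>)}"
      by (simp only: of_nat_le_iff)
    also have "\<dots> \<in> sets M" using crossings_measurable[OF fin] by measurable
    finally show ?thesis .
  qed
  have "(\<integral>\<omega>. (real (crossings h A \<omega>))\<^sup>2 \<partial>M)
      = (\<integral>\<omega>. (\<Sum>n<q. (2 * real n + 1) * indicator {\<omega> \<in> space M. Suc n \<le> crossings h A \<omega>} \<omega>) \<partial>M)"
    by (intro Bochner_Integration.integral_cong refl) (auto simp: sq[OF cA] indicator_def intro!: sum.cong)
  also have "\<dots> = (\<Sum>n<q. (2 * real n + 1) * prob {\<omega> \<in> space M. Suc n \<le> crossings h A \<omega>})"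
    using meas by (subst Bochner_Integration.integral_sum) (auto simp: emeasure_eq_measure)
  also have "\<dots> \<le> (\<Sum>n<q. (2 * real n + 1) * (1 / 2) ^ n)"
    by (intro sum_mono mult_left_mono prob_many_crossings[OF h A short]) auto
  also have "\<dots> = 6 - (4 * real q + 6) * (1 / 2) ^ q"
    by (induction q) (auto simp: algebra_simps)
  also have "\<dots> \<le> 6" by simp
  finally show ?thesis .
qed

end

section \<open>Correlation of sign changes\<close>

lemma cis_mult_cnj: "cis a * cnj (cis b) = cis (a - b)"
  by (simp add: cis_cnj cis_mult)

context gaussian_trig
begin

text \<open>
  For a cell of length \<open>h\<close> and midpoint \<open>t\<close>, the linear forms given by \<open>xv h t\<close> and \<open>yv h t\<close> are the
  normalised sum and difference of the values of \<open>F 0\<close> at the two ends of the cell.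
\<close>

definition \<sigma>x :: "real \<Rightarrow> real" where
  "\<sigma>x h = sqrt (\<Sum>j\<in>J. (c * cos (pi * of_int (k j) * h))\<^sup>2)"

definition \<sigma>y :: "real \<Rightarrow> real" where
  "\<sigma>y h = sqrt (\<Sum>j\<in>J. (c * sin (pi * of_int (k j) * h))\<^sup>2)"

text \<open>Passing from the midpoint t to the ends of the cell multiplies the character at t by cos
  (pi k h) minus or plus i sin (pi k h): the cosines weight the mean of the two end values, the
  sines half their difference.\<close>

definition ax :: "real \<Rightarrow> 'j \<Rightarrow> real" where
  "ax h j = c * cos (pi * of_int (k j) * h) / \<sigma>x h"

definition ay :: "real \<Rightarrow> 'j \<Rightarrow> real" where
  "ay h j = c * sin (pi * of_int (k j) * h) / \<sigma>y h"

definition xv :: "real \<Rightarrow> real \<Rightarrow> 'j \<Rightarrow> complex" where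
  "xv h t j = of_real (ax h j) * cis (2 * pi * of_int (k j) * t)"

definition yv :: "real \<Rightarrow> real \<Rightarrow> 'j \<Rightarrow> complex" where
  "yv h t j = of_real (ay h j) * (\<i> * cis (2 * pi * of_int (k j) * t))"

definition corr :: "('j \<Rightarrow> real) \<Rightarrow> real \<Rightarrow> complex" where
  "corr w u = (\<Sum>j\<in>J. of_real (w j) * cis (2 * pi * of_int (k j) * u))"

text \<open>A majorant for the sum of the squared entries of the 2 x 2 cross correlation matrix of
  two cells at distance u; the two mixed entries share one correlation, hence the factor 2. Moduli
  replace real and imaginary parts because their squares can be summed exactly over the
  grid.\<close>

definition \<rho>2 :: "real \<Rightarrow> real \<Rightarrow> real" where
  "\<rho>2 h u = (cmod (corr (\<lambda>j. (ax h j)\<^sup>2) u))\<^sup>2 + 2 * (cmod (corr (\<lambda>j. ax h j * ay h j) u))\<^sup>2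
     + (cmod (corr (\<lambda>j. (ay h j)\<^sup>2) u))\<^sup>2"

lemma \<rho>2_nonneg: "0 \<le> \<rho>2 h u"
  by (simp add: \<rho>2_def)

lemma angle_le:
  assumes "0 < h" "4 * K * h \<le> 1" "j \<in> J"
  shows "\<bar>pi * of_int (k j) * h\<bar> \<le> pi / 4"
proof -
  have "\<bar>real_of_int (k j)\<bar> * h \<le> K * h" using k_le assms by (intro mult_right_mono) auto
  also have "K * h \<le> 1 / 4" using assms(2) by (simp add: mult.assoc)
  finally have "pi * (\<bar>real_of_int (k j)\<bar> * h) \<le> pi * (1 / 4)" by (intro mult_left_mono) auto
  then show ?thesis using assms by (simp add: abs_mult mult.assoc)
qed

lemma \<sigma>x_bounds:
  assumes "0 < h" "4 * K * h \<le> 1"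
  shows "1 / 2 \<le> (\<sigma>x h)\<^sup>2" "0 < \<sigma>x h"
proof -
  have "(\<Sum>j\<in>J. c\<^sup>2 * (1 / 2)) \<le> (\<Sum>j\<in>J. (c * cos (pi * of_int (k j) * h))\<^sup>2)"
    unfolding power_mult_distrib
    using cos_squared_lower[OF angle_le[OF assms]] by (intro sum_mono mult_left_mono) auto
  moreover have "(\<Sum>j\<in>J. c\<^sup>2 * (1 / 2)) = 1 / 2" using card_J_pos by (simp add: c_sq)
  ultimately have *: "1 / 2 \<le> (\<Sum>j\<in>J. (c * cos (pi * of_int (k j) * h))\<^sup>2)" by simp
  then show "0 < \<sigma>x h" unfolding \<sigma>x_def by simp
  show "1 / 2 \<le> (\<sigma>x h)\<^sup>2" unfolding \<sigma>x_def using * by (simp add: sum_nonneg)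
qed

text \<open>The upper bound is |sin x| \<le> |x|. In the lower bound 1/6 is 1/2 from the sine
  estimate times 1/3 from \<open>second_moment\<close>; it prevents the normalised weights
  \<open>ay\<close> from concentrating on few frequencies.\<close>

lemma \<sigma>y_bounds:
  assumes "0 < h" "4 * K * h \<le> 1"
  shows "(pi * K * h)\<^sup>2 / 6 \<le> (\<sigma>y h)\<^sup>2" "0 < \<sigma>y h" "(\<sigma>y h)\<^sup>2 \<le> (pi * K * h)\<^sup>2"
proof -
  let ?S = "\<Sum>j\<in>J. (c * sin (pi * of_int (k j) * h))\<^sup>2"
  have sq: "(\<sigma>y h)\<^sup>2 = ?S" unfolding \<sigma>y_def by (simp add: sum_nonneg)
  have "c\<^sup>2 * (pi * h)\<^sup>2 / 2 * (\<Sum>j\<in>J. (real_of_int (k j))\<^sup>2) = (\<Sum>j\<in>J. c\<^sup>2 * ((pi * of_int (k j) * h)\<^sup>2 / 2))"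
    by (simp add: sum_distrib_left power_mult_distrib mult_ac)
  also have "\<dots> \<le> ?S"
    unfolding power_mult_distrib[of c]
    using sin_squared_lower[OF angle_le[OF assms]] by (intro sum_mono mult_left_mono) auto
  finally have "c\<^sup>2 * (pi * h)\<^sup>2 / 2 * (\<Sum>j\<in>J. (real_of_int (k j))\<^sup>2) \<le> ?S" .
  then have "c\<^sup>2 * (pi * h)\<^sup>2 / 2 * (K\<^sup>2 * real (card J) / 3) \<le> ?S"
  proof (rule order_trans[rotated])
    show "c\<^sup>2 * (pi * h)\<^sup>2 / 2 * (K\<^sup>2 * real (card J) / 3) \<le> c\<^sup>2 * (pi * h)\<^sup>2 / 2 * (\<Sum>j\<in>J. (real_of_int (k j))\<^sup>2)"
      using second_moment by (intro mult_left_mono) auto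
  qed
  moreover have "c\<^sup>2 * (pi * h)\<^sup>2 / 2 * (K\<^sup>2 * real (card J) / 3) = (pi * K * h)\<^sup>2 / 6"
    using card_J_pos by (simp add: c_sq power_mult_distrib)
  ultimately show *: "(pi * K * h)\<^sup>2 / 6 \<le> (\<sigma>y h)\<^sup>2" unfolding sq by (simp only:)
  have "0 < (pi * K * h)\<^sup>2 / 6" using assms K_ge_1 by simp
  then have "0 < (\<sigma>y h)\<^sup>2" using * by (rule less_le_trans)
  moreover have "0 \<le> \<sigma>y h" unfolding \<sigma>y_def by (simp add: sum_nonneg)
  ultimately show "0 < \<sigma>y h" by (metis less_eq_real_def power2_less_imp_less zero_power2 order_less_irrefl)
  have "?S \<le> (\<Sum>j\<in>J. c\<^sup>2 * (pi * K * h)\<^sup>2)"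
    unfolding power_mult_distrib[of c]
  proof (intro sum_mono mult_left_mono)
    fix j assume j: "j \<in> J"
    have "\<bar>sin (pi * of_int (k j) * h)\<bar> \<le> \<bar>pi * of_int (k j) * h\<bar>" by (rule abs_sin_x_le_abs_x)
    also have "\<dots> = pi * \<bar>real_of_int (k j)\<bar> * h" using assms by (simp add: abs_mult)
    also have "\<dots> \<le> pi * K * h" using k_le[OF j] assms by (intro mult_right_mono mult_left_mono) auto
    finally have "\<bar>sin (pi * of_int (k j) * h)\<bar>\<^sup>2 \<le> (pi * K * h)\<^sup>2" by (intro power_mono) auto
    then show "(sin (pi * of_int (k j) * h))\<^sup>2 \<le> (pi * K * h)\<^sup>2" by simp
  qed auto
  also have "\<dots> = (pi * K * h)\<^sup>2" using card_J_pos by (simp add: c_sq)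
  finally show "(\<sigma>y h)\<^sup>2 \<le> (pi * K * h)\<^sup>2" unfolding sq .
qed

text \<open>After normalisation every frequency has weight O(1 / card J), uniformly in h. This
  flatness is what turns orthogonality into a bound by \<open>\<kappa>\<close> / card J. The
  numerators obtained are 2, 6 and their mean 4, all rounded up to 8.\<close>

lemma weights:
  assumes h: "0 < h" "4 * K * h \<le> 1" and j: "j \<in> J"
  shows "(ax h j)\<^sup>2 \<le> 8 / card J" "(ay h j)\<^sup>2 \<le> 8 / card J" "\<bar>ax h j * ay h j\<bar> \<le> 8 / card J"
proof -
  have J: "0 < real (card J)" using card_J_pos by simp
  have "(ax h j)\<^sup>2 = c\<^sup>2 * (cos (pi * of_int (k j) * h))\<^sup>2 / (\<sigma>x h)\<^sup>2"
    by (simp add: ax_def power_divide power_mult_distrib)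
  also have "\<dots> \<le> (c\<^sup>2 * 1) / (1 / 2)"
    using \<sigma>x_bounds[OF h] by (intro frac_le mult_left_mono) (auto simp: abs_square_le_1)
  finally have x: "(ax h j)\<^sup>2 \<le> 2 / card J" by (simp add: c_sq)
  have pos: "0 < (pi * K * h)\<^sup>2" using h K_ge_1 by simp
  have "\<bar>sin (pi * of_int (k j) * h)\<bar> \<le> \<bar>pi * of_int (k j) * h\<bar>" by (rule abs_sin_x_le_abs_x)
  also have "\<dots> = pi * \<bar>real_of_int (k j)\<bar> * h" using h by (simp add: abs_mult)
  also have "\<dots> \<le> pi * K * h" using k_le[OF j] h by (intro mult_right_mono mult_left_mono) auto
  finally have s: "\<bar>sin (pi * of_int (k j) * h)\<bar>\<^sup>2 \<le> (pi * K * h)\<^sup>2" by (intro power_mono) auto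
  have "(ay h j)\<^sup>2 = c\<^sup>2 * \<bar>sin (pi * of_int (k j) * h)\<bar>\<^sup>2 / (\<sigma>y h)\<^sup>2"
    by (simp add: ay_def power_divide power_mult_distrib)
  also have "\<dots> \<le> (c\<^sup>2 * (pi * K * h)\<^sup>2) / ((pi * K * h)\<^sup>2 / 6)"
    using \<sigma>y_bounds[OF h] s pos by (intro frac_le mult_left_mono) auto
  also have "\<dots> = 6 / card J"
  proof -
    have "c\<^sup>2 * X / (X / 6) = 6 / card J" if "0 < X" for X :: real using that by (simp add: c_sq)
    then show ?thesis using pos .
  qed
  finally have y: "(ay h j)\<^sup>2 \<le> 6 / card J" .
  have le8: "2 / real (card J) \<le> 8 / real (card J)" "6 / real (card J) \<le> 8 / real (card J)"
    using J by (auto intro!: divide_right_mono)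
  show "(ax h j)\<^sup>2 \<le> 8 / card J" "(ay h j)\<^sup>2 \<le> 8 / card J" using x y le8 by linarith+
  have "2 * \<bar>ax h j * ay h j\<bar> \<le> (ax h j)\<^sup>2 + (ay h j)\<^sup>2"
    using zero_le_power2[of "\<bar>ax h j\<bar> - \<bar>ay h j\<bar>"] by (simp add: power2_eq_square abs_mult algebra_simps)
  also have "\<dots> \<le> 8 / card J" using x y by (simp add: add_divide_distrib[symmetric])
  finally show "\<bar>ax h j * ay h j\<bar> \<le> 8 / card J" by linarith
qed

lemma ip_xv_xv: "ip (xv h t) (xv h t') = Re (corr (\<lambda>j. (ax h j)\<^sup>2) (t - t'))"
  unfolding ip_def corr_def Re_sum
proof (intro sum.cong refl)
  fix j
  have "xv h t j * cnj (xv h t' j) = of_real ((ax h j)\<^sup>2) * (cis (2 * pi * of_int (k j) * t) * cnj (cis (2 * pi * of_int (k j) * t')))"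
    by (simp add: xv_def power2_eq_square)
  then show "Re (xv h t j * cnj (xv h t' j)) = Re (of_real ((ax h j)\<^sup>2) * cis (2 * pi * of_int (k j) * (t - t')))"
    by (simp only: cis_mult_cnj right_diff_distrib)
qed

lemma ip_yv_yv: "ip (yv h t) (yv h t') = Re (corr (\<lambda>j. (ay h j)\<^sup>2) (t - t'))"
  unfolding ip_def corr_def Re_sum
proof (intro sum.cong refl)
  fix j
  have "yv h t j * cnj (yv h t' j) = of_real ((ay h j)\<^sup>2) * (cis (2 * pi * of_int (k j) * t) * cnj (cis (2 * pi * of_int (k j) * t')))"
    unfolding yv_def by (simp add: complex_eq_iff power2_eq_square algebra_simps)
  then show "Re (yv h t j * cnj (yv h t' j)) = Re (of_real ((ay h j)\<^sup>2) * cis (2 * pi * of_int (k j) * (t - t')))"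
    by (simp only: cis_mult_cnj right_diff_distrib)
qed

lemma ip_xv_yv: "ip (xv h t) (yv h t') = Im (corr (\<lambda>j. ax h j * ay h j) (t - t'))"
  unfolding ip_def corr_def Im_sum
proof (intro sum.cong refl)
  fix j
  have "xv h t j * cnj (yv h t' j) = - \<i> * (of_real (ax h j * ay h j) * (cis (2 * pi * of_int (k j) * t) * cnj (cis (2 * pi * of_int (k j) * t'))))"
    unfolding xv_def yv_def by (simp add: complex_eq_iff algebra_simps)
  then have "xv h t j * cnj (yv h t' j) = - \<i> * (of_real (ax h j * ay h j) * cis (2 * pi * of_int (k j) * (t - t')))"
    by (simp only: cis_mult_cnj right_diff_distrib)
  then show "Re (xv h t j * cnj (yv h t' j)) = Im (of_real (ax h j * ay h j) * cis (2 * pi * of_int (k j) * (t - t')))"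
    by simp
qed

lemma cmod_corr_minus: "cmod (corr w (- u)) = cmod (corr w u)"
proof -
  have "corr w (- u) = cnj (corr w u)"
    by (simp add: corr_def cnj_sum cis_cnj)
  then show ?thesis by simp
qed

lemma unit_vectors:
  assumes h: "0 < h" "4 * K * h \<le> 1"
  shows "ip (xv h t) (xv h t) = 1" "ip (yv h t) (yv h t) = 1" "ip (xv h t) (yv h t) = 0"
proof -
  have "ip (xv h t) (xv h t) = (\<Sum>j\<in>J. (c * cos (pi * of_int (k j) * h))\<^sup>2) / (\<sigma>x h)\<^sup>2"
    unfolding ip_xv_xv corr_def by (simp add: ax_def power_divide sum_divide_distrib)
  also have "\<dots> = 1" using \<sigma>x_bounds(2)[OF h] unfolding \<sigma>x_def by (simp add: sum_nonneg)
  finally show "ip (xv h t) (xv h t) = 1" .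
  have "ip (yv h t) (yv h t) = (\<Sum>j\<in>J. (c * sin (pi * of_int (k j) * h))\<^sup>2) / (\<sigma>y h)\<^sup>2"
    unfolding ip_yv_yv corr_def by (simp add: ay_def power_divide sum_divide_distrib)
  also have "\<dots> = 1" using \<sigma>y_bounds(2)[OF h] unfolding \<sigma>y_def by (simp add: sum_nonneg)
  finally show "ip (yv h t) (yv h t) = 1" .
  \<comment> \<open>At distance 0 the correlation of real weights is real, so its imaginary part
    vanishes.\<close>
  show "ip (xv h t) (yv h t) = 0" unfolding ip_xv_yv corr_def by simp
qed

lemma cross_ip_bound:
  "(ip (xv h t) (xv h t'))\<^sup>2 + (ip (yv h t) (xv h t'))\<^sup>2 + (ip (xv h t) (yv h t'))\<^sup>2 + (ip (yv h t) (yv h t'))\<^sup>2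
     \<le> \<rho>2 h (t - t')"
proof -
  have sq: "(Re z)\<^sup>2 \<le> (cmod z)\<^sup>2" "(Im z)\<^sup>2 \<le> (cmod z)\<^sup>2" for z :: complex
    by (simp_all add: cmod_power2)
  have "(ip (yv h t) (xv h t'))\<^sup>2 \<le> (cmod (corr (\<lambda>j. ax h j * ay h j) (t' - t)))\<^sup>2"
    unfolding ip_commute[of "yv h t"] ip_xv_yv by (rule sq)
  also have "\<dots> = (cmod (corr (\<lambda>j. ax h j * ay h j) (t - t')))\<^sup>2"
    using cmod_corr_minus[of _ "t - t'"] by simp
  finally show ?thesis
    using sq(1)[of "corr (\<lambda>j. (ax h j)\<^sup>2) (t - t')"] sq(2)[of "corr (\<lambda>j. ax h j * ay h j) (t - t')"]
      sq(1)[of "corr (\<lambda>j. (ay h j)\<^sup>2) (t - t')"]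
    unfolding \<rho>2_def ip_xv_xv ip_xv_yv ip_yv_yv by linarith
qed

lemma F_cell_ends:
  assumes h: "0 < h" "4 * K * h \<le> 1"
  shows "F 0 t \<omega> = \<sigma>x h * G (xv h (t + h / 2)) \<omega> - \<sigma>y h * G (yv h (t + h / 2)) \<omega>"
    "F 0 (t + h) \<omega> = \<sigma>x h * G (xv h (t + h / 2)) \<omega> + \<sigma>y h * G (yv h (t + h / 2)) \<omega>"
proof -
  note s = \<sigma>x_bounds(2)[OF h] \<sigma>y_bounds(2)[OF h]
  have cis_split: "cis (a - d) = of_real (cos d) * cis a - of_real (sin d) * (\<i> * cis a)"
    "cis (a + d) = of_real (cos d) * cis a + of_real (sin d) * (\<i> * cis a)" for a d
    by (auto simp: complex_eq_iff cos_diff sin_diff cos_add sin_add algebra_simps)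
  have 1: "2 * pi * of_int (k j) * t = 2 * pi * of_int (k j) * (t + h / 2) - pi * of_int (k j) * h"
    "2 * pi * of_int (k j) * (t + h) = 2 * pi * of_int (k j) * (t + h / 2) + pi * of_int (k j) * h" for j
    by (simp_all add: algebra_simps)
  have "dv 0 t = (\<lambda>j. of_real (\<sigma>x h) * xv h (t + h / 2) j - of_real (\<sigma>y h) * yv h (t + h / 2) j)"
    using s unfolding dv_def xv_def yv_def ax_def ay_def 1(1) cis_split(1)
    by (intro ext) (simp add: right_diff_distrib)
  then show "F 0 t \<omega> = \<sigma>x h * G (xv h (t + h / 2)) \<omega> - \<sigma>y h * G (yv h (t + h / 2)) \<omega>"
    unfolding F_def by (simp only: G_diff G_scale)
  have "dv 0 (t + h) = (\<lambda>j. of_real (\<sigma>x h) * xv h (t + h / 2) j + of_real (\<sigma>y h) * yv h (t + h / 2) j)"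
    using s unfolding dv_def xv_def yv_def ax_def ay_def 1(2) cis_split(2)
    by (intro ext) (simp add: distrib_left)
  then show "F 0 (t + h) \<omega> = \<sigma>x h * G (xv h (t + h / 2)) \<omega> + \<sigma>y h * G (yv h (t + h / 2)) \<omega>"
    unfolding F_def by (simp only: G_add G_scale)
qed

text \<open>With mean a and half difference d the end values are a - d and a + d, and their product
  a^2 - d^2 is negative exactly when |a| < |d|. The aperture
  \<open>\<sigma>y h / \<sigma>x h\<close> is of order K h.\<close>

lemma crossing_iff_cone:
  assumes h: "0 < h" "4 * K * h \<le> 1"
  shows "crossing h i \<omega> \<longleftrightarrow> \<bar>G (xv h (real i * h + h / 2)) \<omega>\<bar> < (\<sigma>y h / \<sigma>x h) * \<bar>G (yv h (real i * h + h / 2)) \<omega>\<bar>"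
proof -
  note s = \<sigma>x_bounds(2)[OF h] \<sigma>y_bounds(2)[OF h]
  have Suc: "real (Suc i) * h = real i * h + h" by (simp add: distrib_right)
  have "(a - d) * (a + d) < 0 \<longleftrightarrow> \<bar>a\<bar> < \<bar>d\<bar>" for a d :: real
  proof -
    have "(a - d) * (a + d) = a\<^sup>2 - d\<^sup>2" by (simp add: power2_eq_square algebra_simps)
    then show ?thesis by (metis abs_le_square_iff diff_less_0_iff_less linorder_not_le)
  qed
  then have "crossing h i \<omega> \<longleftrightarrow> \<bar>\<sigma>x h * G (xv h (real i * h + h / 2)) \<omega>\<bar> < \<bar>\<sigma>y h * G (yv h (real i * h + h / 2)) \<omega>\<bar>"
    unfolding crossing_def Suc F_cell_ends(2)[OF h, of "real i * h"] F_cell_ends(1)[OF h, of "real i * h"] .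
  then show ?thesis using s by (simp add: abs_mult field_simps)
qed

text \<open>The threshold 1/64 is the square of the bound 1/8 on \<rho> in the cone estimate. The
  squared aperture is at most 2 pi^2 (K h)^2 \<le> 20 (K h)^2, and \<open>5 * K * h \<le> 1\<close>
  makes it less than 1; the constant rounds up 26112 * 20.\<close>

lemma crossing_covariance:
  assumes h: "0 < h" "5 * K * h \<le> 1"
    and \<rho>: "\<rho>2 h (real i * h - real i' * h) \<le> 1 / 64"
  shows "prob {\<omega> \<in> space M. crossing h i \<omega> \<and> crossing h i' \<omega>}
     - prob {\<omega> \<in> space M. crossing h i \<omega>} * prob {\<omega> \<in> space M. crossing h i' \<omega>}
     \<le> 600000 * (K * h)\<^sup>2 * \<rho>2 h (real i * h - real i' * h)"
proof -
  have h': "4 * K * h \<le> 1" using h K_ge_1 mult_right_mono[of "4 * K" "5 * K" h] by linarith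
  let ?t = "real i * h + h / 2" and ?t' = "real i' * h + h / 2"
  let ?R = "\<rho>2 h (real i * h - real i' * h)"
  let ?\<theta> = "\<sigma>y h / \<sigma>x h"
  have \<theta>_sq: "?\<theta>\<^sup>2 \<le> 20 * (K * h)\<^sup>2"
  proof -
    have "?\<theta>\<^sup>2 \<le> (pi * K * h)\<^sup>2 / (1 / 2)"
      unfolding power_divide using \<sigma>x_bounds[OF h(1) h'] \<sigma>y_bounds[OF h(1) h'] by (intro frac_le) auto
    also have "\<dots> = 2 * pi\<^sup>2 * (K * h)\<^sup>2" by (simp add: power_mult_distrib)
    also have "\<dots> \<le> 20 * (K * h)\<^sup>2"
    proof (rule mult_right_mono)
      have "pi\<^sup>2 \<le> 3.15\<^sup>2" using pi_approx by (intro power_mono) auto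
      then show "2 * pi\<^sup>2 \<le> 20" by (simp add: power2_eq_square)
    qed simp
    finally show ?thesis .
  qed
  have \<theta>: "0 \<le> ?\<theta>" "?\<theta> \<le> 1"
  proof -
    show "0 \<le> ?\<theta>" using \<sigma>x_bounds[OF h(1) h'] \<sigma>y_bounds[OF h(1) h'] by simp
    have "(K * h)\<^sup>2 \<le> (1 / 5)\<^sup>2" using h K_ge_1 by (intro power_mono) auto
    then have "?\<theta>\<^sup>2 \<le> 1\<^sup>2" using \<theta>_sq by (simp add: power_divide)
    then show "?\<theta> \<le> 1" by (rule power2_le_imp_le) simp
  qed
  have diff: "?t - ?t' = real i * h - real i' * h" by simp
  have "sqrt ?R \<le> sqrt ((1 / 8)\<^sup>2)"
    using \<rho> by (intro real_sqrt_le_mono) (simp add: power2_eq_square)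
  then have r: "0 \<le> sqrt ?R" "sqrt ?R \<le> 1 / 8" using \<rho>2_nonneg by (auto simp: real_sqrt_abs)
  have "prob {\<omega> \<in> space M. crossing h i \<omega> \<and> crossing h i' \<omega>}
     - prob {\<omega> \<in> space M. crossing h i \<omega>} * prob {\<omega> \<in> space M. crossing h i' \<omega>} \<le> 26112 * (sqrt ?R)\<^sup>2 * ?\<theta>\<^sup>2"
    unfolding crossing_iff_cone[OF h(1) h']
    using cross_ip_bound[of h ?t ?t'] \<rho>2_nonneg[of h] unfolding diff
    by (intro cone_events_covariance unit_vectors[OF h(1) h'] r \<theta>) simp
  also have "\<dots> = 26112 * ?R * ?\<theta>\<^sup>2" using \<rho>2_nonneg by simp
  also have "\<dots> \<le> 26112 * ?R * (20 * (K * h)\<^sup>2)"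
    using \<theta>_sq \<rho>2_nonneg by (intro mult_left_mono) auto
  also have "\<dots> \<le> 600000 * (K * h)\<^sup>2 * ?R"
    using mult_nonneg_nonneg[OF zero_le_power2[of "K * h"] \<rho>2_nonneg[of h "real i * h - real i' * h"]]
    by (simp add: mult_ac)
  finally show ?thesis .
qed

text \<open>The derivative in u is at most the sum of all |w j| times 2 pi K, that is 16 pi K < 52
  K.\<close>

lemma corr_lipschitz:
  assumes "\<And>j. j \<in> J \<Longrightarrow> \<bar>w j\<bar> \<le> 8 / card J"
  shows "cmod (corr w u - corr w v) \<le> 52 * K * \<bar>u - v\<bar>"
proof -
  have cis_lip: "cmod (cis a - cis d) \<le> \<bar>a - d\<bar>" for a d
  proof -
    have "cmod (iexp (a - d) - (\<Sum>i\<le>0. (\<i> * (a - d)) ^ i / fact i)) \<le> \<bar>a - d\<bar> ^ Suc 0 / fact (Suc 0)"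
      by (rule iexp_approx1)
    then have "cmod (cis (a - d) - 1) \<le> \<bar>a - d\<bar>" by (simp add: cis_conv_exp)
    moreover have "cis a - cis d = cis d * (cis (a - d) - 1)"
      by (simp add: right_diff_distrib cis_mult)
    ultimately show ?thesis by (simp add: norm_mult)
  qed
  have "corr w u - corr w v = (\<Sum>j\<in>J. of_real (w j) * (cis (2 * pi * of_int (k j) * u) - cis (2 * pi * of_int (k j) * v)))"
    by (simp add: corr_def sum_subtractf right_diff_distrib)
  also have "cmod \<dots> \<le> (\<Sum>j\<in>J. 8 / card J * (2 * pi * K * \<bar>u - v\<bar>))"
  proof (rule sum_norm_le)
    fix j assume j: "j \<in> J"
    have "cmod (cis (2 * pi * of_int (k j) * u) - cis (2 * pi * of_int (k j) * v)) \<le> \<bar>2 * pi * of_int (k j) * u - 2 * pi * of_int (k j) * v\<bar>"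
      by (rule cis_lip)
    also have "\<dots> = 2 * pi * \<bar>real_of_int (k j)\<bar> * \<bar>u - v\<bar>"
      by (simp add: right_diff_distrib[symmetric] abs_mult)
    also have "\<dots> \<le> 2 * pi * K * \<bar>u - v\<bar>" using k_le[OF j] by (intro mult_right_mono mult_left_mono) auto
    finally show "cmod (of_real (w j) * (cis (2 * pi * of_int (k j) * u) - cis (2 * pi * of_int (k j) * v)))
      \<le> 8 / card J * (2 * pi * K * \<bar>u - v\<bar>)"
      unfolding norm_mult using assms[OF j] by (intro mult_mono) auto
  qed
  also have "\<dots> = (16 * pi) * (K * \<bar>u - v\<bar>)" using card_J_pos by simp
  also have "\<dots> \<le> 52 * (K * \<bar>u - v\<bar>)" using pi_approx K_ge_1 by (intro mult_right_mono) auto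
  finally show ?thesis by (simp add: mult.assoc)
qed

text \<open>Since \<open>\<rho>2\<close> has total weight 1 + 2 + 1, a value above 1/64 forces one
  of the three moduli above 1/16. Moving from u to v costs at most 1/32, and (1/32)^2 = 1/1024
  remains.\<close>

lemma \<rho>2_stable:
  assumes h: "0 < h" "4 * K * h \<le> 1" and close: "52 * K * \<bar>u - v\<bar> \<le> 1 / 32" and big: "1 / 64 < \<rho>2 h u"
  shows "1 / 1024 \<le> \<rho>2 h v"
proof -
  let ?w1 = "\<lambda>j. (ax h j)\<^sup>2" and ?w2 = "\<lambda>j. ax h j * ay h j" and ?w3 = "\<lambda>j. (ay h j)\<^sup>2"
  have small: "(cmod z)\<^sup>2 \<le> 1 / 256" if "cmod z \<le> 1 / 16" for z :: complex
    using power_mono[OF that, of 2] by (simp add: power2_eq_square)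
  have "\<exists>w\<in>{?w1, ?w2, ?w3}. 1 / 16 < cmod (corr w u)"
  proof (rule ccontr)
    assume "\<not> ?thesis"
    then have sm: "(cmod (corr w u))\<^sup>2 \<le> 1 / 256" if "w \<in> {?w1, ?w2, ?w3}" for w
      using that by (intro small) (meson not_less)
    have "(cmod (corr ?w1 u))\<^sup>2 \<le> 1 / 256" "(cmod (corr ?w2 u))\<^sup>2 \<le> 1 / 256" "(cmod (corr ?w3 u))\<^sup>2 \<le> 1 / 256"
      by (rule sm, simp)+
    then show False using big unfolding \<rho>2_def by linarith
  qed
  then obtain w where w: "w \<in> {?w1, ?w2, ?w3}" "1 / 16 < cmod (corr w u)" by blast
  have "cmod (corr w u - corr w v) \<le> 52 * K * \<bar>u - v\<bar>"
    using w(1) weights[OF h] by (intro corr_lipschitz) auto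
  then have "1 / 32 \<le> cmod (corr w v)"
    using w(2) close norm_triangle_ineq2[of "corr w u" "corr w v"] by linarith
  then have "(1 / 32)\<^sup>2 \<le> (cmod (corr w v))\<^sup>2" by (intro power_mono) auto
  moreover have "(cmod (corr w v))\<^sup>2 \<le> \<rho>2 h v"
    using w(1) unfolding \<rho>2_def by auto
  ultimately show ?thesis by (simp add: power2_eq_square)
qed

text \<open>After expanding the square, the exponential of frequency k j - k j' factors over the two
  grid points, so the double sum over the grid is the squared modulus of one character sum. As
  frequency differences are at most 2 K < n, it vanishes unless k j = k j'. At most card J *
  \<kappa> pairs survive, each with weight at most 64 n^2 / (card J)^2.\<close>

lemma corr_grid_sum:
  assumes n: "2 * K < real n" and w: "\<And>j. j \<in> J \<Longrightarrow> \<bar>w j\<bar> \<le> 8 / card J"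
  shows "(\<Sum>i<n. \<Sum>i'<n. (cmod (corr w (real i / real n - real i' / real n)))\<^sup>2)
     \<le> 64 * (real n)\<^sup>2 * real \<kappa> / real (card J)"
proof -
  let ?e = "\<lambda>d i. cis (2 * pi * of_int d * (real i / real n))"
  have n0: "0 < n" using n K_ge_1 by (cases n) auto
  have expand: "complex_of_real ((cmod (corr w (real i / real n - real i' / real n)))\<^sup>2)
     = (\<Sum>j\<in>J. \<Sum>j'\<in>J. of_real (w j * w j') * (?e (k j - k j') i * cnj (?e (k j - k j') i')))" for i i'
  proof -
    let ?u = "real i / real n - real i' / real n"
    have "complex_of_real ((cmod (corr w ?u))\<^sup>2) = corr w ?u * cnj (corr w ?u)"
      by (rule complex_norm_square)
    also have "\<dots> = (\<Sum>j\<in>J. \<Sum>j'\<in>J. (of_real (w j) * cis (2 * pi * of_int (k j) * ?u)) * cnj (of_real (w j') * cis (2 * pi * of_int (k j') * ?u)))"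
      unfolding corr_def cnj_sum by (rule sum_product)
    also have "\<dots> = (\<Sum>j\<in>J. \<Sum>j'\<in>J. of_real (w j * w j') * (?e (k j - k j') i * cnj (?e (k j - k j') i')))"
    proof (intro sum.cong refl)
      fix j j'
      have "cis (2 * pi * of_int (k j) * ?u) * cnj (cis (2 * pi * of_int (k j') * ?u))
         = ?e (k j - k j') i * cnj (?e (k j - k j') i')"
        unfolding cis_mult_cnj by (rule arg_cong[of _ _ cis]) (simp add: algebra_simps)
      then show "(of_real (w j) * cis (2 * pi * of_int (k j) * ?u)) * cnj (of_real (w j') * cis (2 * pi * of_int (k j') * ?u))
         = of_real (w j * w j') * (?e (k j - k j') i * cnj (?e (k j - k j') i'))"
        by (simp add: mult_ac)
    qed
    finally show ?thesis .
  qed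
  let ?S = "\<lambda>d. \<Sum>i<n. ?e d i"
  have S: "?S (k j - k j') * cnj (?S (k j - k j')) = of_real ((real n)\<^sup>2 * of_bool (k j = k j'))"
    if "j \<in> J" "j' \<in> J" for j j'
  proof (cases "k j = k j'")
    case False
    have "\<bar>real_of_int (k j - k j')\<bar> < real n"
      using k_le[OF that(1)] k_le[OF that(2)] n by simp
    then have "\<bar>k j - k j'\<bar> < int n" by linarith
    then have "?S (k j - k j') = 0"
      using False by (intro sum_cis_multiples[OF n0]) auto
    then show ?thesis using False by (simp only: mult_zero_left) simp
  qed (simp add: power2_eq_square)
  have "complex_of_real (\<Sum>i<n. \<Sum>i'<n. (cmod (corr w (real i / real n - real i' / real n)))\<^sup>2)
    = (\<Sum>i<n. \<Sum>i'<n. \<Sum>j\<in>J. \<Sum>j'\<in>J. of_real (w j * w j') * (?e (k j - k j') i * cnj (?e (k j - k j') i')))"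
    unfolding of_real_sum expand ..
  also have "\<dots> = (\<Sum>i<n. \<Sum>j\<in>J. \<Sum>i'<n. \<Sum>j'\<in>J. of_real (w j * w j') * (?e (k j - k j') i * cnj (?e (k j - k j') i')))"
    by (intro sum.cong refl) (rule sum.swap)
  also have "\<dots> = (\<Sum>j\<in>J. \<Sum>i<n. \<Sum>i'<n. \<Sum>j'\<in>J. of_real (w j * w j') * (?e (k j - k j') i * cnj (?e (k j - k j') i')))"
    by (rule sum.swap)
  also have "\<dots> = (\<Sum>j\<in>J. \<Sum>i<n. \<Sum>j'\<in>J. \<Sum>i'<n. of_real (w j * w j') * (?e (k j - k j') i * cnj (?e (k j - k j') i')))"
    by (intro sum.cong refl) (rule sum.swap)
  also have "\<dots> = (\<Sum>j\<in>J. \<Sum>j'\<in>J. \<Sum>i<n. \<Sum>i'<n. of_real (w j * w j') * (?e (k j - k j') i * cnj (?e (k j - k j') i')))"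
    by (intro sum.cong refl) (rule sum.swap)
  also have "\<dots> = (\<Sum>j\<in>J. \<Sum>j'\<in>J. of_real (w j * w j') * (?S (k j - k j') * cnj (?S (k j - k j'))))"
    unfolding cnj_sum sum_product by (simp only: sum_distrib_left)
  also have "\<dots> = (\<Sum>j\<in>J. \<Sum>j'\<in>J. of_real (w j * w j' * ((real n)\<^sup>2 * of_bool (k j = k j'))))"
    by (intro sum.cong refl) (simp only: S of_real_mult)
  also have "\<dots> = complex_of_real (\<Sum>j\<in>J. \<Sum>j'\<in>J. w j * w j' * ((real n)\<^sup>2 * of_bool (k j = k j')))"
    by simp
  finally have "(\<Sum>i<n. \<Sum>i'<n. (cmod (corr w (real i / real n - real i' / real n)))\<^sup>2)
     = (\<Sum>j\<in>J. \<Sum>j'\<in>J. w j * w j' * ((real n)\<^sup>2 * of_bool (k j = k j')))"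
    unfolding of_real_eq_iff .
  also have "\<dots> \<le> (\<Sum>j\<in>J. \<Sum>j'\<in>J. (8 / card J) * (8 / card J) * ((real n)\<^sup>2 * of_bool (k j' = k j)))"
  proof (intro sum_mono)
    fix j j' assume "j \<in> J" "j' \<in> J"
    then have "\<bar>w j\<bar> * \<bar>w j'\<bar> \<le> (8 / card J) * (8 / card J)" using w by (intro mult_mono) auto
    then have "w j * w j' \<le> (8 / card J) * (8 / card J)"
      unfolding abs_mult[symmetric] by linarith
    then show "w j * w j' * ((real n)\<^sup>2 * of_bool (k j = k j')) \<le> (8 / card J) * (8 / card J) * ((real n)\<^sup>2 * of_bool (k j' = k j))"
      by (subst eq_commute[of "k j" "k j'"]) (rule mult_right_mono, auto)
  qed
  also have "\<dots> = (\<Sum>j\<in>J. (8 / card J) * (8 / card J) * (real n)\<^sup>2 * real (card {j' \<in> J. k j' = k j}))"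
  proof -
    have "(\<Sum>j'\<in>J. of_bool (k j' = k j)) = real (card {j' \<in> J. k j' = k j})" for j
      using finite_J by (simp add: Int_def)
    then show ?thesis
      unfolding mult.assoc by (simp only: sum_distrib_left[symmetric])
  qed
  also have "\<dots> \<le> (\<Sum>j\<in>J. (8 / card J) * (8 / card J) * (real n)\<^sup>2 * real \<kappa>)"
    using multiplicity by (intro sum_mono mult_left_mono) auto
  also have "\<dots> = 64 * (real n)\<^sup>2 * real \<kappa> / real (card J)"
    using card_J_pos by (simp add: field_simps)
  finally show ?thesis .
qed

text \<open>256 is 64 times the total weight 1 + 2 + 1 of the three correlations.\<close>

lemma \<rho>2_grid_sum:
  assumes n: "4 * K \<le> real n" "h = 1 / real n"
  shows "(\<Sum>i<n. \<Sum>i'<n. \<rho>2 h (real i * h - real i' * h)) \<le> 256 * (real n)\<^sup>2 * real \<kappa> / real (card J)"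
proof -
  have n': "0 < real n" "2 * K < real n" using n K_ge_1 by linarith+
  have h: "0 < h" "4 * K * h \<le> 1" using n n' by auto
  let ?T = "\<lambda>w. \<Sum>i<n. \<Sum>i'<n. (cmod (corr w (real i / real n - real i' / real n)))\<^sup>2"
  have "(\<Sum>i<n. \<Sum>i'<n. \<rho>2 h (real i * h - real i' * h))
    = ?T (\<lambda>j. (ax h j)\<^sup>2) + 2 * ?T (\<lambda>j. ax h j * ay h j) + ?T (\<lambda>j. (ay h j)\<^sup>2)"
    unfolding \<rho>2_def using n by (simp add: sum.distrib sum_distrib_left)
  then show ?thesis
    using corr_grid_sum[OF n'(2), of "\<lambda>j. (ax h j)\<^sup>2"] corr_grid_sum[OF n'(2), of "\<lambda>j. ax h j * ay h j"]
      corr_grid_sum[OF n'(2), of "\<lambda>j. (ay h j)\<^sup>2"] weights[OF h]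
    by simp
qed

end

section \<open>The variance of the number of sign changes\<close>

context gaussian_trig
begin

lemma crossings_integrable:
  assumes "finite A"
  shows "integrable M (\<lambda>\<omega>. real (crossings h A \<omega>))"
    "integrable M (\<lambda>\<omega>. (real (crossings h A \<omega>))\<^sup>2)"
proof -
  note [measurable] = crossings_measurable[OF assms, of h]
  show "integrable M (\<lambda>\<omega>. real (crossings h A \<omega>))"
    using crossings_le[OF assms] by (intro integrable_const_bound[of _ "real (card A)"]) auto
  show "integrable M (\<lambda>\<omega>. (real (crossings h A \<omega>))\<^sup>2)"
    using crossings_le[OF assms] by (intro integrable_const_bound[of _ "(real (card A))\<^sup>2"]) (auto intro!: power_mono)
qed

lemma integrable_crossings_prod:
  assumes "finite A" "finite B"
  shows "integrable M (\<lambda>\<omega>. real (crossings h A \<omega>) * real (crossings h B \<omega>))"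
proof -
  note [measurable] = crossings_measurable[OF assms(1), of h] crossings_measurable[OF assms(2), of h]
  show ?thesis
    using crossings_le[OF assms(1)] crossings_le[OF assms(2)]
    by (intro integrable_const_bound[of _ "real (card A) * real (card B)"]) (auto simp: abs_mult intro!: mult_mono)
qed

definition cov :: "real \<Rightarrow> nat set \<Rightarrow> nat set \<Rightarrow> real" where
  "cov h A B = (\<integral>\<omega>. real (crossings h A \<omega>) * real (crossings h B \<omega>) \<partial>M)
     - (\<integral>\<omega>. real (crossings h A \<omega>) \<partial>M) * (\<integral>\<omega>. real (crossings h B \<omega>) \<partial>M)"

lemma cov_eq_sum:
  assumes "finite A" "finite B"
  shows "cov h A B = (\<Sum>i\<in>A. \<Sum>i'\<in>B. prob {\<omega> \<in> space M. crossing h i \<omega> \<and> crossing h i' \<omega>}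
     - prob {\<omega> \<in> space M. crossing h i \<omega>} * prob {\<omega> \<in> space M. crossing h i' \<omega>})"
proof -
  have E1: "(\<integral>\<omega>. real (crossings h A \<omega>) \<partial>M) = (\<Sum>i\<in>A. prob {\<omega> \<in> space M. crossing h i \<omega>})"
    if "finite A" for A
  proof -
    have "(\<integral>\<omega>. real (crossings h A \<omega>) \<partial>M) = (\<integral>\<omega>. (\<Sum>i\<in>A. indicator {\<omega> \<in> space M. crossing h i \<omega>} \<omega>) \<partial>M)"
      by (intro Bochner_Integration.integral_cong refl) (auto simp: real_crossings[OF that] indicator_def intro!: sum.cong)
    also have "\<dots> = (\<Sum>i\<in>A. prob {\<omega> \<in> space M. crossing h i \<omega>})"
      by (subst Bochner_Integration.integral_sum) (auto simp: emeasure_eq_measure)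
    finally show ?thesis .
  qed
  have "(\<integral>\<omega>. real (crossings h A \<omega>) * real (crossings h B \<omega>) \<partial>M)
     = (\<integral>\<omega>. (\<Sum>i\<in>A. \<Sum>i'\<in>B. indicator {\<omega> \<in> space M. crossing h i \<omega> \<and> crossing h i' \<omega>} \<omega>) \<partial>M)"
  proof (intro Bochner_Integration.integral_cong refl)
    fix \<omega> assume "\<omega> \<in> space M"
    then show "real (crossings h A \<omega>) * real (crossings h B \<omega>)
      = (\<Sum>i\<in>A. \<Sum>i'\<in>B. indicator {\<omega> \<in> space M. crossing h i \<omega> \<and> crossing h i' \<omega>} \<omega>)"
      unfolding real_crossings[OF assms(1)] real_crossings[OF assms(2)] sum_product
      by (intro sum.cong refl) (auto simp: indicator_def)
  qed
  also have "\<dots> = (\<Sum>i\<in>A. \<Sum>i'\<in>B. prob {\<omega> \<in> space M. crossing h i \<omega> \<and> crossing h i' \<omega>})"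
    by (subst Bochner_Integration.integral_sum, force simp: emeasure_eq_measure)
      (intro sum.cong refl, subst Bochner_Integration.integral_sum, auto simp: emeasure_eq_measure)
  finally show ?thesis
    by (simp add: cov_def E1 assms sum_product sum_subtractf)
qed

text \<open>Either all correlations between the two macroscopic cells are small and the microscopic
  bound applies to every pair, or one is large; then all are bounded below, and a crude bound for
  the covariance can be charged to their sum. \<open>A\<close> and \<open>B\<close> are subsets of
  the cells because the segment may end inside one.\<close>

lemma cov_cell:
  assumes p: "3328 * K \<le> real p" "real p \<le> 3330 * K" and q: "0 < q" and h: "h = 1 / (real p * real q)"
    and AB: "A \<subseteq> {I * q..<I * q + q}" "B \<subseteq> {I' * q..<I' * q + q}"
  shows "cov h A B \<le> 7 * 10 ^ 10 * (K * h)\<^sup>2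
     * (\<Sum>i\<in>{I * q..<I * q + q}. \<Sum>i'\<in>{I' * q..<I' * q + q}. \<rho>2 h (real i * h - real i' * h))"
proof -
  let ?C = "{I * q..<I * q + q}" and ?C' = "{I' * q..<I' * q + q}"
  let ?\<rho> = "\<lambda>i i'. \<rho>2 h (real i * h - real i' * h)"
  have fin: "finite A" "finite B" using AB finite_subset by blast+
  have p0: "0 < real p" using p K_ge_1 by linarith
  have h0: "0 < h" using p0 q h by simp
  have qh: "real q * h = 1 / real p" using q h by simp
  have Kh: "K * h \<le> 1 / 3328"
  proof -
    have "1 * h \<le> real q * h" using q h0 by (intro mult_right_mono) auto
    then have "K * h \<le> K * (1 / real p)" using qh K_ge_1 by (intro mult_left_mono) auto
    also have "\<dots> \<le> 1 / 3328" using p p0 by (simp add: field_simps)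
    finally show ?thesis .
  qed
  have h5: "5 * K * h \<le> 1" and h4: "4 * K * h \<le> 1" using Kh by simp_all
  have \<rho>_sum_mono: "(\<Sum>i\<in>A. \<Sum>i'\<in>B. ?\<rho> i i') \<le> (\<Sum>i\<in>?C. \<Sum>i'\<in>?C'. ?\<rho> i i')"
  proof -
    have "(\<Sum>i\<in>A. \<Sum>i'\<in>B. ?\<rho> i i') \<le> (\<Sum>i\<in>A. \<Sum>i'\<in>?C'. ?\<rho> i i')"
      using AB \<rho>2_nonneg by (intro sum_mono sum_mono2) auto
    also have "\<dots> \<le> (\<Sum>i\<in>?C. \<Sum>i'\<in>?C'. ?\<rho> i i')"
      using AB \<rho>2_nonneg by (intro sum_mono2) (auto intro!: sum_nonneg)
    finally show ?thesis .
  qed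
  show ?thesis
  proof (cases "\<forall>i\<in>?C. \<forall>i'\<in>?C'. ?\<rho> i i' \<le> 1 / 64")
    case True
    have "cov h A B \<le> (\<Sum>i\<in>A. \<Sum>i'\<in>B. 600000 * (K * h)\<^sup>2 * ?\<rho> i i')"
      unfolding cov_eq_sum[OF fin] using True AB
      by (intro sum_mono crossing_covariance[OF h0 h5]) auto
    also have "\<dots> = 600000 * (K * h)\<^sup>2 * (\<Sum>i\<in>A. \<Sum>i'\<in>B. ?\<rho> i i')"
      by (simp only: sum_distrib_left)
    also have "\<dots> \<le> 7 * 10 ^ 10 * (K * h)\<^sup>2 * (\<Sum>i\<in>?C. \<Sum>i'\<in>?C'. ?\<rho> i i')"
      using \<rho>2_nonneg by (intro mult_mono mult_right_mono \<rho>_sum_mono) (auto intro!: sum_nonneg mult_nonneg_nonneg)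
    finally show ?thesis .
  next
    case False
    then obtain i i' where ii': "i \<in> ?C" "i' \<in> ?C'" "1 / 64 < ?\<rho> i i'" by (auto simp: not_le)
    have low: "1 / 1024 \<le> ?\<rho> j j'" if "j \<in> ?C" "j' \<in> ?C'" for j j'
    proof (rule \<rho>2_stable[OF h0 h4 _ ii'(3)])
      have d: "\<bar>real m * h - real l * h\<bar> \<le> 1 / real p" if "m \<in> {r..<r + q}" "l \<in> {r..<r + q}" for m l r
      proof -
        have "\<bar>real m - real l\<bar> \<le> real q" using that by auto
        then have "\<bar>real m - real l\<bar> * h \<le> real q * h" using h0 by (intro mult_right_mono) auto
        then show ?thesis using h0 qh by (simp add: left_diff_distrib[symmetric] abs_mult)
      qed
      have "\<bar>real i * h - real i' * h - (real j * h - real j' * h)\<bar> \<le> 2 * (1 / real p)"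
        using d[OF ii'(1) that(1)] d[OF ii'(2) that(2)] by linarith
      then have "52 * K * \<bar>real i * h - real i' * h - (real j * h - real j' * h)\<bar> \<le> 52 * K * (2 * (1 / real p))"
        using K_ge_1 by (intro mult_left_mono) auto
      \<comment> \<open>This fixes 3328 = 52 * 2 * 32: two points each move by at most 1 / p, and
        the Lipschitz constant is 52 K.\<close>
      also have "\<dots> \<le> 1 / 32" using p p0 by (simp add: field_simps)
      finally show "52 * K * \<bar>real i * h - real i' * h - (real j * h - real j' * h)\<bar> \<le> 1 / 32" .
    qed
    have "(\<Sum>j\<in>?C. \<Sum>j'\<in>?C'. 1 / 1024) \<le> (\<Sum>j\<in>?C. \<Sum>j'\<in>?C'. ?\<rho> j j')"
      using low by (intro sum_mono) auto
    then have sum_low: "(real q)\<^sup>2 / 1024 \<le> (\<Sum>j\<in>?C. \<Sum>j'\<in>?C'. ?\<rho> j j')"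
      by (simp add: power2_eq_square)
    have short: "8 * pi * K * (real q * h) \<le> 1"
    proof -
      have "8 * pi * K \<le> 3328 * K" using pi_approx K_ge_1 by (intro mult_right_mono) auto
      then have "8 * pi * K \<le> real p" using p by linarith
      from divide_right_mono[OF this, of "real p"] show ?thesis unfolding qh using p0 by simp
    qed
    \<comment> \<open>Expected counts are nonnegative, so the covariance is at most the mixed
      moment, which the second moments control.\<close>
    have nn: "0 \<le> (\<integral>\<omega>. real (crossings h A \<omega>) \<partial>M) * (\<integral>\<omega>. real (crossings h B \<omega>) \<partial>M)"
      by (intro mult_nonneg_nonneg integral_nonneg_AE) auto
    have "(\<integral>\<omega>. real (crossings h A \<omega>) * real (crossings h B \<omega>) \<partial>M)
       \<le> (\<integral>\<omega>. ((real (crossings h A \<omega>))\<^sup>2 + (real (crossings h B \<omega>))\<^sup>2) / 2 \<partial>M)"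
    proof (rule integral_mono)
      show "integrable M (\<lambda>\<omega>. ((real (crossings h A \<omega>))\<^sup>2 + (real (crossings h B \<omega>))\<^sup>2) / 2)"
        using crossings_integrable(2)[OF fin(1)] crossings_integrable(2)[OF fin(2)] by simp
      fix \<omega>
      show "real (crossings h A \<omega>) * real (crossings h B \<omega>) \<le> ((real (crossings h A \<omega>))\<^sup>2 + (real (crossings h B \<omega>))\<^sup>2) / 2"
        using zero_le_power2[of "real (crossings h A \<omega>) - real (crossings h B \<omega>)"]
        by (simp add: power2_eq_square algebra_simps)
    qed (rule integrable_crossings_prod[OF fin])
    also have "\<dots> = ((\<integral>\<omega>. (real (crossings h A \<omega>))\<^sup>2 \<partial>M) + (\<integral>\<omega>. (real (crossings h B \<omega>))\<^sup>2 \<partial>M)) / 2"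
      using crossings_integrable(2)[OF fin(1)] crossings_integrable(2)[OF fin(2)] by simp
    also have "\<dots> \<le> 6"
      using crossings_second_moment[OF h0 AB(1) short] crossings_second_moment[OF h0 AB(2) short] by simp
    finally have "cov h A B \<le> 6" using nn unfolding cov_def by linarith
    \<comment> \<open>As p q h = 1, the constant 6 splits into the lower bound q^2 / 1024 of the sum
      and a multiple of (p h)^2, which is at most (3330 K h)^2.\<close>
    also have "6 = 6144 * (real p * h)\<^sup>2 * ((real q)\<^sup>2 / 1024)"
    proof -
      have "(real p * h)\<^sup>2 * (real q)\<^sup>2 = 1"
        unfolding power_mult_distrib[symmetric] using p0 q h by simp
      then show ?thesis by (simp add: mult.commute)
    qed
    also have "\<dots> \<le> 7 * 10 ^ 10 * (K * h)\<^sup>2 * (\<Sum>j\<in>?C. \<Sum>j'\<in>?C'. ?\<rho> j j')"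
    proof (rule mult_mono[OF _ sum_low])
      have "(real p)\<^sup>2 \<le> (3330 * K)\<^sup>2" using p p0 by (intro power_mono) auto
      then have "6144 * ((real p)\<^sup>2 * h\<^sup>2) \<le> 6144 * ((3330 * K)\<^sup>2 * h\<^sup>2)" by (intro mult_left_mono mult_right_mono) auto
      also have "\<dots> = (6144 * 3330\<^sup>2) * (K\<^sup>2 * h\<^sup>2)"
        by (simp only: power_mult_distrib mult.assoc)
      also have "\<dots> \<le> (7 * 10 ^ 10) * (K\<^sup>2 * h\<^sup>2)"
        by (rule mult_right_mono) simp_all
      finally show "6144 * (real p * h)\<^sup>2 \<le> 7 * 10 ^ 10 * (K * h)\<^sup>2"
        by (simp only: power_mult_distrib)
    qed auto
    finally show ?thesis .
  qed
qed

text \<open>The cell estimates add up to the complete grid sum of \<open>\<rho>2\<close>, whose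
  factor n^2 cancels against h^2 and leaves K^2. The result does not depend on q, the number of grid
  cells per macroscopic cell; 1792 is 7 * 256.\<close>

lemma variance_crossings:
  assumes p: "3328 * K \<le> real p" "real p \<le> 3330 * K" and q: "0 < q" and h: "h = 1 / (real p * real q)"
    and A: "A \<subseteq> {..<p * q}"
  shows "variance (\<lambda>\<omega>. real (crossings h A \<omega>)) \<le> 2 * 10 ^ 13 * K\<^sup>2 * real \<kappa> / real (card J)"
proof -
  let ?C = "\<lambda>I. {I * q..<I * q + q}"
  let ?\<rho> = "\<lambda>i i'. \<rho>2 h (real i * h - real i' * h)"
  have fin: "finite A" using A finite_subset by blast
  have "0 < real p" using p K_ge_1 by linarith
  then have n0: "0 < real (p * q)" using q by simp
  have hn: "h = 1 / real (p * q)" using h by simp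
  have "1 * real p \<le> real q * real p" using q by (intro mult_right_mono) auto
  moreover have "real (p * q) = real q * real p" by simp
  ultimately have n4: "4 * K \<le> real (p * q)" using p K_ge_1 by linarith
  have group: "(\<Sum>i\<in>A. f i) = (\<Sum>I<p. \<Sum>i\<in>A \<inter> ?C I. f i)" for f :: "nat \<Rightarrow> real"
  proof -
    have "(\<Sum>i\<in>A. f i) = (\<Sum>i<p * q. if i \<in> A then f i else 0)"
      using A by (simp add: sum.If_cases Int_absorb1)
    also have "\<dots> = (\<Sum>I<p. \<Sum>i\<in>?C I. if i \<in> A then f i else 0)"
      by (rule sum.nat_group[symmetric])
    also have "\<dots> = (\<Sum>I<p. \<Sum>i\<in>A \<inter> ?C I. f i)"
      by (simp add: sum.If_cases Int_commute)
    finally show ?thesis .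
  qed
  have "variance (\<lambda>\<omega>. real (crossings h A \<omega>)) = cov h A A"
    unfolding variance_eq[OF crossings_integrable[OF fin]] cov_def by (simp add: power2_eq_square)
  also have "\<dots> = (\<Sum>I<p. \<Sum>I'<p. cov h (A \<inter> ?C I) (A \<inter> ?C I'))"
    by (simp add: cov_eq_sum fin group) (intro sum.cong refl sum.swap)
  also have "\<dots> \<le> (\<Sum>I<p. \<Sum>I'<p. 7 * 10 ^ 10 * (K * h)\<^sup>2 * (\<Sum>i\<in>?C I. \<Sum>i'\<in>?C I'. ?\<rho> i i'))"
    by (intro sum_mono cov_cell[OF p q h]) auto
  also have "\<dots> = 7 * 10 ^ 10 * (K * h)\<^sup>2 * (\<Sum>I<p. \<Sum>I'<p. \<Sum>i\<in>?C I. \<Sum>i'\<in>?C I'. ?\<rho> i i')"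
    by (simp only: sum_distrib_left)
  also have "(\<Sum>I<p. \<Sum>I'<p. \<Sum>i\<in>?C I. \<Sum>i'\<in>?C I'. ?\<rho> i i') = (\<Sum>I<p. \<Sum>i\<in>?C I. \<Sum>I'<p. \<Sum>i'\<in>?C I'. ?\<rho> i i')"
    by (intro sum.cong refl sum.swap)
  also have "\<dots> = (\<Sum>i<p * q. \<Sum>i'<p * q. ?\<rho> i i')"
    by (simp only: sum.nat_group)
  also have "7 * 10 ^ 10 * (K * h)\<^sup>2 * \<dots> \<le> 7 * 10 ^ 10 * (K * h)\<^sup>2 * (256 * (real (p * q))\<^sup>2 * real \<kappa> / real (card J))"
    by (intro mult_left_mono \<rho>2_grid_sum[OF n4 hn]) auto
  also have "\<dots> = 1792 * 10 ^ 10 * K\<^sup>2 * (h * real (p * q))\<^sup>2 * real \<kappa> / real (card J)"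
    by (simp add: power_mult_distrib)
  also have "h * real (p * q) = 1"
    unfolding hn by (rule nonzero_eq_divide_eq[THEN iffD1, OF less_imp_neq[OF n0, symmetric] refl])
  also have "1792 * 10 ^ 10 * K\<^sup>2 * 1\<^sup>2 * real \<kappa> / real (card J) \<le> 2 * 10 ^ 13 * K\<^sup>2 * real \<kappa> / real (card J)"
    by (intro divide_right_mono mult_right_mono) auto
  finally show ?thesis .
qed

text \<open>A crude bound by Cauchy-Schwarz over the p macroscopic cells. What matters is uniformity
  in q, which yields square integrability of the zero count in the limit.\<close>

lemma second_moment_crossings:
  assumes p: "3328 * K \<le> real p" and q: "0 < q" and h: "h = 1 / (real p * real q)"
    and A: "A \<subseteq> {..<p * q}"
  shows "(\<integral>\<omega>. (real (crossings h A \<omega>))\<^sup>2 \<partial>M) \<le> 6 * (real p)\<^sup>2"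
proof -
  let ?C = "\<lambda>I. {I * q..<I * q + q}"
  have fin: "finite A" using A finite_subset by blast
  have p0: "0 < real p" using p K_ge_1 by linarith
  have h0: "0 < h" using p0 q h by simp
  have qh: "real q * h = 1 / real p" using q h by simp
  have short: "8 * pi * K * (real q * h) \<le> 1"
  proof -
    have "8 * pi * K \<le> 3328 * K" using pi_approx K_ge_1 by (intro mult_right_mono) auto
    then have "8 * pi * K \<le> real p" using p by linarith
    from divide_right_mono[OF this, of "real p"] show ?thesis unfolding qh using p0 by simp
  qed
  have split: "real (crossings h A \<omega>) = (\<Sum>I<p. real (crossings h (A \<inter> ?C I) \<omega>))" for \<omega>
  proof -
    have "real (crossings h A \<omega>) = (\<Sum>i<p * q. if i \<in> A then of_bool (crossing h i \<omega>) else 0)"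
      using A by (simp add: real_crossings[OF fin] sum.If_cases Int_absorb1 del: sum_of_bool_eq)
    also have "\<dots> = (\<Sum>I<p. \<Sum>i\<in>?C I. if i \<in> A then of_bool (crossing h i \<omega>) else 0)"
      by (rule sum.nat_group[symmetric])
    also have "\<dots> = (\<Sum>I<p. real (crossings h (A \<inter> ?C I) \<omega>))"
      by (simp add: real_crossings fin sum.If_cases Int_commute del: sum_of_bool_eq)
    finally show ?thesis .
  qed
  have "(\<integral>\<omega>. (real (crossings h A \<omega>))\<^sup>2 \<partial>M) \<le> (\<integral>\<omega>. real p * (\<Sum>I<p. (real (crossings h (A \<inter> ?C I) \<omega>))\<^sup>2) \<partial>M)"
  proof (rule integral_mono)
    show "integrable M (\<lambda>\<omega>. real p * (\<Sum>I<p. (real (crossings h (A \<inter> ?C I) \<omega>))\<^sup>2))"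
      using fin by (intro integrable_mult_right Bochner_Integration.integrable_sum crossings_integrable) auto
    fix \<omega>
    show "(real (crossings h A \<omega>))\<^sup>2 \<le> real p * (\<Sum>I<p. (real (crossings h (A \<inter> ?C I) \<omega>))\<^sup>2)"
      unfolding split using sum_squared_le_sum_of_squares[of "\<lambda>I. real (crossings h (A \<inter> ?C I) \<omega>)" "{..<p}"] by (simp add: mult.commute)
  qed (rule crossings_integrable[OF fin])
  also have "\<dots> = real p * (\<Sum>I<p. (\<integral>\<omega>. (real (crossings h (A \<inter> ?C I) \<omega>))\<^sup>2 \<partial>M))"
    using crossings_integrable(2) fin by (subst integral_mult_right_zero, subst Bochner_Integration.integral_sum) auto
  also have "\<dots> \<le> real p * (\<Sum>I<p. 6)"
    by (intro mult_left_mono sum_mono crossings_second_moment[OF h0 _ short]) auto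
  finally show ?thesis by (simp add: power2_eq_square)
qed

end

section \<open>Zeros as limits of sign changes\<close>

lemma eventually_nonzero_at_simple_zero:
  fixes f :: "real \<Rightarrow> real"
  assumes d: "(f has_real_derivative f') (at t)" and ne: "f t \<noteq> 0 \<or> f' \<noteq> 0"
  shows "\<forall>\<^sub>F x in at t. f x \<noteq> 0"
proof (cases "f t = 0")
  case False
  have "(f \<longlongrightarrow> f t) (at t)" using DERIV_isCont[OF d] by (simp add: isCont_def)
  then show ?thesis using False by (rule tendsto_imp_eventually_ne)
next
  case True
  then have "((\<lambda>x. (f x - f t) / (x - t)) \<longlongrightarrow> f') (at t)" "f' \<noteq> 0"
    using d ne by (auto simp: has_field_derivative_iff)
  then have "\<forall>\<^sub>F x in at t. (f x - f t) / (x - t) \<noteq> 0"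
    by (rule tendsto_imp_eventually_ne)
  then show ?thesis by eventually_elim (use True in auto)
qed

text \<open>Infinitely many zeros would accumulate in the compact interval, but every point of it
  has a punctured neighbourhood free of zeros.\<close>

lemma finite_simple_zeros:
  fixes f f' :: "real \<Rightarrow> real"
  assumes d: "\<And>t. (f has_real_derivative f' t) (at t)" and simple: "\<And>t. t \<in> {a..b} \<Longrightarrow> f t \<noteq> 0 \<or> f' t \<noteq> 0"
  shows "finite {t \<in> {a..b}. f t = 0}"
proof (rule ccontr)
  assume "infinite {t \<in> {a..b}. f t = 0}"
  moreover have "compact {a..b}" by simp
  ultimately obtain x where x: "x \<in> {a..b}" "x islimpt {t \<in> {a..b}. f t = 0}"
    unfolding compact_eq_Bolzano_Weierstrass by (metis (no_types, lifting) mem_Collect_eq subsetI)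
  have "\<forall>\<^sub>F y in at x. y \<notin> {t \<in> {a..b}. f t = 0}"
    using eventually_nonzero_at_simple_zero[OF d simple[OF x(1)]] by eventually_elim auto
  then show False using x(2) by (simp add: islimpt_iff_eventually)
qed

lemma simple_zero_sign_change:
  fixes f :: "real \<Rightarrow> real"
  assumes "(f has_real_derivative f') (at z)" "f z = 0" "f' \<noteq> 0"
  shows "\<exists>d>0. \<forall>x y. z - d < x \<longrightarrow> x < z \<longrightarrow> z < y \<longrightarrow> y < z + d \<longrightarrow> f x * f y < 0"
proof -
  have *: "\<exists>d>0. \<forall>x y. z - d < x \<longrightarrow> x < z \<longrightarrow> z < y \<longrightarrow> y < z + d \<longrightarrow> f x * f y < 0"
    if d: "(f has_real_derivative f') (at z)" and "f z = 0" "0 < f'" for f and f' :: real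
  proof -
    obtain d1 where d1: "0 < d1" "\<And>h. 0 < h \<Longrightarrow> h < d1 \<Longrightarrow> f z < f (z + h)"
      using DERIV_pos_inc_right[OF d \<open>0 < f'\<close>] by auto
    obtain d2 where d2: "0 < d2" "\<And>h. 0 < h \<Longrightarrow> h < d2 \<Longrightarrow> f (z - h) < f z"
      using DERIV_pos_inc_left[OF d \<open>0 < f'\<close>] by auto
    show ?thesis
    proof (intro exI[of _ "min d1 d2"] conjI allI impI)
      fix x y assume "z - min d1 d2 < x" "x < z" "z < y" "y < z + min d1 d2"
      then show "f x * f y < 0"
        using d1(2)[of "y - z"] d2(2)[of "z - x"] \<open>f z = 0\<close> by (intro mult_neg_pos) auto
    qed (use d1 d2 in auto)
  qed
  show ?thesis
  proof (cases "0 < f'")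
    case False
    then have "\<exists>d>0. \<forall>x y. z - d < x \<longrightarrow> x < z \<longrightarrow> z < y \<longrightarrow> y < z + d \<longrightarrow> (- f x) * (- f y) < 0"
      using assms by (intro *[of "\<lambda>x. - f x" "- f'"]) (auto intro: DERIV_minus)
    then show ?thesis by simp
  qed (use *[of f f'] assms in auto)
qed

lemma cell_unique:
  fixes z h :: real
  assumes "0 < h" "real i * h < z" "z < real (Suc i) * h"
  shows "nat \<lfloor>z / h\<rfloor> = i"
proof -
  have "real i < z / h" "z / h < real i + 1" using assms by (auto simp: field_simps)
  then have "\<lfloor>z / h\<rfloor> = int i" by linarith
  then show ?thesis by simp
qed

text \<open>Once the mesh is below the distance on which every zero has opposite signs on its two
  sides, sending a zero to the index of its cell is a bijection to the cells with a sign change.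
  Zeros at grid points, which no strict sign change would record, are excluded by
  \<open>rat\<close>.\<close>

lemma eventually_sign_changes_eq_zeros:
  fixes f f' :: "real \<Rightarrow> real"
  assumes d: "\<And>t. (f has_real_derivative f' t) (at t)" and T: "0 < T" "T \<le> 1"
    and simple: "\<And>t. t \<in> {0..1} \<Longrightarrow> f t \<noteq> 0 \<or> f' t \<noteq> 0"
    and rat: "\<And>i n. f (real i * (1 / real n)) \<noteq> 0" and fT: "f T \<noteq> 0"
  shows "\<forall>\<^sub>F n in sequentially. card {i. i < n \<and> real (Suc i) * (1 / real n) \<le> T \<and> f (real i * (1 / real n)) * f (real (Suc i) * (1 / real n)) < 0}
      = card {t. 0 \<le> t \<and> t < T \<and> f t = 0}"
proof -
  define Z where "Z = {t. 0 \<le> t \<and> t < T \<and> f t = 0}"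
  have finZ: "finite Z"
    by (rule finite_subset[OF _ finite_simple_zeros[OF d simple]]) (use T in \<open>auto simp: Z_def\<close>)
  \<comment> \<open>The condition \<open>z + d \<le> T\<close> ensures that the cell of a zero ends
    no later than T and is therefore counted.\<close>
  have "\<exists>d>0. (z + d \<le> T \<and> (\<forall>x y. z - d < x \<longrightarrow> x < z \<longrightarrow> z < y \<longrightarrow> y < z + d \<longrightarrow> f x * f y < 0))" if z: "z \<in> Z" for z
  proof -
    have "f' z \<noteq> 0" using simple[of z] z T by (auto simp: Z_def)
    then obtain e where "e > 0" "\<forall>x y. z - e < x \<longrightarrow> x < z \<longrightarrow> z < y \<longrightarrow> y < z + e \<longrightarrow> f x * f y < 0"
      using simple_zero_sign_change[OF d, of z] z by (auto simp: Z_def)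
    then show ?thesis using z by (intro exI[of _ "min e (T - z)"]) (auto simp: Z_def)
  qed
  then obtain e where e: "\<And>z. z \<in> Z \<Longrightarrow> 0 < e z" "\<And>z. z \<in> Z \<Longrightarrow> z + e z \<le> T"
    "\<And>z x y. z \<in> Z \<Longrightarrow> z - e z < x \<Longrightarrow> x < z \<Longrightarrow> z < y \<Longrightarrow> y < z + e z \<Longrightarrow> f x * f y < 0"
    by metis
  define \<delta> where "\<delta> = Min (insert 1 (e ` Z))"
  have \<delta>: "0 < \<delta>" "\<And>z. z \<in> Z \<Longrightarrow> \<delta> \<le> e z"
    using finZ e(1) by (auto simp: \<delta>_def)
  have "\<forall>\<^sub>F n in sequentially. 1 / real n < \<delta>"
    using order_tendstoD(2)[OF lim_1_over_n \<delta>(1)] by simp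
  moreover have "\<forall>\<^sub>F n in sequentially. 0 < n" by (rule eventually_gt_at_top)
  ultimately show ?thesis
  proof eventually_elim
    fix n :: nat assume n: "1 / real n < \<delta>" "0 < n"
    define h where "h = 1 / real n"
    have h: "0 < h" "h < \<delta>" using n by (auto simp: h_def)
    let ?C = "{i. i < n \<and> real (Suc i) * h \<le> T \<and> f (real i * h) * f (real (Suc i) * h) < 0}"
    let ?g = "\<lambda>z. nat \<lfloor>z / h\<rfloor>"
    have cell: "real (?g z) * h < z \<and> z < real (Suc (?g z)) * h" if "z \<in> Z" for z
    proof -
      have z0: "0 \<le> z / h" using that h by (auto simp: Z_def)
      then have r: "real (?g z) = of_int \<lfloor>z / h\<rfloor>" by simp
      have "real (?g z) \<le> z / h" "z / h < real (?g z) + 1" unfolding r by linarith+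
      then have "real (?g z) * h \<le> z" "z < real (Suc (?g z)) * h" using h by (auto simp: field_simps)
      moreover have "real (?g z) * h \<noteq> z"
        using rat[of "?g z" n] that by (auto simp: Z_def h_def)
      ultimately show ?thesis by simp
    qed
    have sc: "f x * f y < 0" if "z \<in> Z" "z - h \<le> x" "x < z" "z < y" "y \<le> z + h" for x y z
      using that h \<delta>(2)[OF that(1)] by (intro e(3)[of z]) auto
    have "bij_betw ?g Z ?C"
      unfolding bij_betw_def
    proof
      show "inj_on ?g Z"
      proof (rule linorder_inj_onI)
        fix z z' assume zz: "z < z'" "z \<in> Z" "z' \<in> Z"
        show "?g z \<noteq> ?g z'"
        proof
          assume eq: "?g z = ?g z'"
          have *: "real (?g z) * h < z" "z' < real (Suc (?g z)) * h"
            using cell[OF zz(2)] cell[OF zz(3)] eq by auto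
          have "real (Suc (?g z)) * h = real (?g z) * h + h" by (simp add: distrib_right)
          then have "z' \<le> z + h" "z - h \<le> real (?g z) * h" using * cell[OF zz(2)] by linarith+
          \<comment> \<open>A second zero in the same cell would lie to the right of z within reach
            of the sign change at z, where f cannot vanish.\<close>
          then have "f (real (?g z) * h) * f z' < 0" using * zz by (intro sc[of z]) auto
          then show False using zz(3) by (simp add: Z_def)
        qed
      qed auto
      show "?g ` Z = ?C"
      proof (intro equalityI subsetI)
        fix i assume "i \<in> ?g ` Z"
        then obtain z where z: "z \<in> Z" "i = ?g z" by auto
        have c: "real i * h < z" "z < real (Suc i) * h" using cell[OF z(1)] z(2) by auto
        have S: "real (Suc i) * h = real i * h + h" by (simp add: distrib_right)
        have le: "real (Suc i) * h \<le> T" using c S e(2)[OF z(1)] \<delta>(2)[OF z(1)] h by linarith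
        have "real n * h = 1" using n by (simp add: h_def)
        then have "real (Suc i) * h \<le> real n * h" using le T by linarith
        then have "i < n" using h by (simp del: of_nat_Suc)
        moreover have "f (real i * h) * f (real (Suc i) * h) < 0"
          using c S by (intro sc[OF z(1)]) linarith+
        ultimately show "i \<in> ?C" using le by simp
      next
        fix i assume i: "i \<in> ?C"
        have "\<exists>\<zeta>. inj_on \<zeta> {i} \<and> (\<forall>i\<in>{i}. real i * h < \<zeta> i \<and> \<zeta> i < real (Suc i) * h \<and> f (\<zeta> i) = 0)"
          using i h DERIV_isCont[OF d] by (intro sign_changes_give_zeros) auto
        then obtain z where z: "real i * h < z" "z < real (Suc i) * h" "f z = 0" by auto
        have "0 \<le> real i * h" using h by simp
        then have "z \<in> Z" using z i unfolding Z_def by auto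
        then show "i \<in> ?g ` Z" using cell_unique[OF h(1) z(1,2)] by (metis image_eqI)
      qed
    qed
    from bij_betw_same_card[OF this]
    show "card {i. i < n \<and> real (Suc i) * (1 / real n) \<le> T \<and> f (real i * (1 / real n)) * f (real (Suc i) * (1 / real n)) < 0}
      = card {t. 0 \<le> t \<and> t < T \<and> f t = 0}"
      unfolding h_def Z_def by (rule sym)
  qed
qed

text \<open>Counting occupied cells makes the number of points of a random set a limit of finite
  sums of indicators. Finitely many points eventually lie in distinct cells; for infinitely many the
  counts are unbounded. This divergence lets the limit recognise the sets on which
  \<open>card\<close> is 0 by convention.\<close>

lemma card_occupied_cells:
  fixes S :: "real set"
  assumes T: "0 < T" and S: "S \<subseteq> {0..<T}"
  defines "N \<equiv> \<lambda>n. card {i. i < n \<and> (\<exists>t\<in>S. real i * (T / real n) \<le> t \<and> t < real (Suc i) * (T / real n))}"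
  shows "finite S \<Longrightarrow> (\<lambda>n. real (N n)) \<longlonglongrightarrow> real (card S)"
    and "infinite S \<Longrightarrow> \<not> convergent (\<lambda>n. real (N n))"
proof -
  define occ where "occ n = {i. i < n \<and> (\<exists>t\<in>S. real i * (T / real n) \<le> t \<and> t < real (Suc i) * (T / real n))}" for n
  have N: "N n = card (occ n)" for n by (simp add: N_def occ_def)
  have fin_occ: "finite (occ n)" for n by (simp add: occ_def)
  let ?g = "\<lambda>n t. nat \<lfloor>t / (T / real n)\<rfloor>"
  have cell: "real (?g n t) * (T / real n) \<le> t" "t < real (Suc (?g n t)) * (T / real n)" "?g n t < n"
    if "t \<in> S" "0 < n" for n t
  proof -
    have h: "0 < T / real n" using T that by simp
    have t0: "0 \<le> t" "t < T" using S that by auto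
    then have "0 \<le> t / (T / real n)" using h by simp
    then have r: "real (?g n t) = of_int \<lfloor>t / (T / real n)\<rfloor>" by simp
    have r2: "real (?g n t) \<le> t / (T / real n)" "t / (T / real n) < real (?g n t) + 1" unfolding r by linarith+
    have cancel: "t / (T / real n) * (T / real n) = t"
      by (rule nonzero_eq_divide_eq[THEN iffD1, OF less_imp_neq[OF h, symmetric] refl])
    have "real (?g n t) * (T / real n) \<le> t / (T / real n) * (T / real n)"
      using r2(1) h by (intro mult_right_mono) auto
    then show "real (?g n t) * (T / real n) \<le> t" unfolding cancel .
    have "t / (T / real n) * (T / real n) < (real (?g n t) + 1) * (T / real n)"
      using r2(2) h by (intro mult_strict_right_mono) auto
    then show "t < real (Suc (?g n t)) * (T / real n)" unfolding cancel by (simp add: add.commute)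
    have "t / (T / real n) < real n" using t0 T that by (simp add: field_simps)
    then show "?g n t < n" using r2(1) by linarith
  qed
  have lower: "\<forall>\<^sub>F n in sequentially. card S0 \<le> N n" if S0: "finite S0" "S0 \<subseteq> S" for S0
  proof -
    \<comment> \<open>The smallest distance between points of \<open>S0\<close>; the inserted 1
      keeps the minimum meaningful when there are fewer than two.\<close>
    define \<delta> where "\<delta> = Min (insert 1 ((\<lambda>(s, t). \<bar>s - t\<bar>) ` {(s, t) \<in> S0 \<times> S0. s \<noteq> t}))"
    have "finite {(s, t) \<in> S0 \<times> S0. s \<noteq> t}"
      by (rule finite_subset[of _ "S0 \<times> S0"]) (use S0 in auto)
    then have \<delta>: "0 < \<delta>" "\<And>s t. s \<in> S0 \<Longrightarrow> t \<in> S0 \<Longrightarrow> s \<noteq> t \<Longrightarrow> \<delta> \<le> \<bar>s - t\<bar>"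
      unfolding \<delta>_def by (auto intro!: Min_le)
    have "(\<lambda>n. T * (1 / real n)) \<longlonglongrightarrow> T * 0" by (intro tendsto_mult tendsto_const lim_1_over_n)
    then have "\<forall>\<^sub>F n in sequentially. T * (1 / real n) < \<delta>"
      using order_tendstoD(2)[of _ "T * 0" sequentially \<delta>] \<delta>(1) by simp
    moreover have "\<forall>\<^sub>F n in sequentially. 0 < (n :: nat)" by (rule eventually_gt_at_top)
    ultimately show ?thesis
    proof eventually_elim
      fix n :: nat assume n: "T * (1 / real n) < \<delta>" "0 < n"
      have "inj_on (?g n) S0"
      proof (rule inj_onI, rule ccontr)
        fix s t assume st: "s \<in> S0" "t \<in> S0" "?g n s = ?g n t" "s \<noteq> t"
        have Suc: "real (Suc (?g n s)) * (T / real n) = real (?g n s) * (T / real n) + T / real n"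
          by (simp only: of_nat_Suc distrib_right mult_1 add.commute)
        have "s \<in> S" "t \<in> S" using st S0 by auto
        then have "\<bar>s - t\<bar> < T / real n"
          using cell[of s n] cell[of t n] n(2) Suc unfolding st(3)[symmetric] by (auto simp: abs_less_iff)
        then show False using \<delta>(2)[OF st(1,2,4)] n by simp
      qed
      moreover have "?g n ` S0 \<subseteq> occ n"
      proof
        fix i assume "i \<in> ?g n ` S0"
        then obtain t where t: "t \<in> S" "i = ?g n t" using S0 by blast
        show "i \<in> occ n"
          unfolding occ_def mem_Collect_eq t(2) using t(1) cell[OF t(1) n(2)] by (intro conjI bexI[of _ t])
      qed
      ultimately show "card S0 \<le> N n"
        unfolding N by (intro card_inj_on_le[OF _ _ fin_occ]) auto
    qed
  qed
  {
    assume fin: "finite S"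
    have upper: "N n \<le> card S" for n
    proof -
      have "\<exists>t\<in>S. real i * (T / real n) \<le> t \<and> t < real (Suc i) * (T / real n)" if "i \<in> occ n" for i
        using that by (auto simp: occ_def)
      then obtain \<tau> where \<tau>: "\<And>i. i \<in> occ n \<Longrightarrow> \<tau> i \<in> S \<and> real i * (T / real n) \<le> \<tau> i \<and> \<tau> i < real (Suc i) * (T / real n)"
        by metis
      have "inj_on \<tau> (occ n)"
      proof (rule linorder_inj_onI)
        fix i j assume ij: "i < j" "i \<in> occ n" "j \<in> occ n"
        have "real (Suc i) * (T / real n) \<le> real j * (T / real n)"
          using ij T by (intro mult_right_mono) auto
        then show "\<tau> i \<noteq> \<tau> j" using \<tau>[OF ij(2)] \<tau>[OF ij(3)] by linarith
      qed auto
      then show ?thesis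
        unfolding N using \<tau> by (intro card_inj_on_le[OF _ _ fin]) auto
    qed
    have "\<forall>\<^sub>F n in sequentially. real (N n) = real (card S)"
      using lower[OF fin subset_refl] by eventually_elim (use upper in \<open>simp add: le_antisym\<close>)
    then show "(\<lambda>n. real (N n)) \<longlonglongrightarrow> real (card S)" by (rule tendsto_eventually)
  next
    assume inf: "infinite S"
    show "\<not> convergent (\<lambda>n. real (N n))"
    proof
      assume "convergent (\<lambda>n. real (N n))"
      then have "Bseq (\<lambda>n. real (N n))" by (rule convergent_imp_Bseq)
      then obtain B where B: "\<And>n. real (N n) \<le> B"
        by (metis Bseq_def abs_of_nat real_norm_def)
      obtain S0 where S0: "S0 \<subseteq> S" "finite S0" "card S0 = nat \<lceil>B\<rceil> + 1"
        using infinite_arbitrarily_large[OF inf] by blast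
      obtain n where "card S0 \<le> N n"
        using lower[OF S0(2,1)] by (auto simp: eventually_sequentially)
      then have "real (nat \<lceil>B\<rceil> + 1) \<le> B" using S0(3) B[of n] by (metis of_nat_le_iff order_trans)
      then show False by linarith
    qed
  }
qed

text \<open>By compactness the minimum of |f| is attained, so arbitrarily small values on a dense
  set force a zero. Applied with a countable \<open>D\<close>, this makes the existence of a zero a
  measurable event.\<close>

lemma exists_zero_Icc_iff:
  fixes f :: "real \<Rightarrow> real"
  assumes cont: "\<And>t. isCont f t" and D: "D \<subseteq> {a..b}" "{a..b} \<subseteq> closure D"
  shows "(\<exists>t\<in>{a..b}. f t = 0) \<longleftrightarrow> (\<forall>m::nat. \<exists>q\<in>D. \<bar>f q\<bar> < 1 / real (Suc m))"
proof
  assume "\<exists>t\<in>{a..b}. f t = 0"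
  then obtain t where t: "t \<in> {a..b}" "f t = 0" by blast
  show "\<forall>m::nat. \<exists>q\<in>D. \<bar>f q\<bar> < 1 / real (Suc m)"
  proof
    fix m :: nat
    obtain d where d: "0 < d" "\<And>x. dist x t < d \<Longrightarrow> dist (f x) (f t) < 1 / real (Suc m)"
      using cont[of t] unfolding continuous_at_eps_delta by (metis of_nat_0_less_iff zero_less_Suc zero_less_divide_1_iff)
    obtain q where "q \<in> D" "dist q t < d"
      using D(2) t(1) d(1) by (metis closure_approachable subsetD)
    then show "\<exists>q\<in>D. \<bar>f q\<bar> < 1 / real (Suc m)" using d(2)[of q] t by (auto simp: dist_real_def)
  qed
next
  assume *: "\<forall>m::nat. \<exists>q\<in>D. \<bar>f q\<bar> < 1 / real (Suc m)"
  then have "{a..b} \<noteq> {}" using D(1) by blast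
  moreover have "continuous_on {a..b} (\<lambda>t. \<bar>f t\<bar>)"
    using cont by (intro continuous_intros continuous_at_imp_continuous_on) auto
  ultimately obtain t where t: "t \<in> {a..b}" "\<And>s. s \<in> {a..b} \<Longrightarrow> \<bar>f t\<bar> \<le> \<bar>f s\<bar>"
    using continuous_attains_inf[of "{a..b}" "\<lambda>t. \<bar>f t\<bar>"] by auto
  have "f t = 0"
  proof (rule ccontr)
    assume "f t \<noteq> 0"
    then obtain m where m: "1 / real (Suc m) < \<bar>f t\<bar>" using nat_approx_posE[of "\<bar>f t\<bar>"] by auto
    obtain q where "q \<in> D" "\<bar>f q\<bar> < 1 / real (Suc m)" using * by blast
    then show False using t(2)[of q] D(1) m by force
  qed
  then show "\<exists>t\<in>{a..b}. f t = 0" using t by blast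
qed

section \<open>The variance of the number of zeros\<close>

text \<open>The mean value inequality is used twice, first for f' and then for f, starting from the
  double zero; the intersection of the neighbourhood with [0, 1] is still convex.\<close>

lemma double_zero_quadratic_bound:
  fixes f f' f'' :: "real \<Rightarrow> real"
  assumes d: "\<And>t. (f has_real_derivative f' t) (at t)" "\<And>t. (f' has_real_derivative f'' t) (at t)"
    and B: "\<And>s. s \<in> {0..1} \<Longrightarrow> \<bar>f'' s\<bar> \<le> B" and t: "t \<in> {0..1}" "f t = 0" "f' t = 0"
    and s: "s \<in> {0..1}" "\<bar>s - t\<bar> \<le> \<delta>"
  shows "\<bar>f s\<bar> \<le> B * \<delta>\<^sup>2"
proof -
  let ?S = "{max 0 (t - \<delta>)..min 1 (t + \<delta>)}"
  have S: "convex ?S" "t \<in> ?S" "s \<in> ?S" using s t by (auto simp: abs_le_iff)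
  have B0: "0 \<le> B" using B[OF t(1)] by linarith
  have f': "\<bar>f' x\<bar> \<le> B * \<delta>" if "x \<in> ?S" for x
  proof -
    have "norm (f' x - f' t) \<le> B * norm (x - t)"
      using B d(2) by (intro field_differentiable_bound[OF S(1) _ _ that S(2)]) (auto intro: has_field_derivative_at_within)
    also have "\<dots> \<le> B * \<delta>" using that B0 by (intro mult_left_mono) (auto simp: abs_le_iff)
    finally show ?thesis using t by simp
  qed
  have "norm (f s - f t) \<le> (B * \<delta>) * norm (s - t)"
    using f' d(1) by (intro field_differentiable_bound[OF S(1) _ _ S(3,2)]) (auto intro: has_field_derivative_at_within)
  also have "\<dots> \<le> (B * \<delta>) * \<delta>"
    using s B0 by (intro mult_left_mono) auto
  finally show ?thesis using t by (simp add: power2_eq_square mult.assoc)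
qed

context gaussian_trig
begin

lemma pred_exists_zero_Icc [measurable]: "Measurable.pred M (\<lambda>\<omega>. \<exists>t\<in>{u..v}. F 0 t \<omega> = 0)"
proof -
  obtain D where D: "countable D" "D \<subseteq> {u..v}" "{u..v} \<subseteq> closure D"
    by (rule separable)
  show ?thesis
  proof (cases "D = {}")
    case True
    then have "{u..v} = {}" using D by auto
    then show ?thesis by simp
  next
    case False
    have "(\<exists>t\<in>{u..v}. F 0 t \<omega> = 0) \<longleftrightarrow> (\<forall>m::nat. \<exists>j::nat. \<bar>F 0 (from_nat_into D j) \<omega>\<bar> < 1 / real (Suc m))" for \<omega>
    proof -
      have "(\<exists>q\<in>D. P q) \<longleftrightarrow> (\<exists>j. P (from_nat_into D j))" for P :: "real \<Rightarrow> bool"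
        using False D(1) by (metis from_nat_into from_nat_into_to_nat_on)
      then show ?thesis
        using exists_zero_Icc_iff[of "\<lambda>t. F 0 t \<omega>", OF F_isCont D(2,3)] by simp
    qed
    then show ?thesis by simp
  qed
qed

text \<open>Half-open intervals are exhausted by countably many closed ones; they are wanted because
  the counting cells must be disjoint.\<close>

lemma pred_exists_zero_Ico [measurable]: "Measurable.pred M (\<lambda>\<omega>. \<exists>t. u \<le> t \<and> t < v \<and> F 0 t \<omega> = 0)"
proof -
  have "(\<exists>t. u \<le> t \<and> t < v \<and> F 0 t \<omega> = 0) \<longleftrightarrow> (\<exists>m::nat. \<exists>t\<in>{u..v - 1 / real (Suc m)}. F 0 t \<omega> = 0)" for \<omega>
  proof
    assume "\<exists>t. u \<le> t \<and> t < v \<and> F 0 t \<omega> = 0"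
    then obtain t where t: "u \<le> t" "t < v" "F 0 t \<omega> = 0" by blast
    obtain m where "1 / real (Suc m) < v - t" using nat_approx_posE[of "v - t"] t by auto
    then show "\<exists>m::nat. \<exists>t\<in>{u..v - 1 / real (Suc m)}. F 0 t \<omega> = 0"
      using t by (intro exI[of _ m] bexI[of _ t]) auto
  next
    assume "\<exists>m::nat. \<exists>t\<in>{u..v - 1 / real (Suc m)}. F 0 t \<omega> = 0"
    then obtain m :: nat and t where t: "u \<le> t" "t \<le> v - 1 / real (Suc m)" "F 0 t \<omega> = 0" by auto
    have "0 < 1 / real (Suc m)" by simp
    then show "\<exists>t. u \<le> t \<and> t < v \<and> F 0 t \<omega> = 0" using t by (intro exI[of _ t]) linarith
  qed
  then show ?thesis by simp
qed

text \<open>The probability space need not be complete, so the count is written as a limit at every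
  \<omega> and not just almost surely: where the zero set is infinite the cell counts are not
  Cauchy, and \<open>card\<close> returns 0. The endpoint T is treated apart, since \<open>D\<close>
  may or may not contain it.\<close>

lemma zero_count_measurable:
  assumes T: "0 < T" and D: "{0..<T} \<subseteq> D" "D \<subseteq> {0..T}"
  shows "(\<lambda>\<omega>. real (card {t \<in> D. F 0 t \<omega> = 0})) \<in> borel_measurable M"
proof -
  define Z where "Z \<omega> = {t. 0 \<le> t \<and> t < T \<and> F 0 t \<omega> = 0}" for \<omega>
  define N where "N n \<omega> = card {i. i < n \<and> (\<exists>t\<in>Z \<omega>. real i * (T / real n) \<le> t \<and> t < real (Suc i) * (T / real n))}" for n \<omega>
  have [measurable]: "(\<lambda>\<omega>. real (N n \<omega>)) \<in> borel_measurable M" for n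
  proof -
    have "(\<exists>t\<in>Z \<omega>. real i * (T / real n) \<le> t \<and> t < real (Suc i) * (T / real n))
      \<longleftrightarrow> (\<exists>t. max 0 (real i * (T / real n)) \<le> t \<and> t < min T (real (Suc i) * (T / real n)) \<and> F 0 t \<omega> = 0)" for i \<omega>
      unfolding Z_def by auto
    then have rep: "real (N n \<omega>) = (\<Sum>i<n. of_bool (\<exists>t. max 0 (real i * (T / real n)) \<le> t \<and> t < min T (real (Suc i) * (T / real n)) \<and> F 0 t \<omega> = 0))" for \<omega>
      unfolding N_def by (simp only: sum_of_bool_eq finite_lessThan Int_def lessThan_iff mem_Collect_eq)
    show ?thesis unfolding rep by measurable
  qed
  define e where "e \<longleftrightarrow> T \<in> D"
  have in_D: "t \<in> D \<longleftrightarrow> (0 \<le> t \<and> t < T) \<or> (t = T \<and> e)" for t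
    using subsetD[OF D(1), of t] subsetD[OF D(2), of t] by (cases "t = T") (auto simp: e_def)
  have ZT: "Z \<omega> \<subseteq> {0..<T}" for \<omega> by (auto simp: Z_def)
  have eq: "real (card {t \<in> D. F 0 t \<omega> = 0})
    = (if Cauchy (\<lambda>n. real (N n \<omega>)) then lim (\<lambda>n. real (N n \<omega>)) + of_bool (e \<and> F 0 T \<omega> = 0) else 0)" for \<omega>
  proof -
    have split: "{t \<in> D. F 0 t \<omega> = 0} = (if e \<and> F 0 T \<omega> = 0 then insert T (Z \<omega>) else Z \<omega>)"
      by (auto simp: Z_def in_D)
    show ?thesis
    proof (cases "finite (Z \<omega>)")
      case True
      from card_occupied_cells(1)[OF T ZT this]
      have lim: "(\<lambda>n. real (N n \<omega>)) \<longlonglongrightarrow> real (card (Z \<omega>))" unfolding N_def .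
      have "T \<notin> Z \<omega>" by (simp add: Z_def)
      then show ?thesis
        using True LIMSEQ_imp_Cauchy[OF lim] limI[OF lim] by (simp add: split)
    next
      case False
      from card_occupied_cells(2)[OF T ZT this]
      have "\<not> Cauchy (\<lambda>n. real (N n \<omega>))" unfolding N_def Cauchy_convergent_iff .
      then show ?thesis using False by (simp add: split)
    qed
  qed
  show ?thesis unfolding eq by measurable
qed

lemma AE_F_nonzero: "AE \<omega> in M. F 0 t \<omega> \<noteq> 0"
proof (rule AE_I)
  show "{\<omega> \<in> space M. \<not> F 0 t \<omega> \<noteq> 0} \<subseteq> {\<omega> \<in> space M. \<bar>F 0 t \<omega>\<bar> \<le> 0}" by auto
  have "prob {\<omega> \<in> space M. \<bar>F 0 t \<omega>\<bar> \<le> 0} \<le> 0" by (rule prob_F_small) simp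
  then show "emeasure M {\<omega> \<in> space M. \<bar>F 0 t \<omega>\<bar> \<le> 0} = 0"
    by (simp add: emeasure_eq_measure measure_le_0_iff)
qed measurable

text \<open>Near a double zero \<open>F 0\<close> is of order \<open>1 / n\<^sup>2\<close> at some point of the grid of mesh \<open>1 / n\<close>.\<close>

lemma AE_no_double_zero_bounded:
  fixes B :: nat
  shows "AE \<omega> in M. \<not> ((\<forall>s\<in>{0..1}. \<bar>F 2 s \<omega>\<bar> \<le> real B) \<and> (\<exists>t\<in>{0..1}. F 0 t \<omega> = 0 \<and> F 1 t \<omega> = 0))"
proof -
  define U where "U n = (\<Union>i\<in>{..Suc n}. {\<omega> \<in> space M. \<bar>F 0 (real i / real (Suc n)) \<omega>\<bar> \<le> real B * (1 / real (Suc n))\<^sup>2})" for n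
  have U_sets [measurable]: "U n \<in> sets M" for n unfolding U_def by measurable
  \<comment> \<open>There are n + 2 grid points, each with probability at most B / (n + 1)^2, so the
    union has probability O(B / n).\<close>
  have U_prob: "prob (U n) \<le> 2 * real B * (1 / real (Suc n))" for n
  proof -
    have "prob (U n) \<le> (\<Sum>i\<in>{..Suc n}. prob {\<omega> \<in> space M. \<bar>F 0 (real i / real (Suc n)) \<omega>\<bar> \<le> real B * (1 / real (Suc n))\<^sup>2})"
      unfolding U_def by (rule measure_UNION_le) auto
    also have "\<dots> \<le> (\<Sum>i\<in>{..Suc n}. real B * (1 / real (Suc n))\<^sup>2)"
      by (intro sum_mono prob_F_small) auto
    also have "\<dots> = real (Suc (Suc n)) * (real B * (1 / real (Suc n))\<^sup>2)" by simp
    also have "\<dots> \<le> (2 * real (Suc n)) * (real B * (1 / real (Suc n))\<^sup>2)"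
      by (intro mult_right_mono) auto
    also have "\<dots> = 2 * real B * (1 / real (Suc n))"
    proof -
      have cancel: "(2 * x) * (r * (1 / x)\<^sup>2) = 2 * r * (1 / x)" if "0 < x" for x r :: real
        using that by (simp add: power2_eq_square)
      show ?thesis by (rule cancel) simp
    qed
    finally show ?thesis .
  qed
  show ?thesis
  proof (rule AE_I)
    \<comment> \<open>The exceptional event lies in every \<open>U n\<close>, hence in the
      intersection, which is null because the probabilities tend to 0.\<close>
    show "(\<Inter>n. U n) \<in> sets M" by measurable
    have "prob (\<Inter>n. U n) \<le> 2 * real B * (1 / real (Suc n))" for n
      by (rule order_trans[OF finite_measure_mono U_prob]) auto
    moreover have "(\<lambda>n. 2 * real B * (1 / real (Suc n))) \<longlonglongrightarrow> 2 * real B * 0"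
      by (intro tendsto_mult tendsto_const LIMSEQ_Suc lim_1_over_n)
    ultimately have "prob (\<Inter>n. U n) \<le> 2 * real B * 0"
      by (intro LIMSEQ_le_const) auto
    then show "emeasure M (\<Inter>n. U n) = 0"
      by (simp add: emeasure_eq_measure measure_le_0_iff)
    show "{\<omega> \<in> space M. \<not> \<not> ((\<forall>s\<in>{0..1}. \<bar>F 2 s \<omega>\<bar> \<le> real B) \<and> (\<exists>t\<in>{0..1}. F 0 t \<omega> = 0 \<and> F 1 t \<omega> = 0))} \<subseteq> (\<Inter>n. U n)"
    proof (intro subsetI INT_I)
      fix \<omega> n assume "\<omega> \<in> {\<omega> \<in> space M. \<not> \<not> ((\<forall>s\<in>{0..1}. \<bar>F 2 s \<omega>\<bar> \<le> real B) \<and> (\<exists>t\<in>{0..1}. F 0 t \<omega> = 0 \<and> F 1 t \<omega> = 0))}"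
      then obtain t where \<omega>: "\<omega> \<in> space M" and B: "\<And>s. s \<in> {0..1} \<Longrightarrow> \<bar>F 2 s \<omega>\<bar> \<le> real B"
        and t: "t \<in> {0..1}" "F 0 t \<omega> = 0" "F 1 t \<omega> = 0" by auto
      define i where "i = nat \<lfloor>t * real (Suc n)\<rfloor>"
      have t0: "0 \<le> t * real (Suc n)" using t by simp
      have ri: "real i = of_int \<lfloor>t * real (Suc n)\<rfloor>" using t0 by (simp add: i_def del: of_nat_Suc)
      have i: "real i \<le> t * real (Suc n)" "t * real (Suc n) < real i + 1" unfolding ri by linarith+
      have "t * real (Suc n) \<le> 1 * real (Suc n)" using t by (intro mult_right_mono) auto
      then have "real i \<le> real (Suc n)" unfolding mult_1 by (rule order_trans[OF i(1)])
      then have "i \<le> Suc n" unfolding of_nat_le_iff .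
      have s: "real i / real (Suc n) \<in> {0..1}" using \<open>i \<le> Suc n\<close> by (auto simp: divide_le_eq)
      have "\<bar>real i - t * real (Suc n)\<bar> \<le> 1" using i by simp
      then have "\<bar>real i - t * real (Suc n)\<bar> / real (Suc n) \<le> 1 / real (Suc n)" by (rule divide_right_mono) simp
      moreover have "\<bar>real i - t * real (Suc n)\<bar> / real (Suc n) = \<bar>real i / real (Suc n) - t\<bar>"
      proof -
        have "(real i - t * real (Suc n)) / real (Suc n) = real i / real (Suc n) - t"
          by (simp only: diff_divide_distrib) simp
        then show ?thesis by (metis abs_divide abs_of_nat)
      qed
      ultimately have close: "\<bar>real i / real (Suc n) - t\<bar> \<le> 1 / real (Suc n)" by simp
      have "\<bar>F 0 (real i / real (Suc n)) \<omega>\<bar> \<le> real B * (1 / real (Suc n))\<^sup>2"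
        by (rule double_zero_quadratic_bound[where f = "\<lambda>t. F 0 t \<omega>",
              OF F_deriv[of 0, folded One_nat_def] F_deriv[of 1, unfolded Suc_1] B t s close])
      then show "\<omega> \<in> U n" using \<omega> \<open>i \<le> Suc n\<close> unfolding U_def by auto
    qed
  qed
qed

text \<open>On [0, 1] the second derivative is bounded by some natural number depending on \<omega>,
  and countably many null sets may be united.\<close>

lemma AE_no_double_zero: "AE \<omega> in M. \<forall>t\<in>{0..1}. F 0 t \<omega> \<noteq> 0 \<or> F 1 t \<omega> \<noteq> 0"
proof -
  have "AE \<omega> in M. \<forall>B::nat. \<not> ((\<forall>s\<in>{0..1}. \<bar>F 2 s \<omega>\<bar> \<le> real B) \<and> (\<exists>t\<in>{0..1}. F 0 t \<omega> = 0 \<and> F 1 t \<omega> = 0))"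
    unfolding AE_all_countable using AE_no_double_zero_bounded by blast
  then show ?thesis
  proof eventually_elim
    fix \<omega> assume *: "\<forall>B::nat. \<not> ((\<forall>s\<in>{0..1}. \<bar>F 2 s \<omega>\<bar> \<le> real B) \<and> (\<exists>t\<in>{0..1}. F 0 t \<omega> = 0 \<and> F 1 t \<omega> = 0))"
    have "continuous_on {0..1} (\<lambda>t. F 2 t \<omega>)"
      using F_isCont by (intro continuous_at_imp_continuous_on) auto
    then have "bounded ((\<lambda>t. F 2 t \<omega>) ` {0..1})"
      by (intro compact_imp_bounded compact_continuous_image) auto
    then obtain C where "\<forall>x\<in>(\<lambda>t. F 2 t \<omega>) ` {0..1}. norm x \<le> C" unfolding bounded_iff by blast
    then have C: "\<And>s. s \<in> {0..1} \<Longrightarrow> \<bar>F 2 s \<omega>\<bar> \<le> C" by simp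
    have "\<bar>F 2 s \<omega>\<bar> \<le> real (nat \<lceil>C\<rceil>)" if "s \<in> {0..1}" for s
      using C[OF that] by linarith
    then show "\<forall>t\<in>{0..1}. F 0 t \<omega> \<noteq> 0 \<or> F 1 t \<omega> \<noteq> 0" using * by blast
  qed
qed

text \<open>Supplies the domination of the sign change counts by the zero count. Finiteness matters
  because \<open>card\<close> of an infinite set is 0.\<close>

lemma crossings_le_zeros:
  assumes h: "0 < h" and A: "\<And>i. i \<in> A \<Longrightarrow> real (Suc i) * h \<le> T"
    and fin: "finite {t. 0 \<le> t \<and> t < T \<and> F 0 t \<omega> = 0}"
  shows "crossings h A \<omega> \<le> card {t. 0 \<le> t \<and> t < T \<and> F 0 t \<omega> = 0}"
proof -
  let ?C = "{i \<in> A. crossing h i \<omega>}"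
  have cr: "F 0 (real i * h) \<omega> * F 0 (real (Suc i) * h) \<omega> < 0" if "i \<in> ?C" for i
    using that by (simp add: crossing_def)
  obtain \<zeta> where \<zeta>: "inj_on \<zeta> ?C"
    "\<forall>i\<in>?C. real i * h < \<zeta> i \<and> \<zeta> i < real (Suc i) * h \<and> F 0 (\<zeta> i) \<omega> = 0"
    using sign_changes_give_zeros[of "\<lambda>t. F 0 t \<omega>", OF F_isCont h cr] by blast
  have "\<zeta> i \<in> {t. 0 \<le> t \<and> t < T \<and> F 0 t \<omega> = 0}" if i: "i \<in> ?C" for i
  proof -
    have "0 \<le> real i * h" using h by simp
    then show ?thesis using \<zeta>(2) i A[of i] by force
  qed
  then show ?thesis
    unfolding crossings_def by (intro card_inj_on_le[OF \<zeta>(1) _ fin]) auto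
qed

text \<open>Almost surely the sign change counts on refining grids are eventually equal to the zero
  count and never exceed it. Fatou with the uniform second moment gives square integrability; the
  count itself then dominates, and both moments converge. Allowing any \<open>D\<close> between the
  half-open and the closed interval covers arcs shorter than a period as well as a full
  period.\<close>

theorem variance_zero_count:
  assumes T: "0 < T" "T \<le> 1" and D: "{0..<T} \<subseteq> D" "D \<subseteq> {0..T}"
  shows "integrable M (\<lambda>\<omega>. (real (card {t \<in> D. F 0 t \<omega> = 0}))\<^sup>2)"
    and "variance (\<lambda>\<omega>. real (card {t \<in> D. F 0 t \<omega> = 0})) \<le> 2 * 10 ^ 13 * K\<^sup>2 * real \<kappa> / real (card J)"
proof -
  define Z where "Z \<omega> = real (card {t \<in> D. F 0 t \<omega> = 0})" for \<omega>
  have Z_meas [measurable]: "Z \<in> borel_measurable M"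
    unfolding Z_def[abs_def] by (rule zero_count_measurable[OF T(1) D])
  \<comment> \<open>Rounding up costs at most 1 \<le> K, within the margin 3330 - 3328.\<close>
  define p where "p = nat \<lceil>3328 * K\<rceil>"
  have p: "3328 * K \<le> real p" "real p \<le> 3330 * K" using K_ge_1 unfolding p_def by linarith+
  have p0: "0 < p" using p K_ge_1 by (cases p) auto
  \<comment> \<open>The grids refine the p macroscopic cells; \<open>Suc\<close> keeps the number of
    subdivisions positive.\<close>
  define n where "n q = p * Suc q" for q
  have n0: "0 < n q" for q using p0 by (simp add: n_def)
  define A where "A q = {i. i < n q \<and> real (Suc i) * (1 / real (n q)) \<le> T}" for q
  define S where "S q \<omega> = real (crossings (1 / real (n q)) (A q) \<omega>)" for q \<omega>
  have A: "A q \<subseteq> {..<p * Suc q}" "finite (A q)" for q by (auto simp: A_def n_def)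
  have hq: "1 / real (n q) = 1 / (real p * real (Suc q))" for q by (simp add: n_def distrib_left)
  have S_meas [measurable]: "S q \<in> borel_measurable M" for q
    unfolding S_def[abs_def] by (rule crossings_measurable[OF A(2)])
  have n_top: "filterlim n at_top sequentially"
  proof (rule filterlim_at_top_mono[OF filterlim_ident])
    show "\<forall>\<^sub>F q in sequentially. q \<le> n q"
    proof (rule always_eventually, rule allI)
      fix q
      have "1 * q \<le> p * Suc q" using p0 by (intro mult_mono) auto
      then show "q \<le> n q" by (simp add: n_def)
    qed
  qed
  have good: "AE \<omega> in M. (\<forall>\<^sub>F q in sequentially. S q \<omega> = Z \<omega>) \<and> (\<forall>q. S q \<omega> \<le> Z \<omega>)"
  proof -
    have "AE \<omega> in M. \<forall>i n'. F 0 (real i * (1 / real n')) \<omega> \<noteq> 0"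
      unfolding AE_all_countable using AE_F_nonzero by blast
    with AE_F_nonzero[of T] AE_no_double_zero show ?thesis
    proof eventually_elim
      fix \<omega>
      assume g: "F 0 T \<omega> \<noteq> 0" "\<forall>t\<in>{0..1}. F 0 t \<omega> \<noteq> 0 \<or> F 1 t \<omega> \<noteq> 0" "\<forall>i n'. F 0 (real i * (1 / real n')) \<omega> \<noteq> 0"
      let ?Z = "{t. 0 \<le> t \<and> t < T \<and> F 0 t \<omega> = 0}"
      have "{t \<in> D. F 0 t \<omega> = 0} = ?Z"
      proof (intro Collect_cong)
        fix t
        show "(t \<in> D \<and> F 0 t \<omega> = 0) = (0 \<le> t \<and> t < T \<and> F 0 t \<omega> = 0)"
          using subsetD[OF D(1), of t] subsetD[OF D(2), of t] g(1) by (cases "t = T") auto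
      qed
      then have Z: "Z \<omega> = real (card ?Z)" by (simp add: Z_def)
      have d: "((\<lambda>t. F 0 t \<omega>) has_real_derivative F 1 t \<omega>) (at t)" for t using F_deriv[of 0 \<omega> t] by simp
      have "\<forall>\<^sub>F n' in sequentially. card {i. i < n' \<and> real (Suc i) * (1 / real n') \<le> T
          \<and> F 0 (real i * (1 / real n')) \<omega> * F 0 (real (Suc i) * (1 / real n')) \<omega> < 0} = card ?Z"
        using g by (intro eventually_sign_changes_eq_zeros[where f = "\<lambda>t. F 0 t \<omega>", OF d T]) auto
      then have "\<forall>\<^sub>F q in sequentially. card {i. i < n q \<and> real (Suc i) * (1 / real (n q)) \<le> T
          \<and> F 0 (real i * (1 / real (n q))) \<omega> * F 0 (real (Suc i) * (1 / real (n q))) \<omega> < 0} = card ?Z"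
        by (rule eventually_compose_filterlim[OF _ n_top])
      then have "\<forall>\<^sub>F q in sequentially. S q \<omega> = Z \<omega>"
      proof eventually_elim
        fix q
        assume e: "card {i. i < n q \<and> real (Suc i) * (1 / real (n q)) \<le> T
          \<and> F 0 (real i * (1 / real (n q))) \<omega> * F 0 (real (Suc i) * (1 / real (n q))) \<omega> < 0} = card ?Z"
        have "{i \<in> A q. crossing (1 / real (n q)) i \<omega>} = {i. i < n q \<and> real (Suc i) * (1 / real (n q)) \<le> T
          \<and> F 0 (real i * (1 / real (n q))) \<omega> * F 0 (real (Suc i) * (1 / real (n q))) \<omega> < 0}"
          unfolding A_def crossing_def by blast
        then show "S q \<omega> = Z \<omega>" unfolding S_def Z crossings_def using e by simp
      qed
      moreover have "S q \<omega> \<le> Z \<omega>" for q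
      proof -
        have "finite {t \<in> {0..1}. F 0 t \<omega> = 0}" using g(2) by (intro finite_simple_zeros[OF d]) auto
        then have "finite ?Z" by (rule finite_subset[rotated]) (use T in auto)
        then show ?thesis
          unfolding S_def Z of_nat_le_iff using n0[of q] by (intro crossings_le_zeros) (auto simp: A_def)
      qed
      ultimately show "(\<forall>\<^sub>F q in sequentially. S q \<omega> = Z \<omega>) \<and> (\<forall>q. S q \<omega> \<le> Z \<omega>)" by blast
    qed
  qed
  then have lim: "AE \<omega> in M. (\<lambda>q. S q \<omega>) \<longlonglongrightarrow> Z \<omega>" and le: "AE \<omega> in M. \<forall>q. S q \<omega> \<le> Z \<omega>"
    by (auto elim!: eventually_mono intro: tendsto_eventually)
  have S_nn: "0 \<le> S q \<omega>" for q \<omega> by (simp add: S_def)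
  have Z_nn: "0 \<le> Z \<omega>" for \<omega> by (simp add: Z_def)
  have S2: "(\<integral>\<^sup>+ \<omega>. ennreal ((S q \<omega>)\<^sup>2) \<partial>M) \<le> ennreal (6 * (real p)\<^sup>2)" for q
  proof -
    have "(\<integral>\<^sup>+ \<omega>. ennreal ((S q \<omega>)\<^sup>2) \<partial>M) = ennreal (\<integral>\<omega>. (S q \<omega>)\<^sup>2 \<partial>M)"
      unfolding S_def by (intro nn_integral_eq_integral crossings_integrable[OF A(2)]) auto
    also have "\<dots> \<le> ennreal (6 * (real p)\<^sup>2)"
      unfolding S_def using second_moment_crossings[OF p(1) _ hq A(1)] by (intro ennreal_leI) simp
    finally show ?thesis .
  qed
  have "(\<integral>\<^sup>+ \<omega>. ennreal ((Z \<omega>)\<^sup>2) \<partial>M) \<le> (\<integral>\<^sup>+ \<omega>. liminf (\<lambda>q. ennreal ((S q \<omega>)\<^sup>2)) \<partial>M)"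
  proof (rule nn_integral_mono_AE)
    show "AE \<omega> in M. ennreal ((Z \<omega>)\<^sup>2) \<le> liminf (\<lambda>q. ennreal ((S q \<omega>)\<^sup>2))"
      using lim
    proof eventually_elim
      fix \<omega> assume "(\<lambda>q. S q \<omega>) \<longlonglongrightarrow> Z \<omega>"
      then have "(\<lambda>q. ennreal ((S q \<omega>)\<^sup>2)) \<longlonglongrightarrow> ennreal ((Z \<omega>)\<^sup>2)"
        by (intro tendsto_ennrealI tendsto_power)
      from lim_imp_Liminf[OF _ this]
      show "ennreal ((Z \<omega>)\<^sup>2) \<le> liminf (\<lambda>q. ennreal ((S q \<omega>)\<^sup>2))" by simp
    qed
  qed
  also have "\<dots> \<le> liminf (\<lambda>q. \<integral>\<^sup>+ \<omega>. ennreal ((S q \<omega>)\<^sup>2) \<partial>M)"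
    by (rule nn_integral_liminf) measurable
  also have "\<dots> \<le> ennreal (6 * (real p)\<^sup>2)"
    using S2 by (intro Liminf_le) auto
  finally have fin: "(\<integral>\<^sup>+ \<omega>. ennreal ((Z \<omega>)\<^sup>2) \<partial>M) < \<infinity>"
    by (rule le_less_trans) simp
  have int2: "integrable M (\<lambda>\<omega>. (Z \<omega>)\<^sup>2)"
    by (rule integrableI_nonneg) (use fin in auto)
  then show "integrable M (\<lambda>\<omega>. (real (card {t \<in> D. F 0 t \<omega> = 0}))\<^sup>2)"
    unfolding Z_def .
  have int1: "integrable M Z"
    by (rule square_integrable_imp_integrable[OF Z_meas int2])
  have lim2: "(\<lambda>q. \<integral>\<omega>. (S q \<omega>)\<^sup>2 \<partial>M) \<longlonglongrightarrow> (\<integral>\<omega>. (Z \<omega>)\<^sup>2 \<partial>M)"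
  proof (rule integral_dominated_convergence[where w = "\<lambda>\<omega>. (Z \<omega>)\<^sup>2"])
    show "AE \<omega> in M. (\<lambda>q. (S q \<omega>)\<^sup>2) \<longlonglongrightarrow> (Z \<omega>)\<^sup>2"
      using lim by eventually_elim (intro tendsto_power)
    show "AE \<omega> in M. norm ((S q \<omega>)\<^sup>2) \<le> (Z \<omega>)\<^sup>2" for q
      using le by eventually_elim (auto intro!: power_mono S_nn)
  qed (use int2 in auto)
  have lim1: "(\<lambda>q. \<integral>\<omega>. S q \<omega> \<partial>M) \<longlonglongrightarrow> (\<integral>\<omega>. Z \<omega> \<partial>M)"
  proof (rule integral_dominated_convergence[where w = Z])
    show "AE \<omega> in M. norm (S q \<omega>) \<le> Z \<omega>" for q
      using le by eventually_elim (use S_nn in auto)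
  qed (use int1 lim in auto)
  have "(\<lambda>q. (\<integral>\<omega>. (S q \<omega>)\<^sup>2 \<partial>M) - (\<integral>\<omega>. S q \<omega> \<partial>M)\<^sup>2) \<longlonglongrightarrow> (\<integral>\<omega>. (Z \<omega>)\<^sup>2 \<partial>M) - (\<integral>\<omega>. Z \<omega> \<partial>M)\<^sup>2"
    by (intro tendsto_diff tendsto_power lim1 lim2)
  moreover have "(\<integral>\<omega>. (S q \<omega>)\<^sup>2 \<partial>M) - (\<integral>\<omega>. S q \<omega> \<partial>M)\<^sup>2 \<le> 2 * 10 ^ 13 * K\<^sup>2 * real \<kappa> / real (card J)" for q
  proof -
    have "variance (S q) \<le> 2 * 10 ^ 13 * K\<^sup>2 * real \<kappa> / real (card J)"
      unfolding S_def[abs_def] by (rule variance_crossings[OF p _ hq A(1)]) simp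
    moreover have "variance (S q) = (\<integral>\<omega>. (S q \<omega>)\<^sup>2 \<partial>M) - (\<integral>\<omega>. S q \<omega> \<partial>M)\<^sup>2"
      unfolding S_def[abs_def] by (rule variance_eq[OF crossings_integrable[OF A(2)]])
    ultimately show ?thesis by simp
  qed
  ultimately have "(\<integral>\<omega>. (Z \<omega>)\<^sup>2 \<partial>M) - (\<integral>\<omega>. Z \<omega> \<partial>M)\<^sup>2 \<le> 2 * 10 ^ 13 * K\<^sup>2 * real \<kappa> / real (card J)"
    by (intro LIMSEQ_le_const2) auto
  moreover have "variance Z = (\<integral>\<omega>. (Z \<omega>)\<^sup>2 \<partial>M) - (\<integral>\<omega>. Z \<omega> \<partial>M)\<^sup>2"
    by (rule variance_eq[OF int1 int2])
  ultimately show "variance (\<lambda>\<omega>. real (card {t \<in> D. F 0 t \<omega> = 0})) \<le> 2 * 10 ^ 13 * K\<^sup>2 * real \<kappa> / real (card J)"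
    unfolding Z_def[abs_def] by simp
qed

end

section \<open>Restriction of the arithmetic wave to a closed geodesic\<close>

lemma torus_point_eq_iff: "torus_point x = torus_point y \<longleftrightarrow> x - y \<in> integer_lattice"
  by transfer simp

lemma wave_torus_point:
  "wave m c (torus_point x) = (\<Sum>\<mu>\<in>frequencies m. c \<mu> * exp (2 * of_real pi * \<i> * of_real (\<mu> \<bullet> x)))
     / of_real (sqrt (real (card (frequencies m))))"
  by transfer simp

lemma norm_sq_integer_lattice:
  assumes "x \<in> integer_lattice"
  shows "\<exists>n::nat. (norm x)\<^sup>2 = real n"
proof -
  have "(norm x)\<^sup>2 = (\<Sum>i\<in>UNIV. x $ i * x $ i)"
    by (simp add: power2_norm_eq_inner inner_vec_def)
  also have "\<dots> \<in> \<int>"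
    using assms unfolding integer_lattice_def by (intro Ints_sum Ints_mult) auto
  finally obtain z where z: "(norm x)\<^sup>2 = of_int z" by (auto elim: Ints_cases)
  then have "0 \<le> z" by (metis of_int_0_le_iff zero_le_power2)
  then show ?thesis using z by (intro exI[of _ "nat z"]) simp
qed

lemma integer_lattice_scale: "x \<in> integer_lattice \<Longrightarrow> n \<in> \<int> \<Longrightarrow> n *\<^sub>R x \<in> integer_lattice"
  by (simp add: integer_lattice_def)

lemma integer_lattice_diff: "x \<in> integer_lattice \<Longrightarrow> y \<in> integer_lattice \<Longrightarrow> x - y \<in> integer_lattice"
  by (simp add: integer_lattice_def)

text \<open>The vector \<open>v\<close> is the shortest lattice vector on the ray, so that the geodesic closes up exactly at \<open>v\<close>.\<close>

lemma rational_vector_primitive: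
  assumes "norm \<alpha> = 1" "rational_vector \<alpha>"
  shows "\<exists>v\<in>integer_lattice. v \<noteq> 0 \<and> \<alpha> = (1 / norm v) *\<^sub>R v \<and> (\<forall>s. s *\<^sub>R v \<in> integer_lattice \<longrightarrow> s \<in> \<int>)"
proof -
  obtain i where i: "\<alpha> $ i \<noteq> 0" "\<And>j. \<alpha> $ j / \<alpha> $ i \<in> \<rat>"
    using assms(2) unfolding rational_vector_def by blast
  have "\<exists>q::int. 0 < q \<and> of_int q * (\<alpha> $ j / \<alpha> $ i) \<in> \<int>" for j
  proof -
    obtain a b :: int where "0 < b" "\<alpha> $ j / \<alpha> $ i = of_int a / of_int b"
      using i(2)[of j] by (metis Rats_cases')
    then show ?thesis by (intro exI[of _ b]) simp
  qed
  then obtain q :: "3 \<Rightarrow> int" where q: "\<And>j. 0 < q j" "\<And>j. of_int (q j) * (\<alpha> $ j / \<alpha> $ i) \<in> \<int>" by metis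
  \<comment> \<open>A common denominator of the ratios gives a lattice vector on the line of
    \<alpha>; the sign is adjusted afterwards to land on the ray.\<close>
  define d where "d = (\<Prod>j\<in>UNIV. q j)"
  have d0: "0 < d" unfolding d_def using q by (intro prod_pos) auto
  have d: "of_int d * (\<alpha> $ j / \<alpha> $ i) \<in> \<int>" for j
  proof -
    have "d = q j * prod q (UNIV - {j})" unfolding d_def by (rule prod.remove) auto
    then have "of_int d * (\<alpha> $ j / \<alpha> $ i) = of_int (prod q (UNIV - {j})) * (of_int (q j) * (\<alpha> $ j / \<alpha> $ i))"
      by simp
    then show ?thesis using q(2)[of j] by (metis Ints_mult Ints_of_int)
  qed
  let ?A = "{s. 0 < s \<and> s *\<^sub>R \<alpha> \<in> integer_lattice}"
  have "(of_int d / \<alpha> $ i) *\<^sub>R \<alpha> \<in> integer_lattice" "(- (of_int d / \<alpha> $ i)) *\<^sub>R \<alpha> \<in> integer_lattice"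
    using d by (auto simp: integer_lattice_def)
  moreover have "0 < of_int d / \<alpha> $ i \<or> 0 < - (of_int d / \<alpha> $ i)"
    using d0 i(1) by (simp add: zero_less_divide_iff divide_less_0_iff) linarith
  ultimately obtain s0 where s0: "s0 \<in> ?A" by blast
  have norm_A: "(norm (s *\<^sub>R \<alpha>))\<^sup>2 = s\<^sup>2" for s using assms(1) by simp
  \<comment> \<open>Squared lengths of lattice vectors are natural numbers, so a shortest one on the
    ray exists.\<close>
  define n0 where "n0 = (LEAST n::nat. \<exists>s\<in>?A. s\<^sup>2 = real n)"
  have ex: "\<exists>n::nat. \<exists>s\<in>?A. s\<^sup>2 = real n"
  proof -
    obtain n :: nat where "(norm (s0 *\<^sub>R \<alpha>))\<^sup>2 = real n" using norm_sq_integer_lattice s0 by blast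
    then show ?thesis unfolding norm_A using s0 by (intro exI[of _ n] bexI[of _ s0])
  qed
  obtain P where P: "P \<in> ?A" "P\<^sup>2 = real n0"
    using LeastI_ex[OF ex] unfolding n0_def by blast
  have min: "P \<le> s" if "s \<in> ?A" for s
  proof -
    have "\<exists>n::nat. (norm (s *\<^sub>R \<alpha>))\<^sup>2 = real n" using that by (intro norm_sq_integer_lattice) simp
    then obtain n :: nat where n: "s\<^sup>2 = real n" unfolding norm_A by blast
    then have "n0 \<le> n" unfolding n0_def using that by (intro Least_le) blast
    then have "P\<^sup>2 \<le> s\<^sup>2" using P n by simp
    then show ?thesis by (rule power2_le_imp_le) (use that in simp)
  qed
  let ?v = "P *\<^sub>R \<alpha>"
  have v: "?v \<in> integer_lattice" "norm ?v = P" "0 < P" using P assms(1) by auto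
  show ?thesis
  proof (intro bexI[of _ ?v] conjI allI impI)
    show "?v \<noteq> 0" using v assms(1) by auto
    show "\<alpha> = (1 / norm ?v) *\<^sub>R ?v" using v by simp
    \<comment> \<open>If s were not an integer, its fractional part would give a lattice vector on
      the ray shorter than the shortest.\<close>
    fix s assume s: "s *\<^sub>R ?v \<in> integer_lattice"
    have "s *\<^sub>R ?v - of_int \<lfloor>s\<rfloor> *\<^sub>R ?v \<in> integer_lattice"
      by (rule integer_lattice_diff[OF s integer_lattice_scale[OF v(1)]]) simp
    then have f: "(frac s * P) *\<^sub>R \<alpha> \<in> integer_lattice"
      by (simp add: frac_def scaleR_left_diff_distrib[symmetric] left_diff_distrib)
    have "frac s = 0"
    proof (rule ccontr)
      assume "frac s \<noteq> 0"
      then have "0 < frac s" using frac_ge_0[of s] by linarith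
      then have "frac s * P \<in> ?A" using f v by simp
      then have "1 * P \<le> frac s * P" using min by simp
      then have "1 \<le> frac s" using v(3) by simp
      then show False using frac_lt_1[of s] by linarith
    qed
    then show "s \<in> \<int>" by (simp add: frac_eq_0_iff)
  qed (rule v(1))
qed

lemma finite_frequencies: "finite (frequencies m)"
  unfolding frequencies_eq by (rule finite_integer_lattice_sphere)

lemma frequencies_nonempty:
  assumes "sum_of_three_squares m"
  shows "frequencies m \<noteq> {}"
proof -
  obtain a b c :: int where "int m = a\<^sup>2 + b\<^sup>2 + c\<^sup>2" using assms unfolding sum_of_three_squares_def by blast
  then have "real_of_int (int m) = real_of_int (a\<^sup>2 + b\<^sup>2 + c\<^sup>2)" by (rule arg_cong)
  then have "real m = (of_int a)\<^sup>2 + (of_int b)\<^sup>2 + (of_int c)\<^sup>2" by simp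
  then have "vector [of_int a, of_int b, of_int c] \<in> frequencies m"
    by (auto simp: frequencies_def integer_lattice_def forall_3)
  then show ?thesis by blast
qed

lemma frequencies_uminus: "\<mu> \<in> frequencies m \<Longrightarrow> - \<mu> \<in> frequencies m"
  by (auto simp: frequencies_def integer_lattice_def)

lemma frequencies_nonzero: "0 < m \<Longrightarrow> \<mu> \<in> frequencies m \<Longrightarrow> \<mu> \<noteq> 0"
  by (auto simp: frequencies_def)

lemma norm_frequency: "\<mu> \<in> frequencies m \<Longrightarrow> norm \<mu> = sqrt (real m)"
  by (auto simp: frequencies_eq)

section \<open>Second moments of the lattice points on a sphere\<close>

definition flip :: "3 \<Rightarrow> real^3 \<Rightarrow> real^3" where
  "flip i \<mu> = (\<chi> l. if l = i then - \<mu> $ l else \<mu> $ l)"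

definition swap :: "3 \<Rightarrow> 3 \<Rightarrow> real^3 \<Rightarrow> real^3" where
  "swap i j \<mu> = (\<chi> l. if l = i then \<mu> $ j else if l = j then \<mu> $ i else \<mu> $ l)"

lemma frequencies_alt: "frequencies m = {\<mu> \<in> integer_lattice. (\<Sum>l\<in>UNIV. (\<mu> $ l)\<^sup>2) = real m}"
  by (simp add: frequencies_def sum_3)

lemma flip_frequencies: "\<mu> \<in> frequencies m \<Longrightarrow> flip i \<mu> \<in> frequencies m"
proof -
  assume \<mu>: "\<mu> \<in> frequencies m"
  have "(flip i \<mu> $ l)\<^sup>2 = (\<mu> $ l)\<^sup>2" for l by (simp add: flip_def)
  then show ?thesis using \<mu> by (auto simp: frequencies_alt integer_lattice_def) (simp add: flip_def)
qed

lemma flip_flip: "flip i (flip i \<mu>) = \<mu>"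
  by (simp add: flip_def vec_eq_iff)

lemma swap_swap: "swap i j (swap i j \<mu>) = \<mu>"
  by (simp add: swap_def vec_eq_iff)

lemma swap_frequencies: "\<mu> \<in> frequencies m \<Longrightarrow> swap i j \<mu> \<in> frequencies m"
  using exhaust_3[of i] exhaust_3[of j]
  by (auto simp: frequencies_def integer_lattice_def swap_def)

text \<open>Changing the sign of one coordinate permutes the frequencies and negates the
  product.\<close>

lemma sum_frequencies_prod:
  assumes "i \<noteq> j"
  shows "(\<Sum>\<mu>\<in>frequencies m. \<mu> $ i * \<mu> $ j) = 0"
proof -
  have "(\<Sum>\<mu>\<in>frequencies m. \<mu> $ i * \<mu> $ j) = (\<Sum>\<mu>\<in>frequencies m. flip i \<mu> $ i * flip i \<mu> $ j)"
    by (rule sum.reindex_bij_witness[of _ "flip i" "flip i"]) (auto simp: flip_flip flip_frequencies)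
  also have "\<dots> = - (\<Sum>\<mu>\<in>frequencies m. \<mu> $ i * \<mu> $ j)"
    using assms by (simp add: flip_def sum_negf)
  finally show ?thesis by linarith
qed

text \<open>Interchanging coordinates permutes the frequencies, so the three coordinates share the
  total m N equally.\<close>

lemma sum_frequencies_square:
  "(\<Sum>\<mu>\<in>frequencies m. (\<mu> $ i)\<^sup>2) = real m * real (card (frequencies m)) / 3"
proof -
  let ?S = "\<lambda>i. \<Sum>\<mu>\<in>frequencies m. (\<mu> $ i)\<^sup>2"
  have eq: "?S i = ?S j" for i j
  proof -
    have "?S i = (\<Sum>\<mu>\<in>frequencies m. (swap i j \<mu> $ i)\<^sup>2)"
      by (rule sum.reindex_bij_witness[of _ "swap i j" "swap i j"]) (auto simp: swap_swap swap_frequencies)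
    then show ?thesis by (simp add: swap_def)
  qed
  have "?S 1 + ?S 2 + ?S 3 = (\<Sum>\<mu>\<in>frequencies m. (\<mu> $ 1)\<^sup>2 + (\<mu> $ 2)\<^sup>2 + (\<mu> $ 3)\<^sup>2)"
    by (simp add: sum.distrib)
  also have "\<dots> = (\<Sum>\<mu>\<in>frequencies m. real m)" by (intro sum.cong) (auto simp: frequencies_def)
  also have "\<dots> = real m * real (card (frequencies m))" by simp
  finally show ?thesis using eq[of i 1] eq[of i 2] eq[of i 3] by linarith
qed

text \<open>By the two symmetries the second moment matrix is a multiple of the identity. As a
  consequence \<open>second_moment\<close> holds with equality in every direction v.\<close>

lemma sum_frequencies_inner_square:
  "(\<Sum>\<mu>\<in>frequencies m. (\<mu> \<bullet> v)\<^sup>2) = real m * real (card (frequencies m)) * (norm v)\<^sup>2 / 3"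
proof -
  have "(\<Sum>\<mu>\<in>frequencies m. (\<mu> \<bullet> v)\<^sup>2)
      = (\<Sum>\<mu>\<in>frequencies m. \<Sum>i\<in>UNIV. \<Sum>j\<in>UNIV. (v $ i * v $ j) * (\<mu> $ i * \<mu> $ j))"
    by (intro sum.cong refl) (simp add: inner_vec_def power2_eq_square sum_product mult_ac)
  also have "\<dots> = (\<Sum>i\<in>UNIV. \<Sum>\<mu>\<in>frequencies m. \<Sum>j\<in>UNIV. (v $ i * v $ j) * (\<mu> $ i * \<mu> $ j))"
    by (rule sum.swap)
  also have "\<dots> = (\<Sum>i\<in>UNIV. \<Sum>j\<in>UNIV. \<Sum>\<mu>\<in>frequencies m. (v $ i * v $ j) * (\<mu> $ i * \<mu> $ j))"
    by (intro sum.cong refl) (rule sum.swap)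
  also have "\<dots> = (\<Sum>i\<in>UNIV. \<Sum>j\<in>UNIV. (v $ i * v $ j) * (\<Sum>\<mu>\<in>frequencies m. \<mu> $ i * \<mu> $ j))"
    by (simp only: sum_distrib_left)
  also have "\<dots> = (\<Sum>i\<in>UNIV. \<Sum>j\<in>UNIV. if j = i then (v $ i)\<^sup>2 * (real m * real (card (frequencies m)) / 3) else 0)"
    using sum_frequencies_square[of _ m] sum_frequencies_prod[of _ _ m]
    by (intro sum.cong refl) (auto simp: power2_eq_square)
  also have "\<dots> = (\<Sum>i\<in>UNIV. (v $ i)\<^sup>2) * (real m * real (card (frequencies m)) / 3)"
    by (simp add: sum_distrib_right)
  also have "(\<Sum>i\<in>UNIV. (v $ i)\<^sup>2) = (norm v)\<^sup>2"
    unfolding power2_norm_eq_inner by (simp add: inner_vec_def power2_eq_square)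
  finally show ?thesis by simp
qed

text \<open>The lexicographically positive frequencies: for m > 0 one from each antipodal pair, so
  that the coefficients on them are independent.\<close>

definition half_frequencies :: "nat \<Rightarrow> (real^3) set" where
  "half_frequencies m = {\<mu> \<in> frequencies m. 0 < \<mu> $ 1 \<or> (\<mu> $ 1 = 0 \<and> (0 < \<mu> $ 2 \<or> (\<mu> $ 2 = 0 \<and> 0 < \<mu> $ 3)))}"

lemma half_frequencies:
  shows "half_frequencies m \<subseteq> frequencies m" "finite (half_frequencies m)"
    and "\<mu> \<in> half_frequencies m \<Longrightarrow> - \<mu> \<notin> half_frequencies m"
proof -
  show "half_frequencies m \<subseteq> frequencies m" by (auto simp: half_frequencies_def)
  then show "finite (half_frequencies m)" by (rule finite_subset) (rule finite_frequencies)
qed (auto simp: half_frequencies_def)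

lemma half_frequencies_union:
  assumes "0 < m"
  shows "frequencies m = half_frequencies m \<union> uminus ` half_frequencies m"
proof -
  have "\<mu> \<in> half_frequencies m \<or> - \<mu> \<in> half_frequencies m" if \<mu>: "\<mu> \<in> frequencies m" for \<mu>
  proof -
    have "\<not> (\<mu> $ 1 = 0 \<and> \<mu> $ 2 = 0 \<and> \<mu> $ 3 = 0)"
      using frequencies_nonzero[OF assms \<mu>] by (auto simp: vec_eq_iff forall_3)
    then show ?thesis using \<mu> frequencies_uminus[OF \<mu>] unfolding half_frequencies_def by auto
  qed
  then show ?thesis
    using half_frequencies(1)[of m] frequencies_uminus[of _ m] by (force simp: image_iff)
qed

lemma sum_frequencies_half:
  fixes g :: "real^3 \<Rightarrow> 'b :: comm_monoid_add"
  assumes "0 < m"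
  shows "(\<Sum>\<mu>\<in>frequencies m. g \<mu>) = (\<Sum>\<mu>\<in>half_frequencies m. g \<mu> + g (- \<mu>))"
proof -
  have "(\<Sum>\<mu>\<in>frequencies m. g \<mu>) = (\<Sum>\<mu>\<in>half_frequencies m. g \<mu>) + (\<Sum>\<mu>\<in>uminus ` half_frequencies m. g \<mu>)"
    unfolding half_frequencies_union[OF assms]
    using half_frequencies(2)[of m] half_frequencies(3)[of _ m] by (intro sum.union_disjoint) auto
  also have "(\<Sum>\<mu>\<in>uminus ` half_frequencies m. g \<mu>) = (\<Sum>\<mu>\<in>half_frequencies m. g (- \<mu>))"
    by (subst sum.reindex) (auto simp: inj_on_def)
  finally show ?thesis by (simp add: sum.distrib)
qed

lemma card_frequencies: "0 < m \<Longrightarrow> card (frequencies m) = 2 * card (half_frequencies m)"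
  using sum_frequencies_half[of m "\<lambda>_. 1 :: nat"] by simp

lemma card_plane_le_kappa:
  assumes "v \<noteq> 0" "X \<subseteq> integer_lattice \<inter> sphere 0 R \<inter> {x. v \<bullet> x = r}"
  shows "card X \<le> kappa R"
proof -
  let ?P = "{x. v \<bullet> x = r}"
  have "aff_dim ?P = 2" using assms(1) by (simp add: aff_dim_hyperplane)
  moreover have "affine ?P" by (rule affine_hyperplane)
  ultimately have "card (integer_lattice \<inter> sphere 0 R \<inter> ?P) \<le> kappa R"
    unfolding kappa_def by (intro Max_ge kappa_set(1)) blast
  moreover have "card X \<le> card (integer_lattice \<inter> sphere 0 R \<inter> ?P)"
    using finite_integer_lattice_sphere[of R] by (intro card_mono[OF _ assms(2)]) auto
  ultimately show ?thesis by simp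
qed

section \<open>Characteristic function of the coefficients\<close>

lemma (in prob_space) char_scaled_normal:
  assumes "distributed M lborel X (normal_density 0 (1 / sqrt 2))"
  shows "(\<integral>\<omega>. iexp (sqrt 2 * r * X \<omega>) \<partial>M) = of_real (exp (- r\<^sup>2 / 2))"
proof -
  have "distributed M lborel (\<lambda>x. 0 + sqrt 2 * X x) (normal_density (0 + sqrt 2 * 0) (\<bar>sqrt 2\<bar> * (1 / sqrt 2)))"
    using assms by (rule normal_density_affine) auto
  then have d: "distributed M lborel (\<lambda>x. sqrt 2 * X x) std_normal_density" by simp
  have X: "X \<in> borel_measurable M" using distributed_measurable[OF assms] by simp
  have "distr M borel (\<lambda>x. sqrt 2 * X x) = distr M lborel (\<lambda>x. sqrt 2 * X x)"
    by (rule distr_cong) auto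
  also have "\<dots> = std_normal_distribution"
    using distributed_distr_eq_density[OF d] .
  finally have law: "distr M borel (\<lambda>x. sqrt 2 * X x) = std_normal_distribution" .
  have "(\<integral>\<omega>. iexp (sqrt 2 * r * X \<omega>) \<partial>M) = char (distr M borel (\<lambda>x. sqrt 2 * X x)) r"
    unfolding char_def using X by (subst integral_distr) (auto simp: mult_ac)
  then show ?thesis unfolding law char_std_normal_distribution .
qed

lemma (in prob_space) char_standard_complex_gaussian:
  assumes "standard_complex_gaussian M Z"
  shows "(\<integral>\<omega>. iexp (Re (w * (of_real (sqrt 2) * Z \<omega>))) \<partial>M) = of_real (exp (- (cmod w)\<^sup>2 / 2))"
proof -
  have ind: "indep_var borel (\<lambda>\<omega>. Re (Z \<omega>)) borel (\<lambda>\<omega>. Im (Z \<omega>))"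
    and X: "distributed M lborel (\<lambda>\<omega>. Re (Z \<omega>)) (normal_density 0 (1 / sqrt 2))"
    and Y: "distributed M lborel (\<lambda>\<omega>. Im (Z \<omega>)) (normal_density 0 (1 / sqrt 2))"
    using assms unfolding standard_complex_gaussian_def by auto
  have [measurable]: "(\<lambda>\<omega>. Re (Z \<omega>)) \<in> borel_measurable M" "(\<lambda>\<omega>. Im (Z \<omega>)) \<in> borel_measurable M"
    using distributed_measurable[OF X] distributed_measurable[OF Y] by auto
  have ind': "indep_var borel (\<lambda>\<omega>. iexp (sqrt 2 * Re w * Re (Z \<omega>))) borel (\<lambda>\<omega>. iexp (sqrt 2 * (- Im w) * Im (Z \<omega>)))"
    by (rule indep_var_compose[OF ind, unfolded comp_def]) measurable
  have "(\<integral>\<omega>. iexp (Re (w * (of_real (sqrt 2) * Z \<omega>))) \<partial>M)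
     = (\<integral>\<omega>. iexp (sqrt 2 * Re w * Re (Z \<omega>)) * iexp (sqrt 2 * (- Im w) * Im (Z \<omega>)) \<partial>M)"
  proof (intro Bochner_Integration.integral_cong refl)
    fix \<omega>
    have "Re (w * (of_real (sqrt 2) * Z \<omega>)) = sqrt 2 * Re w * Re (Z \<omega>) + sqrt 2 * (- Im w) * Im (Z \<omega>)"
      by (simp add: algebra_simps)
    then show "iexp (Re (w * (of_real (sqrt 2) * Z \<omega>))) = iexp (sqrt 2 * Re w * Re (Z \<omega>)) * iexp (sqrt 2 * (- Im w) * Im (Z \<omega>))"
      by (simp only: exp_add[symmetric] distrib_left[symmetric] of_real_add[symmetric])
  qed
  also have "\<dots> = (\<integral>\<omega>. iexp (sqrt 2 * Re w * Re (Z \<omega>)) \<partial>M) * (\<integral>\<omega>. iexp (sqrt 2 * (- Im w) * Im (Z \<omega>)) \<partial>M)"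
    by (rule indep_var_lebesgue_integral[OF ind']) (rule integrable_const_bound[of _ 1], auto)+
  also have "\<dots> = of_real (exp (- (Re w)\<^sup>2 / 2)) * of_real (exp (- (- Im w)\<^sup>2 / 2))"
    unfolding char_scaled_normal[OF X] char_scaled_normal[OF Y] ..
  also have "\<dots> = of_real (exp (- (cmod w)\<^sup>2 / 2))"
    unfolding of_real_mult[symmetric] by (simp add: exp_add[symmetric] cmod_power2 add_divide_distrib[symmetric])
  finally show ?thesis .
qed

text \<open>E|a|^2 = 1 gives real and imaginary parts of variance 1/2; the factor sqrt 2 makes them
  standard normal.\<close>

lemma half_frequencies_gaussian:
  assumes a: "wave_coefficients M m a"
  shows "gaussian_coefficients M (half_frequencies m) (\<lambda>\<mu> \<omega>. of_real (sqrt 2) * a \<mu> \<omega>)"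
proof -
  let ?H = "half_frequencies m"
  let ?b = "\<lambda>\<mu> \<omega>. of_real (sqrt 2) * a \<mu> \<omega>"
  interpret prob_space M using a unfolding wave_coefficients_def by simp
  have gauss: "standard_complex_gaussian M (a \<mu>)" if "\<mu> \<in> ?H" for \<mu>
    using a that half_frequencies(1)[of m] unfolding wave_coefficients_def by blast
  have ind: "indep_vars (\<lambda>_. borel) a ?H"
    using a half_frequencies(1)[of m] half_frequencies(3)[of _ m] unfolding wave_coefficients_def by blast
  have a_meas: "a \<mu> \<in> borel_measurable M" if "\<mu> \<in> ?H" for \<mu>
    using ind that unfolding indep_vars_def by blast
  show ?thesis
  proof
    show "finite ?H" by (rule half_frequencies(2))
    show "?b \<mu> \<in> borel_measurable M" if "\<mu> \<in> ?H" for \<mu>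
      using a_meas[OF that] by measurable
    fix z :: "real^3 \<Rightarrow> complex"
    let ?X = "\<lambda>\<mu> \<omega>. iexp (Re (z \<mu> * ?b \<mu> \<omega>))"
    have ind': "indep_vars (\<lambda>_. borel) ?X ?H"
      by (rule indep_vars_compose2[OF ind]) measurable
    have int: "integrable M (?X \<mu>)" if "\<mu> \<in> ?H" for \<mu>
      using a_meas[OF that] by (intro integrable_const_bound[of _ 1]) auto
    have "(\<integral>\<omega>. iexp (\<Sum>\<mu>\<in>?H. Re (z \<mu> * ?b \<mu> \<omega>)) \<partial>M) = (\<integral>\<omega>. (\<Prod>\<mu>\<in>?H. ?X \<mu> \<omega>) \<partial>M)"
      by (simp only: of_real_sum sum_distrib_left exp_sum[OF half_frequencies(2)])
    also have "\<dots> = (\<Prod>\<mu>\<in>?H. \<integral>\<omega>. ?X \<mu> \<omega> \<partial>M)"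
      by (rule indep_vars_lebesgue_integral[OF half_frequencies(2) ind' int])
    also have "\<dots> = (\<Prod>\<mu>\<in>?H. of_real (exp (- (cmod (z \<mu>))\<^sup>2 / 2)))"
      by (intro prod.cong refl char_standard_complex_gaussian gauss)
    also have "\<dots> = of_real (exp (\<Sum>\<mu>\<in>?H. - (cmod (z \<mu>))\<^sup>2 / 2))"
      by (simp only: of_real_prod exp_sum[OF half_frequencies(2)])
    also have "(\<Sum>\<mu>\<in>?H. - (cmod (z \<mu>))\<^sup>2 / 2) = - (\<Sum>\<mu>\<in>?H. (cmod (z \<mu>))\<^sup>2) / 2"
      by (simp only: sum_negf sum_divide_distrib[symmetric])
    finally show "(\<integral>\<omega>. iexp (\<Sum>\<mu>\<in>?H. Re (z \<mu> * ?b \<mu> \<omega>)) \<partial>M)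
        = of_real (exp (- (\<Sum>\<mu>\<in>?H. (cmod (z \<mu>))\<^sup>2) / 2))" .
  qed
qed

lemma inner_integer_lattice:
  assumes "\<mu> \<in> integer_lattice" "v \<in> integer_lattice"
  shows "\<mu> \<bullet> v = of_int \<lfloor>\<mu> \<bullet> v\<rfloor>"
proof -
  have "\<mu> \<bullet> v \<in> \<int>"
    using assms unfolding integer_lattice_def inner_vec_def by (auto intro!: Ints_sum Ints_mult)
  then show ?thesis by (auto elim: Ints_cases)
qed

text \<open>The bound K = |v| sqrt m is Cauchy-Schwarz, and it is at least 1 because a nonzero
  integer vector has length at least 1. Frequencies with the same integer \<mu> . v lie on one plane
  section of the sphere, so \<open>kappa\<close> bounds the multiplicity.\<close>

lemma half_frequencies_trig:
  assumes a: "wave_coefficients M m a" and m: "0 < m" "sum_of_three_squares m"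
    and v: "v \<in> integer_lattice" "v \<noteq> 0"
  shows "gaussian_trig M (half_frequencies m) (\<lambda>\<mu> \<omega>. of_real (sqrt 2) * a \<mu> \<omega>)
    (\<lambda>\<mu>. \<lfloor>\<mu> \<bullet> v\<rfloor>) (norm v * sqrt (real m)) (kappa (sqrt (real m)))"
proof -
  let ?H = "half_frequencies m"
  interpret gaussian_coefficients M ?H "\<lambda>\<mu> \<omega>. of_real (sqrt 2) * a \<mu> \<omega>"
    by (rule half_frequencies_gaussian[OF a])
  have k: "real_of_int \<lfloor>\<mu> \<bullet> v\<rfloor> = \<mu> \<bullet> v" if "\<mu> \<in> frequencies m" for \<mu>
    using that inner_integer_lattice[OF _ v(1), of \<mu>] by (simp add: frequencies_def)
  have HE: "\<mu> \<in> frequencies m" if "\<mu> \<in> ?H" for \<mu> using that half_frequencies(1) by blast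
  show ?thesis
  proof
    show "?H \<noteq> {}"
      using frequencies_nonempty[OF m(2)] half_frequencies_union[OF m(1)] by auto
    show "1 \<le> norm v * sqrt (real m)"
    proof -
      obtain n :: nat where n: "(norm v)\<^sup>2 = real n" using norm_sq_integer_lattice[OF v(1)] by blast
      have "n \<noteq> 0" using n v(2) by (intro notI) simp
      then have "1\<^sup>2 \<le> (norm v)\<^sup>2" using n by simp
      then have "1 \<le> norm v" by (rule power2_le_imp_le) simp
      moreover have "1 \<le> sqrt (real m)" using m(1) by simp
      ultimately have "1 * 1 \<le> norm v * sqrt (real m)" by (intro mult_mono) auto
      then show ?thesis by simp
    qed
    show "\<bar>real_of_int \<lfloor>\<mu> \<bullet> v\<rfloor>\<bar> \<le> norm v * sqrt (real m)" if "\<mu> \<in> ?H" for \<mu>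
    proof -
      have "\<bar>\<mu> \<bullet> v\<bar> \<le> norm \<mu> * norm v" by (rule Cauchy_Schwarz_ineq2)
      then show ?thesis unfolding k[OF HE[OF that]] norm_frequency[OF HE[OF that]] by (simp only: mult.commute)
    qed
    show "(norm v * sqrt (real m))\<^sup>2 * real (card ?H) \<le> 3 * (\<Sum>\<mu>\<in>?H. (real_of_int \<lfloor>\<mu> \<bullet> v\<rfloor>)\<^sup>2)"
    proof -
      have "(\<Sum>\<mu>\<in>?H. (real_of_int \<lfloor>\<mu> \<bullet> v\<rfloor>)\<^sup>2) = (\<Sum>\<mu>\<in>?H. (\<mu> \<bullet> v)\<^sup>2)"
        by (intro sum.cong refl) (simp only: k HE)
      \<comment> \<open>Cardinality and sum of squares both double from the half to the full set, so
        isotropy passes to the half.\<close>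
      moreover have "(\<Sum>\<mu>\<in>frequencies m. (\<mu> \<bullet> v)\<^sup>2) = 2 * (\<Sum>\<mu>\<in>?H. (\<mu> \<bullet> v)\<^sup>2)"
        unfolding sum_frequencies_half[OF m(1)] by (simp add: sum_distrib_left)
      ultimately have "6 * (\<Sum>\<mu>\<in>?H. (real_of_int \<lfloor>\<mu> \<bullet> v\<rfloor>)\<^sup>2) = 2 * (real m * real (card ?H) * (norm v)\<^sup>2)"
        using sum_frequencies_inner_square[of v m] unfolding card_frequencies[OF m(1)] by simp
      then show ?thesis by (simp add: power_mult_distrib mult_ac)
    qed
    show "card {\<nu> \<in> ?H. \<lfloor>\<nu> \<bullet> v\<rfloor> = \<lfloor>\<mu> \<bullet> v\<rfloor>} \<le> kappa (sqrt (real m))" if "\<mu> \<in> ?H" for \<mu>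
    proof (rule card_plane_le_kappa[OF v(2), of _ _ "\<mu> \<bullet> v"])
      show "{\<nu> \<in> ?H. \<lfloor>\<nu> \<bullet> v\<rfloor> = \<lfloor>\<mu> \<bullet> v\<rfloor>} \<subseteq> integer_lattice \<inter> sphere 0 (sqrt (real m)) \<inter> {x. v \<bullet> x = \<mu> \<bullet> v}"
      proof
        fix \<nu> assume \<nu>: "\<nu> \<in> {\<nu> \<in> ?H. \<lfloor>\<nu> \<bullet> v\<rfloor> = \<lfloor>\<mu> \<bullet> v\<rfloor>}"
        then have \<nu>H: "\<nu> \<in> ?H" and "\<lfloor>\<nu> \<bullet> v\<rfloor> = \<lfloor>\<mu> \<bullet> v\<rfloor>" by simp_all
        then have "\<nu> \<bullet> v = \<mu> \<bullet> v" by (metis k[OF HE[OF \<nu>H]] k[OF HE[OF that]])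
        then have "\<nu> \<in> {x. v \<bullet> x = \<mu> \<bullet> v}" by (simp add: inner_commute)
        moreover have "\<nu> \<in> integer_lattice \<inter> sphere 0 (sqrt (real m))"
          using HE[of \<nu>] \<nu> unfolding frequencies_eq by blast
        ultimately show "\<nu> \<in> integer_lattice \<inter> sphere 0 (sqrt (real m)) \<inter> {x. v \<bullet> x = \<mu> \<bullet> v}" by blast
      qed
    qed
  qed
qed

text \<open>The terms of \<mu> and -\<mu> are conjugate and add up to twice a real part, with phase
  2 pi k s because \<mu> . (s v) = k s. The normalisations agree: 2 / sqrt (2 card H) is sqrt 2
  times the constant \<open>c\<close>.\<close>

lemma wave_on_geodesic:
  assumes a: "wave_coefficients M m a" and m: "0 < m" "sum_of_three_squares m"
    and v: "v \<in> integer_lattice" "v \<noteq> 0" and \<omega>: "\<omega> \<in> space M"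
  shows "wave m (\<lambda>\<mu>. a \<mu> \<omega>) (torus_point (s *\<^sub>R v))
    = of_real (gaussian_trig.F (half_frequencies m) (\<lambda>\<mu> \<omega>. of_real (sqrt 2) * a \<mu> \<omega>) (\<lambda>\<mu>. \<lfloor>\<mu> \<bullet> v\<rfloor>) 0 s \<omega>)"
proof -
  let ?H = "half_frequencies m" and ?b = "\<lambda>\<mu> \<omega>. of_real (sqrt 2) * a \<mu> \<omega>" and ?k = "\<lambda>\<mu>. \<lfloor>\<mu> \<bullet> v\<rfloor>"
  interpret gaussian_trig M ?H ?b ?k "norm v * sqrt (real m)" "kappa (sqrt (real m))"
    by (rule half_frequencies_trig[OF a m v])
  have HE: "\<mu> \<in> frequencies m" if "\<mu> \<in> ?H" for \<mu> using that half_frequencies(1) by blast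
  have pair: "a \<mu> \<omega> * exp (2 * of_real pi * \<i> * of_real (\<mu> \<bullet> (s *\<^sub>R v)))
      + a (- \<mu>) \<omega> * exp (2 * of_real pi * \<i> * of_real (- \<mu> \<bullet> (s *\<^sub>R v)))
    = of_real (2 * Re (cis (2 * pi * of_int (?k \<mu>) * s) * a \<mu> \<omega>))" if "\<mu> \<in> ?H" for \<mu>
  proof -
    have "\<mu> \<bullet> v = of_int (?k \<mu>)"
      using HE[OF that] v(1) by (intro inner_integer_lattice) (auto simp: frequencies_def)
    then have ph: "\<mu> \<bullet> (s *\<^sub>R v) = of_int (?k \<mu>) * s" by (simp add: mult.commute)
    have e: "exp (2 * of_real pi * \<i> * of_real (\<mu> \<bullet> (s *\<^sub>R v))) = cis (2 * pi * of_int (?k \<mu>) * s)"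
      unfolding ph cis_conv_exp by (simp add: mult_ac)
    have e': "exp (2 * of_real pi * \<i> * of_real (- \<mu> \<bullet> (s *\<^sub>R v))) = cnj (cis (2 * pi * of_int (?k \<mu>) * s))"
      unfolding inner_minus_left ph cis_cnj by (simp add: cis_conv_exp mult_ac)
    have "a (- \<mu>) \<omega> = cnj (a \<mu> \<omega>)"
      using a HE[OF that] \<omega> unfolding wave_coefficients_def by blast
    then show ?thesis
      unfolding e e' by (simp add: complex_eq_iff algebra_simps)
  qed
  have sq: "sqrt (real (card (frequencies m))) = sqrt 2 * sqrt (real (card ?H))"
    unfolding card_frequencies[OF m(1)] by (simp add: real_sqrt_mult)
  have "wave m (\<lambda>\<mu>. a \<mu> \<omega>) (torus_point (s *\<^sub>R v))
    = (\<Sum>\<mu>\<in>?H. of_real (2 * Re (cis (2 * pi * of_int (?k \<mu>) * s) * a \<mu> \<omega>))) / of_real (sqrt 2 * sqrt (real (card ?H)))"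
    unfolding wave_torus_point sq sum_frequencies_half[OF m(1)]
    by (simp only: pair cong: sum.cong)
  also have "\<dots> = of_real ((\<Sum>\<mu>\<in>?H. 2 * Re (cis (2 * pi * of_int (?k \<mu>) * s) * a \<mu> \<omega>)) / (sqrt 2 * sqrt (real (card ?H))))"
    by (simp only: of_real_sum of_real_divide)
  also have "(\<Sum>\<mu>\<in>?H. 2 * Re (cis (2 * pi * of_int (?k \<mu>) * s) * a \<mu> \<omega>)) / (sqrt 2 * sqrt (real (card ?H))) = F 0 s \<omega>"
  proof -
    have "2 / (sqrt 2 * sqrt (real (card ?H))) = c * sqrt 2"
      unfolding c_def by (simp add: real_div_sqrt flip: divide_divide_eq_left)
    then have "2 * x / (sqrt 2 * sqrt (real (card ?H))) = c * sqrt 2 * x" for x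
      by (metis times_divide_eq_left)
    then have "(\<Sum>\<mu>\<in>?H. 2 * Re (cis (2 * pi * of_int (?k \<mu>) * s) * a \<mu> \<omega>)) / (sqrt 2 * sqrt (real (card ?H)))
      = (\<Sum>\<mu>\<in>?H. c * sqrt 2 * Re (cis (2 * pi * of_int (?k \<mu>) * s) * a \<mu> \<omega>))"
      by (simp only: sum_divide_distrib)
    also have "\<dots> = F 0 s \<omega>"
      unfolding F_def G_def dv_def by (intro sum.cong refl) (simp add: algebra_simps)
    finally show ?thesis .
  qed
  finally show ?thesis .
qed

text \<open>As v is primitive, s and t give the same torus point exactly when s - t is an integer,
  so the segment is the injective image of a part of one period. The parameter set depends only on v
  and L and has length at most 1, which is why the final bound is uniform in L.\<close>

lemma nodal_intersections_on_geodesic: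
  assumes v: "v \<noteq> 0" "\<And>s. s *\<^sub>R v \<in> integer_lattice \<Longrightarrow> s \<in> \<int>" "v \<in> integer_lattice" and L: "0 < L"
  shows "\<exists>T D. 0 < T \<and> T \<le> 1 \<and> {0..<T} \<subseteq> D \<and> D \<subseteq> {0..T} \<and>
    (\<forall>m a \<omega>. nodal_intersections m a ((1 / norm v) *\<^sub>R v) L \<omega>
       = card {s \<in> D. wave m (\<lambda>\<mu>. a \<mu> \<omega>) (torus_point (s *\<^sub>R v)) = 0})"
proof -
  let ?p = "\<lambda>s. torus_point (s *\<^sub>R v)"
  define l where "l = L / norm v"
  have l: "0 < l" using L v(1) by (simp add: l_def)
  have seg: "torus_segment ((1 / norm v) *\<^sub>R v) L = ?p ` {0..l}"
  proof -
    have "{0..l} = (\<lambda>t. t / norm v) ` {0..L}"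
    proof (intro equalityI subsetI)
      fix s assume "s \<in> {0..l}"
      then have "s * norm v \<in> {0..L}" using v(1) by (simp add: l_def field_simps)
      moreover have "s = (s * norm v) / norm v" using v(1) by simp
      ultimately show "s \<in> (\<lambda>t. t / norm v) ` {0..L}" by (rule rev_image_eqI)
    qed (auto simp: l_def divide_right_mono)
    then show ?thesis unfolding torus_segment_def by (simp add: image_image)
  qed
  \<comment> \<open>A segment shorter than the period keeps both ends; any other covers the whole
    closed geodesic, of which [0, 1) lists every point once.\<close>
  define D where "D = (if l < 1 then {0..l} else {0..<1})"
  define T where "T = min l 1"
  have eq_iff: "?p s = ?p t \<longleftrightarrow> s - t \<in> \<int>" for s t
    unfolding torus_point_eq_iff scaleR_left_diff_distrib[symmetric]
    using v(2)[of "s - t"] integer_lattice_scale[OF v(3), of "s - t"] by blast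
  have inj: "inj_on ?p D"
  proof (rule inj_onI)
    fix s t assume st: "s \<in> D" "t \<in> D" "?p s = ?p t"
    then obtain z where z: "s - t = of_int z" using eq_iff by (auto elim: Ints_cases)
    have "\<bar>s - t\<bar> < 1" using st(1,2) unfolding D_def by (auto split: if_splits)
    then have "z = 0" using z by linarith
    then show "s = t" using z by simp
  qed
  have img: "?p ` {0..l} = ?p ` D"
  proof (cases "l < 1")
    case False
    show ?thesis
    proof (intro equalityI subsetI)
      fix x assume "x \<in> ?p ` {0..l}"
      then obtain s where s: "x = ?p s" by blast
      have "?p s = ?p (frac s)" unfolding eq_iff by (simp add: frac_def)
      moreover have "frac s \<in> D" using False frac_lt_1[of s] by (simp add: D_def)
      ultimately show "x \<in> ?p ` D" using s by blast
    next
      fix x assume "x \<in> ?p ` D"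
      then show "x \<in> ?p ` {0..l}" using False by (auto simp: D_def)
    qed
  qed (simp add: D_def)
  show ?thesis
  proof (intro exI[of _ T] exI[of _ D] conjI allI)
    show "0 < T" "T \<le> 1" "{0..<T} \<subseteq> D" "D \<subseteq> {0..T}" using l by (auto simp: T_def D_def min_def)
    fix m a \<omega>
    have "{p \<in> torus_segment ((1 / norm v) *\<^sub>R v) L. wave m (\<lambda>\<mu>. a \<mu> \<omega>) p = 0}
        = ?p ` {s \<in> D. wave m (\<lambda>\<mu>. a \<mu> \<omega>) (?p s) = 0}"
      unfolding seg img by blast
    moreover have "inj_on ?p {s \<in> D. wave m (\<lambda>\<mu>. a \<mu> \<omega>) (?p s) = 0}"
      using inj by (rule inj_on_subset) auto
    ultimately show "nodal_intersections m a ((1 / norm v) *\<^sub>R v) L \<omega> = card {s \<in> D. wave m (\<lambda>\<mu>. a \<mu> \<omega>) (?p s) = 0}"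
      unfolding nodal_intersections_def by (simp add: card_image)
  qed
qed

theorem theorem1p2:
  fixes \<alpha> :: "real^3"
  assumes "norm \<alpha> = 1" and "rational_vector \<alpha>"
  shows "\<exists>C::real. \<forall>(L::real) (m::nat) (M::'w measure) (a :: real^3 \<Rightarrow> 'w \<Rightarrow> complex).
           0 < L \<longrightarrow> 0 < m \<longrightarrow> sum_of_three_squares m \<longrightarrow> wave_coefficients M m a \<longrightarrow>
             integrable M (\<lambda>\<omega>. (real (nodal_intersections m a \<alpha> L \<omega>))\<^sup>2) \<and>
             prob_space.variance M (\<lambda>\<omega>. real (nodal_intersections m a \<alpha> L \<omega>) / sqrt (real m))
               \<le> C * (real (kappa (sqrt (real m))) / real (card (frequencies m)))"
proof -
  obtain v where v: "v \<in> integer_lattice" "v \<noteq> 0" and \<alpha>: "\<alpha> = (1 / norm v) *\<^sub>R v"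
    and prim: "\<And>s. s *\<^sub>R v \<in> integer_lattice \<Longrightarrow> s \<in> \<int>"
    using rational_vector_primitive[OF assms] by blast
  show ?thesis
  \<comment> \<open>Dividing by m cancels the m in K^2 = |v|^2 m, and card H = N / 2 doubles the
    constant. The vector v was obtained from \<alpha> alone, so the constant depends only on
    \<alpha>.\<close>
  proof (intro exI[of _ "4 * 10 ^ 13 * (norm v)\<^sup>2"] allI impI)
    fix L :: real and m :: nat and M :: "'w measure" and a :: "real^3 \<Rightarrow> 'w \<Rightarrow> complex"
    assume L: "0 < L" and m: "0 < m" "sum_of_three_squares m" and a: "wave_coefficients M m a"
    let ?H = "half_frequencies m" and ?b = "\<lambda>\<mu> \<omega>. of_real (sqrt 2) * a \<mu> \<omega>" and ?k = "\<lambda>\<mu>. \<lfloor>\<mu> \<bullet> v\<rfloor>"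
    interpret gaussian_trig M ?H ?b ?k "norm v * sqrt (real m)" "kappa (sqrt (real m))"
      by (rule half_frequencies_trig[OF a m v])
    obtain T D where T: "0 < T" "T \<le> 1" and D: "{0..<T} \<subseteq> D" "D \<subseteq> {0..T}"
      and nodal: "\<And>m (a :: real^3 \<Rightarrow> 'w \<Rightarrow> complex) \<omega>. nodal_intersections m a ((1 / norm v) *\<^sub>R v) L \<omega>
         = card {s \<in> D. wave m (\<lambda>\<mu>. a \<mu> \<omega>) (torus_point (s *\<^sub>R v)) = 0}"
      using nodal_intersections_on_geodesic[OF v(2) prim v(1) L] by blast
    have count: "nodal_intersections m a \<alpha> L \<omega> = card {s \<in> D. F 0 s \<omega> = 0}" if "\<omega> \<in> space M" for \<omega>
      unfolding \<alpha> nodal wave_on_geodesic[OF a m v that] by simp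
    note bound = variance_zero_count[OF T D]
    have "integrable M (\<lambda>\<omega>. (real (nodal_intersections m a \<alpha> L \<omega>))\<^sup>2)"
      using bound(1) by (rule Bochner_Integration.integrable_cong[THEN iffD1, rotated -1]) (simp_all add: count)
    moreover have "variance (\<lambda>\<omega>. real (nodal_intersections m a \<alpha> L \<omega>) / sqrt (real m))
       = variance (\<lambda>\<omega>. real (card {s \<in> D. F 0 s \<omega> = 0})) / real m"
    proof -
      have E: "expectation (\<lambda>\<omega>. real (nodal_intersections m a \<alpha> L \<omega>) / sqrt (real m))
         = expectation (\<lambda>\<omega>. real (card {s \<in> D. F 0 s \<omega> = 0})) / sqrt (real m)"
        by (subst integral_divide_zero[symmetric], rule Bochner_Integration.integral_cong) (simp_all add: count)
      have sq: "(x / sqrt (real m) - y / sqrt (real m))\<^sup>2 = (x - y)\<^sup>2 / real m" for x y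
        unfolding diff_divide_distrib[symmetric] power_divide by simp
      show ?thesis
        unfolding E by (subst integral_divide_zero[symmetric], rule Bochner_Integration.integral_cong)
          (simp_all add: count sq)
    qed
    moreover have "variance (\<lambda>\<omega>. real (card {s \<in> D. F 0 s \<omega> = 0})) / real m
       \<le> (2 * 10 ^ 13 * (norm v * sqrt (real m))\<^sup>2 * real (kappa (sqrt (real m))) / real (card ?H)) / real m"
      using bound(2) by (rule divide_right_mono) simp
    moreover have "\<dots> = 4 * 10 ^ 13 * (norm v)\<^sup>2 * (real (kappa (sqrt (real m))) / real (card (frequencies m)))"
      unfolding card_frequencies[OF m(1)] using m(1) by (simp add: power_mult_distrib)
    ultimately show "integrable M (\<lambda>\<omega>. (real (nodal_intersections m a \<alpha> L \<omega>))\<^sup>2) \<and>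
        variance (\<lambda>\<omega>. real (nodal_intersections m a \<alpha> L \<omega>) / sqrt (real m))
          \<le> 4 * 10 ^ 13 * (norm v)\<^sup>2 * (real (kappa (sqrt (real m))) / real (card (frequencies m)))"
      by simp
  qed
qed

end
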